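(* If $\nu$ is a norm on $\mathbb{R}^2$ whose unit ball is not a parallelogram, then the critical locus $\mathcal{K}_\nu(1)$ is contained in a one-dimensional $(F,H)$-transversal $\mathcal{C}^1$-submanifold of $X$.
   Context: $X=\mathrm{SL}_2(\mathbb{R})/\mathrm{SL}_2(\mathbb{Z})$; $F=\{\operatorname{diag}(e^s,e^{-s}):s\in\mathbb{R}\}$, $H=\{\begin{pmatrix}1&\alpha\\0&1\end{pmatrix}:\alpha\in\mathbb{R}\}$. $\Delta_\nu$ is the smallest covolume of a lattice in $\mathbb{R}^2$ meeting $\{\nu<1\}$ only in $0$, and $\mathcal{K}_\nu(1)=\{\Lambda\in X:\Lambda\cap\{\nu<1/\sqrt{\Delta_\nu}\}=\{0\}\}$. A $\mathcal{C}^1$ submanifold $Z\subset X$ is $(F,H)$-transversal if at each $x\in Z$: $T_x(Fx)\not\subset T_xZ$ and $T_x(Hx)\not\subset T_xZ+T_x(Fx)$. *)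

theory Defs
  imports "HOL-Analysis.Analysis"
begin

definition SL2R :: "(real^2^2) set" where
  "SL2R = {g. det g = 1}"

definition SL2Z :: "(real^2^2) set" where
  "SL2Z = {g \<in> SL2R. \<forall>i j. g $ i $ j \<in> \<int>}"

definition Z2 :: "(real^2) set" where
  "Z2 = {v. \<forall>i. v $ i \<in> \<int>}"

definition act :: "real^2^2 \<Rightarrow> (real^2) set \<Rightarrow> (real^2) set" where
  "act g \<Lambda> = (\<lambda>v. g *v v) ` \<Lambda>"

definition orbit :: "(real^2^2) set \<Rightarrow> (real^2) set \<Rightarrow> (real^2) set set" where
  "orbit L x = (\<lambda>g. act g x) ` L"

text \<open>
  The coset \<open>g SL\<^sub>2(\<int>)\<close> is represented by the unimodular lattice \<open>g \<int>\<^sup>2\<close>; the lemma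
  \<open>act_Z2_eq_iff\<close> below says that this identifies \<open>SL\<^sub>2(\<real>)/SL\<^sub>2(\<int>)\<close> with the set \<open>X\<close> = \<open>space_X\<close>.
\<close>

definition space_X :: "(real^2) set set" where
  "space_X = orbit SL2R Z2"

definition F_group :: "(real^2^2) set" where
  "F_group = range (\<lambda>s. vector [vector [exp s, 0], vector [0, exp (- s)]])"

definition H_group :: "(real^2^2) set" where
  "H_group = range (\<lambda>\<alpha>. vector [vector [1, \<alpha>], vector [0, 1]])"


definition is_norm :: "(real^2 \<Rightarrow> real) \<Rightarrow> bool" where
  "is_norm \<nu> \<longleftrightarrow>
     (\<forall>v. 0 \<le> \<nu> v) \<and> (\<forall>v. \<nu> v = 0 \<longleftrightarrow> v = 0) \<and>
     (\<forall>c v. \<nu> (c *\<^sub>R v) = \<bar>c\<bar> * \<nu> v) \<and> (\<forall>v w. \<nu> (v + w) \<le> \<nu> v + \<nu> w)"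

definition parallelogram :: "(real^2) set \<Rightarrow> bool" where
  "parallelogram P \<longleftrightarrow>
     (\<exists>p a b. a \<noteq> b \<and> independent {a, b} \<and>
        P = {p + s *\<^sub>R a + t *\<^sub>R b | s t. s \<in> {0..1} \<and> t \<in> {0..1}})"

text \<open>
  The lattices in \<open>\<real>\<^sup>2\<close> are the sets \<open>g \<int>\<^sup>2\<close> with \<open>g\<close> invertible, and \<open>\<bar>det g\<bar>\<close> is the
  covolume of \<open>g \<int>\<^sup>2\<close>.
\<close>

definition critical_det :: "(real^2 \<Rightarrow> real) \<Rightarrow> real" where
  "critical_det \<nu> = Inf {\<bar>det g\<bar> | g. det g \<noteq> 0 \<and> act g Z2 \<inter> {v. \<nu> v < 1} = {0}}"

definition critical_locus :: "(real^2 \<Rightarrow> real) \<Rightarrow> (real^2) set set" where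
  "critical_locus \<nu> = {\<Lambda> \<in> space_X. \<Lambda> \<inter> {v. \<nu> v < 1 / sqrt (critical_det \<nu>)} = {0}}"


text \<open>
  The differentiable structure on \<open>X\<close> is the one for which \<open>g \<mapsto> g \<int>\<^sup>2\<close> is a local
  diffeomorphism from \<open>SL\<^sub>2(\<real>)\<close>, the latter being a hypersurface in the space of matrices.
  A (local, inverse) chart of \<open>X\<close> is therefore a map \<open>y \<mapsto> s(y) \<int>\<^sup>2\<close> that is injective on an
  open set \<open>V \<subseteq> \<real>\<^sup>3\<close>, where \<open>s\<close> is a \<open>C\<^sup>1\<close> immersion of \<open>V\<close> into the three-dimensional
  manifold \<open>SL\<^sub>2(\<real>)\<close>; its image is then open in \<open>X\<close>.
\<close>

definition C1_chart :: "(real^3) set \<Rightarrow> (real^3 \<Rightarrow> real^2^2) \<Rightarrow> bool" where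
  "C1_chart V s \<longleftrightarrow>
     open V \<and> s ` V \<subseteq> SL2R \<and>
     (\<exists>s'. (\<forall>y\<in>V. (s has_derivative blinfun_apply (s' y)) (at y) \<and> inj (blinfun_apply (s' y))) \<and>
           continuous_on V s') \<and>
     inj_on (\<lambda>y. act (s y) Z2) V"

definition C1_submanifold :: "nat \<Rightarrow> (real^2) set set \<Rightarrow> bool" where
  "C1_submanifold k Z \<longleftrightarrow>
     Z \<subseteq> space_X \<and>
     (\<forall>x\<in>Z. \<exists>V s E. C1_chart V s \<and> x \<in> (\<lambda>y. act (s y) Z2) ` V \<and>
        subspace E \<and> dim E = k \<and> {y \<in> V. act (s y) Z2 \<in> Z} = V \<inter> E)"

text \<open>
  The tangent space \<open>T\<^sub>x X\<close> is identified with the Lie algebra \<open>sl\<^sub>2(\<real>)\<close> by letting a matrix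
  \<open>v\<close> correspond to the velocity at time \<open>0\<close> of \<open>t \<mapsto> exp(t v) x\<close>. Every \<open>C\<^sup>1\<close> curve in \<open>X\<close>
  through \<open>x\<close> is, near time \<open>0\<close>, uniquely of the form \<open>t \<mapsto> \<gamma>(t) x\<close> with \<open>\<gamma>\<close> a \<open>C\<^sup>1\<close> curve in
  \<open>SL\<^sub>2(\<real>)\<close> and \<open>\<gamma>(0) = 1\<close>, and its velocity is \<open>\<gamma>'(0)\<close>. The definition also gives the right
  tangent space to an orbit of \<open>F\<close> or \<open>H\<close>, which is in general only an immersed submanifold:
  the orbits are the leaves of a foliation, so that a continuous curve in \<open>X\<close> with values in
  one orbit is continuous for the intrinsic topology of that orbit.
\<close>

definition tangent_space :: "(real^2) set set \<Rightarrow> (real^2) set \<Rightarrow> (real^2^2) set" where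
  "tangent_space S x =
     {v. \<exists>\<gamma> \<epsilon>. \<epsilon> > 0 \<and> \<gamma> 0 = mat 1 \<and> \<gamma> C1_differentiable_on {-\<epsilon><..<\<epsilon>} \<and>
        (\<forall>t\<in>{-\<epsilon><..<\<epsilon>}. \<gamma> t \<in> SL2R \<and> act (\<gamma> t) x \<in> S) \<and>
        (\<gamma> has_vector_derivative v) (at 0)}"

definition transversal :: "(real^2^2) set \<Rightarrow> (real^2^2) set \<Rightarrow> (real^2) set set \<Rightarrow> bool" where
  "transversal A B Z \<longleftrightarrow>
     (\<forall>x\<in>Z. \<not> tangent_space (orbit A x) x \<subseteq> tangent_space Z x \<and>
        \<not> tangent_space (orbit B x) x
            \<subseteq> {u + w | u w. u \<in> tangent_space Z x \<and> w \<in> tangent_space (orbit A x) x})"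


lemma act_mult: "act (g ** h) \<Lambda> = act g (act h \<Lambda>)"
  by (auto simp: act_def image_image matrix_vector_mul_assoc)

lemma act_one: "act (mat 1) \<Lambda> = \<Lambda>"
  by (simp add: act_def)

lemma SL2Z_preserves_Z2:
  assumes "m \<in> SL2Z"
  shows "act m Z2 = Z2"
proof -
  have int: "m $ i $ j \<in> \<int>" for i j
    using assms by (simp add: SL2Z_def)
  have det: "m $ 1 $ 1 * m $ 2 $ 2 - m $ 1 $ 2 * m $ 2 $ 1 = 1"
    using assms by (simp add: SL2Z_def SL2R_def det_2)
  show ?thesis
  proof
    show "act m Z2 \<subseteq> Z2"
      using int by (auto simp: act_def Z2_def matrix_vector_mult_def intro!: Ints_sum Ints_mult)
    show "Z2 \<subseteq> act m Z2"
    proof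
      fix v assume v: "v \<in> Z2"
      define w :: "real^2" where
        "w = vector [m$2$2 * v$1 - m$1$2 * v$2, m$1$1 * v$2 - m$2$1 * v$1]"
      have "w \<in> Z2"
        using v int by (simp add: w_def Z2_def forall_2)
      moreover have "(m *v w) $ 1 = (m$1$1 * m$2$2 - m$1$2 * m$2$1) * v$1"
        and "(m *v w) $ 2 = (m$1$1 * m$2$2 - m$1$2 * m$2$1) * v$2"
        by (simp_all add: w_def matrix_vector_mult_def sum_2 algebra_simps)
      then have "m *v w = v"
        by (simp add: det vec_eq_iff forall_2)
      ultimately show "v \<in> act m Z2"
        unfolding act_def by force
    qed
  qed
qed

lemma act_Z2_eq_iff:
  assumes "g \<in> SL2R" "h \<in> SL2R"
  shows "act g Z2 = act h Z2 \<longleftrightarrow> (\<exists>m\<in>SL2Z. g = h ** m)"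
proof
  assume eq: "act g Z2 = act h Z2"
  have "invertible h"
    using assms by (simp add: SL2R_def invertible_det_nz)
  then obtain k where k: "h ** k = mat 1" "k ** h = mat 1"
    unfolding invertible_def by blast
  have "det h * det k = 1"
    using k(1) by (metis det_I det_mul)
  then have "k ** g \<in> SL2R"
    using assms by (simp add: SL2R_def det_mul)
  moreover have "act (k ** g) Z2 = Z2"
    by (simp add: act_mult eq) (simp add: k act_one flip: act_mult)
  then have "(k ** g) *v axis j 1 \<in> Z2" for j
    unfolding act_def by (force simp: Z2_def axis_def)
  then have "(k ** g) $ i $ j \<in> \<int>" for i j
    by (simp add: Z2_def matrix_vector_mul_component inner_axis)
  ultimately have "k ** g \<in> SL2Z"
    by (simp add: SL2Z_def)
  moreover have "g = h ** (k ** g)"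
    by (simp add: matrix_mul_assoc k)
  ultimately show "\<exists>m\<in>SL2Z. g = h ** m" ..
qed (auto simp: act_mult SL2Z_preserves_Z2)

end

theory Submission
  imports Defs
begin

text \<open>
  Rescale the norm to \<open>N\<close> so that the critical determinant is 1. A critical lattice has a basis
  \<open>p\<close>, \<open>q\<close> with \<open>N p = N q = N (q - p) = 1\<close>, and it is rigid to first order: comparing with
  perturbed lattices, whose admissibility is certified by three support functionals, shows that
  no two adjacent vertices of the hexagon lie on a common support line (otherwise the ball is a
  parallelogram) and that the support lines at \<open>p\<close>, \<open>q\<close>, \<open>q - p\<close> satisfy Ceva's relation. Hence the
  support line at each vertex is unique, and the trace of the linear map between two such frames
  is at most 2, with equality only if they coincide. The compact set of frames is therefore a
  graph over the angle of the second row, which parametrizes the cosets of \<open>FH\<close>; by uniqueness of the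
  support lines the coordinate functions on this closed set of angles are strictly
  differentiable, so by Whitney's extension theorem on the line they extend to periodic \<open>C\<^sup>1\<close> functions.
  The graph of the extension is transversal to \<open>F\<close> and \<open>H\<close> since it is a graph over the angle, and
  it is embedded in \<open>X\<close> near the frames since the only elements of \<open>SL\<^sub>2(\<int>)\<close> that map a frame to a frame are
  the six rotations of the hexagon.
\<close>

section \<open>Norms in the plane and admissible lattices\<close>

text \<open>Left multiplication by \<open>F\<close> rescales the two rows of a matrix by inverse
  positive factors, and left multiplication by \<open>H\<close> adds a multiple of the second row to
  the first; in \<open>SL2R\<close> the direction of the second row is all that survives both. This
  is why a curve along which that direction turns with nonzero speed is transversal. The obstacle is
  that the critical lattices come as a mere closed set, possibly with isolated points or without any
  arc, so there is no curve to differentiate. Derivatives have to be extracted from chords both of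
  whose ends lie in the set, which is why strict differentiability and not plain differentiability
  is pursued. One lattice has six frames, permuted by an element of order six of
  \<open>SL2Z\<close>. The rotation group in the Iwasawa coordinates is conjugated so that this
  element becomes the shift of the angle by \<open>pi / 3\<close>; functions with that period then
  give curves that make sense in the quotient. Far from the frames nothing prevents such a curve
  from meeting itself in the quotient, hence the restriction to a neighbourhood.\<close>

definition cross2 :: "real^2 \<Rightarrow> real^2 \<Rightarrow> real" where
  "cross2 v w = v$1 * w$2 - v$2 * w$1"

lemma inner_2: "v \<bullet> (w::real^2) = v$1 * w$1 + v$2 * w$2"
  by (simp add: inner_vec_def sum_2)

lemma vec2_eqI: "v$1 = w$1 \<Longrightarrow> v$2 = w$2 \<Longrightarrow> v = (w::'a^2)"
  by (simp add: vec_eq_iff forall_2)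

lemma cross2_lincomb:
  "cross2 (a *\<^sub>R p + c *\<^sub>R q) (b *\<^sub>R p + d *\<^sub>R q) = (a * d - b * c) * cross2 p q"
  by (simp add: cross2_def algebra_simps)

lemma cross2_scale_self: "cross2 (c *\<^sub>R v) v = 0"
  by (simp add: cross2_def)

text \<open>Cramer's rule; later proofs use it to write plane vectors in the basis \<open>p\<close>,
  \<open>q\<close>.\<close>

lemma cross2_expand:
  assumes "cross2 p q \<noteq> 0"
  shows "v = (cross2 v q / cross2 p q) *\<^sub>R p + (cross2 p v / cross2 p q) *\<^sub>R q"
proof (rule vec2_eqI)
  show "v$1 = ((cross2 v q / cross2 p q) *\<^sub>R p + (cross2 p v / cross2 p q) *\<^sub>R q)$1"
    using assms by (simp add: field_simps) (simp add: cross2_def algebra_simps)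
  show "v$2 = ((cross2 v q / cross2 p q) *\<^sub>R p + (cross2 p v / cross2 p q) *\<^sub>R q)$2"
    using assms by (simp add: field_simps) (simp add: cross2_def algebra_simps)
qed

lemma inner_eq_on_basis:
  assumes "cross2 p q \<noteq> 0" "f \<bullet> p = f' \<bullet> p" "f \<bullet> q = f' \<bullet> q"
  shows "f = f'"
proof -
  have "f \<bullet> v = f' \<bullet> v" for v
    by (subst (1 2) cross2_expand[OF assms(1)]) (simp add: inner_add_right assms)
  then show ?thesis
    by (metis inner_commute vector_eq_ldot)
qed

locale plane_norm =
  fixes N :: "real^2 \<Rightarrow> real"
  assumes is_norm: "is_norm N"
begin

lemma nonneg: "0 \<le> N v"
  and eq_0_iff: "N v = 0 \<longleftrightarrow> v = 0"
  and scale: "N (c *\<^sub>R v) = \<bar>c\<bar> * N v"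
  and triangle: "N (v + w) \<le> N v + N w"
  using is_norm by (auto simp: is_norm_def)

lemma zero [simp]: "N 0 = 0"
  by (simp add: eq_0_iff)

lemma minus [simp]: "N (- v) = N v"
  using scale[of "-1" v] by simp

lemma continuous: "continuous_on S N"
proof -
  have "convex_on UNIV N"
  proof (rule convex_onI)
    fix t x y assume "0 < t" "t < (1::real)"
    then show "N ((1 - t) *\<^sub>R x + t *\<^sub>R y) \<le> (1 - t) * N x + t * N y"
      using triangle[of "(1 - t) *\<^sub>R x" "t *\<^sub>R y"] by (simp add: scale)
  qed auto
  then show ?thesis
    using convex_on_continuous continuous_on_subset by blast
qed

lemma norm_le: "\<exists>C>0. \<forall>v. norm v \<le> C * N v"
proof -
  obtain u :: "real^2" where u: "u \<in> sphere 0 1" and min: "\<And>v. v \<in> sphere 0 1 \<Longrightarrow> N u \<le> N v"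
    using continuous_attains_inf[of "sphere 0 1 :: (real^2) set" N] continuous
    by (metis compact_sphere sphere_eq_empty zero_le_one not_le)
  have pos: "N u > 0"
    using u nonneg[of u] eq_0_iff[of u] by fastforce
  have "norm v \<le> (1 / N u) * N v" for v
  proof (cases "v = 0")
    case False
    then have "N u \<le> N ((1 / norm v) *\<^sub>R v)"
      by (intro min) simp
    then show ?thesis
      using False pos by (simp add: scale field_simps)
  qed (simp add: nonneg pos less_imp_le)
  then show ?thesis
    using pos by (intro exI[of _ "1 / N u"]) auto
qed

section \<open>Support functionals and certificates of admissibility\<close>

definition dual_ball :: "(real^2) set" where
  "dual_ball = {f. \<forall>v. f \<bullet> v \<le> N v}"

lemma dual_ballD: "f \<in> dual_ball \<Longrightarrow> f \<bullet> v \<le> N v"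
  by (simp add: dual_ball_def)

lemma dual_ballD_minus: "f \<in> dual_ball \<Longrightarrow> - (f \<bullet> v) \<le> N v"
  using dual_ballD[of f "-v"] by simp

lemma dual_ball_uminus: "f \<in> dual_ball \<Longrightarrow> - f \<in> dual_ball"
  using dual_ballD_minus by (simp add: dual_ball_def)

text \<open>Hahn-Banach: a line separating the open unit ball from the boundary point
  \<open>p / N p\<close>, divided by its level \<open>b\<close>, is the required functional.\<close>

lemma support_functional:
  obtains f where "f \<in> dual_ball" "f \<bullet> p = N p"
proof (cases "p = 0")
  case True
  then show ?thesis
    using that[of 0] nonneg by (simp add: dual_ball_def eq_0_iff)
next
  case False
  then have Np: "N p > 0"
    using nonneg[of p] eq_0_iff[of p] by linarith
  let ?B = "{v. N v < 1}"
  have conv: "convex ?B"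
  proof (rule convexI)
    fix x y and u v :: real
    assume "x \<in> ?B" "y \<in> ?B" and uv: "0 \<le> u" "0 \<le> v" "u + v = 1"
    then have "u * N x + v * N y < 1"
      by (intro convex_bound_lt) auto
    then show "u *\<^sub>R x + v *\<^sub>R y \<in> ?B"
      using triangle[of "u *\<^sub>R x" "v *\<^sub>R y"] uv by (simp add: scale)
  qed
  have "0 \<in> ?B"
    by simp
  moreover have "(1 / N p) *\<^sub>R p \<notin> ?B"
    using Np by (simp add: scale)
  ultimately obtain a b where a: "a \<noteq> 0" "\<And>x. x \<in> ?B \<Longrightarrow> a \<bullet> x \<le> b" "b \<le> a \<bullet> ((1 / N p) *\<^sub>R p)"
    using separating_hyperplane_sets[OF conv, of "{(1 / N p) *\<^sub>R p}"] by auto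
  have Na: "N a > 0"
    using nonneg[of a] eq_0_iff[of a] a(1) by linarith
  \<comment> \<open>The level \<open>b\<close> is positive because a small multiple of
    \<open>a\<close> lies in the ball and pairs positively with \<open>a\<close>.\<close>
  have "a \<bullet> ((1 / (2 * N a)) *\<^sub>R a) \<le> b"
    using Na by (intro a(2)) (simp add: scale)
  then have b: "b > 0"
    using Na a(1) by (smt (verit) inner_gt_zero_iff inner_scaleR_right mult_pos_pos divide_pos_pos)
  have le: "a \<bullet> v \<le> b * N v" for v
  proof (rule field_le_epsilon)
    fix e :: real assume e: "e > 0"
    \<comment> \<open>Separation is known on the open ball only, so \<open>v\<close> is divided by a
      number slightly above \<open>N v\<close>, chosen to make the loss exactly
      \<open>e\<close>.\<close>
    define c where "c = N v + e / b"
    have c: "c > 0" "N v < c"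
      using e b nonneg[of v] by (auto simp: c_def add_nonneg_pos)
    then have "a \<bullet> ((1 / c) *\<^sub>R v) \<le> b"
      by (intro a(2)) (simp add: scale)
    then have "a \<bullet> v \<le> b * c"
      using c by (simp add: field_simps)
    moreover have "b * c = b * N v + e"
      using b by (simp add: c_def distrib_left)
    ultimately show "a \<bullet> v \<le> b * N v + e"
      by simp
  qed
  show ?thesis
  proof (rule that)
    show "(1 / b) *\<^sub>R a \<in> dual_ball"
      using b le by (simp add: dual_ball_def field_simps)
    show "((1 / b) *\<^sub>R a) \<bullet> p = N p"
      using b a(3) le[of p] Np by (simp add: field_simps)
  qed
qed

lemma compact_dual_ball: "compact dual_ball"
proof -
  have eq: "dual_ball = (\<Inter>v. {f. f \<bullet> v \<le> N v})"
    by (auto simp: dual_ball_def)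
  have "closed dual_ball"
    unfolding eq by (intro closed_INT ballI closed_Collect_le continuous_intros)
  moreover have "bounded dual_ball"
  proof -
    have "compact (N ` cball 0 1)"
      by (intro compact_continuous_image continuous) simp
    then obtain C where C: "\<And>v. v \<in> cball 0 1 \<Longrightarrow> N v \<le> C"
      by (metis (no_types, lifting) bounded_imp_bdd_above compact_imp_bounded bdd_above.unfold imageI)
    have "norm f \<le> C" if f: "f \<in> dual_ball" for f
    proof (cases "f = 0")
      case False
      have "f \<bullet> ((1 / norm f) *\<^sub>R f) \<le> N ((1 / norm f) *\<^sub>R f)"
        by (rule dual_ballD[OF f])
      also have "\<dots> \<le> C"
        by (rule C) simp
      finally show ?thesis
        using False by (simp add: dot_square_norm power2_eq_square)
    next
      case True
      then show ?thesis
        using C[of 0] by simp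
    qed
    then show ?thesis
      by (auto simp: bounded_iff)
  qed
  ultimately show ?thesis
    by (simp add: compact_eq_bounded_closed)
qed

text \<open>
  Up to sign, each lattice vector lies in a cone on whose generators one of the functionals is
  nonnegative.
\<close>

lemma admissible_criterion:
  fixes x y :: int
  assumes f: "f\<^sub>1 \<in> dual_ball" "f\<^sub>2 \<in> dual_ball" "f\<^sub>3 \<in> dual_ball"
    and 1: "f\<^sub>1 \<bullet> P \<ge> 1"
    and 2: "f\<^sub>2 \<bullet> Q \<ge> 1" "f\<^sub>2 \<bullet> P \<ge> 0"
    and 3: "f\<^sub>3 \<bullet> (Q - P) \<ge> 1" "f\<^sub>3 \<bullet> P \<le> 0" "f\<^sub>3 \<bullet> Q \<ge> 0"
    and xy: "x \<noteq> 0 \<or> y \<noteq> 0"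
  shows "N (of_int x *\<^sub>R P + of_int y *\<^sub>R Q) \<ge> 1"
proof -
  have pos: "N (of_int x *\<^sub>R P + of_int y *\<^sub>R Q) \<ge> 1" if y: "y \<ge> 1" for x y :: int
  proof (cases "x \<ge> 0")
    case True
    have "1 \<le> f\<^sub>2 \<bullet> Q" by fact
    also have "\<dots> \<le> of_int y * (f\<^sub>2 \<bullet> Q)"
      using y 2 by (simp add: mult_le_cancel_right1)
    also have "\<dots> \<le> f\<^sub>2 \<bullet> (of_int x *\<^sub>R P + of_int y *\<^sub>R Q)"
      using True 2 by (simp add: inner_add_right)
    also have "\<dots> \<le> N (of_int x *\<^sub>R P + of_int y *\<^sub>R Q)"
      by (rule dual_ballD[OF f(2)])
    finally show ?thesis .
  next
    case False
    then have x: "of_int x \<le> (- 1 :: real)"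
      by linarith
    have "1 \<le> - (f\<^sub>3 \<bullet> P) + f\<^sub>3 \<bullet> Q"
      using 3 by (simp add: inner_diff_right)
    also have "- (f\<^sub>3 \<bullet> P) \<le> of_int x * (f\<^sub>3 \<bullet> P)"
      using x 3(2) by (metis mult_minus1 mult_right_mono_neg)
    also have "f\<^sub>3 \<bullet> Q \<le> of_int y * (f\<^sub>3 \<bullet> Q)"
      using y 3 by (simp add: mult_le_cancel_right1)
    also have "of_int x * (f\<^sub>3 \<bullet> P) + of_int y * (f\<^sub>3 \<bullet> Q) = f\<^sub>3 \<bullet> (of_int x *\<^sub>R P + of_int y *\<^sub>R Q)"
      by (simp add: inner_add_right)
    also have "\<dots> \<le> N (of_int x *\<^sub>R P + of_int y *\<^sub>R Q)"
      by (rule dual_ballD[OF f(3)])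
    finally show ?thesis by simp
  qed
  consider "y \<ge> 1" | "y \<le> -1" | "y = 0"
    by linarith
  then show ?thesis
  proof cases
    case 1
    then show ?thesis by (rule pos)
  next
    case 2
    then have "N (of_int (- x) *\<^sub>R P + of_int (- y) *\<^sub>R Q) \<ge> 1"
      by (intro pos) simp
    also have "of_int (- x) *\<^sub>R P + of_int (- y) *\<^sub>R Q = - (of_int x *\<^sub>R P + of_int y *\<^sub>R Q)"
      by simp
    finally show ?thesis
      by (simp only: minus)
  next
    case 3
    have "1 \<le> N P"
      using 1 dual_ballD[OF f(1), of P] by linarith
    moreover have "1 \<le> \<bar>real_of_int x\<bar>"
      using 3 xy by linarith
    ultimately have "1 * 1 \<le> \<bar>real_of_int x\<bar> * N P"
      by (intro mult_mono) auto
    then show ?thesis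
      using 3 by (simp add: scale)
  qed
qed

end

text \<open>The assumption \<open>critical\<close> is the lower bound in "the critical determinant
  is 1": no admissible lattice has covolume below 1. Each variational argument contradicts it with a
  competitor of smaller covolume.\<close>

locale critical_norm = plane_norm +
  assumes not_parallelogram: "\<not> parallelogram {v. N v \<le> 1}"
    and critical: "\<And>P Q. cross2 P Q \<noteq> 0 \<Longrightarrow>
      (\<And>x y :: int. x \<noteq> 0 \<or> y \<noteq> 0 \<Longrightarrow> N (of_int x *\<^sub>R P + of_int y *\<^sub>R Q) \<ge> 1) \<Longrightarrow> \<bar>cross2 P Q\<bar> \<ge> 1"
begin

lemma critical_criterion:
  assumes "f\<^sub>1 \<in> dual_ball" "f\<^sub>2 \<in> dual_ball" "f\<^sub>3 \<in> dual_ball"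
    and "f\<^sub>1 \<bullet> P \<ge> 1"
    and "f\<^sub>2 \<bullet> Q \<ge> 1" "f\<^sub>2 \<bullet> P \<ge> 0"
    and "f\<^sub>3 \<bullet> (Q - P) \<ge> 1" "f\<^sub>3 \<bullet> P \<le> 0" "f\<^sub>3 \<bullet> Q \<ge> 0"
    and "cross2 P Q \<noteq> 0"
  shows "\<bar>cross2 P Q\<bar> \<ge> 1"
  using assms by (intro critical admissible_criterion[of f\<^sub>1 f\<^sub>2 f\<^sub>3])

end

section \<open>Hexagons of critical lattices\<close>

lemma eventually_less_affine_at_right:
  "u < a \<Longrightarrow> \<forall>\<^sub>F e in at_right (0::real). u < a + e * (b::real)"
  by (rule order_tendstoD(1)[of _ "a + 0 * b"]) (auto intro!: tendsto_eq_intros)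

lemma eventually_affine_less_at_right:
  "a < u \<Longrightarrow> \<forall>\<^sub>F e in at_right (0::real). a + e * (b::real) < u"
  by (rule order_tendstoD(2)[of _ "a + 0 * b"]) (auto intro!: tendsto_eq_intros)

context critical_norm
begin

text \<open>The competitor is spanned by \<open>p + e (a p + c q)\<close> and
  \<open>q + e (b p + d q)\<close>. The hypotheses are the admissibility criterion for it, spelled
  out in real numbers, and the covolume factor is strictly between 0 and 1.\<close>

lemma no_shrinking_perturbation:
  assumes cr: "\<bar>cross2 p q\<bar> = 1" and f: "f\<^sub>1 \<in> dual_ball" "f\<^sub>2 \<in> dual_ball" "f\<^sub>3 \<in> dual_ball"
    and 1: "f\<^sub>1 \<bullet> p + e * (a * (f\<^sub>1 \<bullet> p) + c * (f\<^sub>1 \<bullet> q)) \<ge> 1"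
    and 2: "f\<^sub>2 \<bullet> q + e * (b * (f\<^sub>2 \<bullet> p) + d * (f\<^sub>2 \<bullet> q)) \<ge> 1"
      "f\<^sub>2 \<bullet> p + e * (a * (f\<^sub>2 \<bullet> p) + c * (f\<^sub>2 \<bullet> q)) \<ge> 0"
    and 3: "f\<^sub>3 \<bullet> (q - p) + e * ((b - a) * (f\<^sub>3 \<bullet> p) + (d - c) * (f\<^sub>3 \<bullet> q)) \<ge> 1"
      "f\<^sub>3 \<bullet> p + e * (a * (f\<^sub>3 \<bullet> p) + c * (f\<^sub>3 \<bullet> q)) \<le> 0"
      "f\<^sub>3 \<bullet> q + e * (b * (f\<^sub>3 \<bullet> p) + d * (f\<^sub>3 \<bullet> q)) \<ge> 0"
    and det: "(1 + e * a) * (1 + e * d) - e * b * (e * c) > 0" "(1 + e * a) * (1 + e * d) - e * b * (e * c) < 1"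
  shows False
proof -
  define P where "P = (1 + e * a) *\<^sub>R p + (e * c) *\<^sub>R q"
  define Q where "Q = (e * b) *\<^sub>R p + (1 + e * d) *\<^sub>R q"
  have cPQ: "cross2 P Q = ((1 + e * a) * (1 + e * d) - e * b * (e * c)) * cross2 p q"
    unfolding P_def Q_def by (rule cross2_lincomb)
  have "\<bar>cross2 P Q\<bar> \<ge> 1"
  proof (rule critical_criterion[OF f])
    show "cross2 P Q \<noteq> 0"
      unfolding cPQ using det cr by auto
  qed (use 1 2 3 in \<open>auto simp: P_def Q_def algebra_simps inner_simps\<close>)
  then show False
    unfolding cPQ using det cr by (simp add: abs_mult)
qed

text \<open>With \<open>q - p\<close> strictly outside the unit ball only the constraints at
  \<open>p\<close> and \<open>q\<close> bind. One of the two vectors can then be shrunk and pushed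
  back to its support line along the other one, at the cost of the slack.\<close>

lemma reduced_basis_slack:
  assumes cr: "\<bar>cross2 p q\<bar> = 1" and Np: "N p = 1" and Nq: "N q = 1"
    and slack: "N (q - p) > 1"
    and f: "f\<^sub>1 \<in> dual_ball" "f\<^sub>1 \<bullet> p = 1" "f\<^sub>2 \<in> dual_ball" "f\<^sub>2 \<bullet> q = 1"
    and nonneg: "f\<^sub>2 \<bullet> p > 0 \<or> f\<^sub>2 \<bullet> p = 0 \<and> f\<^sub>1 \<bullet> q \<ge> 0"
  shows False
proof -
  obtain f\<^sub>3 where f3: "f\<^sub>3 \<in> dual_ball" "f\<^sub>3 \<bullet> (q - p) = N (q - p)"
    by (rule support_functional)
  have f3_ineqs: "f\<^sub>3 \<bullet> (q - p) > 1" "f\<^sub>3 \<bullet> p < 0" "f\<^sub>3 \<bullet> q > 0"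
    using f3 slack dual_ballD[OF f3(1), of q] dual_ballD_minus[OF f3(1), of p] Np Nq
    by (auto simp: inner_diff_right)
  have ev: "\<forall>\<^sub>F e in at_right (0::real). f\<^sub>3 \<bullet> (q - p) + e * ((b - a) * (f\<^sub>3 \<bullet> p) + (d - c) * (f\<^sub>3 \<bullet> q)) > 1
      \<and> f\<^sub>3 \<bullet> p + e * (a * (f\<^sub>3 \<bullet> p) + c * (f\<^sub>3 \<bullet> q)) < 0
      \<and> f\<^sub>3 \<bullet> q + e * (b * (f\<^sub>3 \<bullet> p) + d * (f\<^sub>3 \<bullet> q)) > 0 \<and> 0 < e \<and> e < 1" for a b c d
    by (intro eventually_conj eventually_less_affine_at_right eventually_affine_less_at_right)
      (use f3_ineqs eventually_at_right_real[of 0 "1::real"] in \<open>auto elim: eventually_mono\<close>)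
  consider "f\<^sub>2 \<bullet> p > 0" | "f\<^sub>2 \<bullet> p = 0" "f\<^sub>1 \<bullet> q > 0" | "f\<^sub>2 \<bullet> p = 0" "f\<^sub>1 \<bullet> q = 0"
    using nonneg by linarith
  then show False
  proof cases
    case 1
    obtain e where e: "f\<^sub>3 \<bullet> (q - p) + e * ((1 / (f\<^sub>2 \<bullet> p) - 0) * (f\<^sub>3 \<bullet> p) + (- 1 - 0) * (f\<^sub>3 \<bullet> q)) > 1"
      "f\<^sub>3 \<bullet> p + e * (0 * (f\<^sub>3 \<bullet> p) + 0 * (f\<^sub>3 \<bullet> q)) < 0"
      "f\<^sub>3 \<bullet> q + e * (1 / (f\<^sub>2 \<bullet> p) * (f\<^sub>3 \<bullet> p) + - 1 * (f\<^sub>3 \<bullet> q)) > 0" "0 < e" "e < 1"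
      using eventually_happens[OF ev[where a = 0 and b = "1 / (f\<^sub>2 \<bullet> p)" and c = 0 and d = "- 1"]] by auto
    show False
      by (rule no_shrinking_perturbation[OF cr f(1,3) f3(1), where e = e and a = 0
            and b = "1 / (f\<^sub>2 \<bullet> p)" and c = 0 and d = "- 1"]) (use e f 1 in auto)
  next
    case 2
    obtain e where e: "f\<^sub>3 \<bullet> (q - p) + e * ((0 - - 1) * (f\<^sub>3 \<bullet> p) + (0 - 1 / (f\<^sub>1 \<bullet> q)) * (f\<^sub>3 \<bullet> q)) > 1"
      "f\<^sub>3 \<bullet> p + e * (- 1 * (f\<^sub>3 \<bullet> p) + 1 / (f\<^sub>1 \<bullet> q) * (f\<^sub>3 \<bullet> q)) < 0"
      "f\<^sub>3 \<bullet> q + e * (0 * (f\<^sub>3 \<bullet> p) + 0 * (f\<^sub>3 \<bullet> q)) > 0" "0 < e" "e < 1"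
      using eventually_happens[OF ev[where a = "- 1" and b = 0 and c = "1 / (f\<^sub>1 \<bullet> q)" and d = 0]] by auto
    show False
      by (rule no_shrinking_perturbation[OF cr f(1,3) f3(1), where e = e and a = "- 1"
            and b = 0 and c = "1 / (f\<^sub>1 \<bullet> q)" and d = 0]) (use e f 2 in auto)
  next
    \<comment> \<open>Here the two functionals are the dual basis of \<open>p\<close>,
      \<open>q\<close> and no descent of first order exists; shearing both vectors at once gains in
      second order, with determinant \<open>1 - e * e\<close>.\<close>
    case 3
    obtain e where e: "f\<^sub>3 \<bullet> (q - p) + e * ((1 - 0) * (f\<^sub>3 \<bullet> p) + (0 - 1) * (f\<^sub>3 \<bullet> q)) > 1"
      "f\<^sub>3 \<bullet> p + e * (0 * (f\<^sub>3 \<bullet> p) + 1 * (f\<^sub>3 \<bullet> q)) < 0"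
      "f\<^sub>3 \<bullet> q + e * (1 * (f\<^sub>3 \<bullet> p) + 0 * (f\<^sub>3 \<bullet> q)) > 0" "0 < e" "e < 1"
      using eventually_happens[OF ev[where a = 0 and b = 1 and c = 1 and d = 0]] by auto
    have "e * e < 1"
      using e(4,5) mult_strict_mono[of e 1 e 1] by simp
    then show False
      by (intro no_shrinking_perturbation[OF cr f(1,3) f3(1), where e = e and a = 0
            and b = 1 and c = 1 and d = 0]) (use e f 3 in auto)
  qed
qed

text \<open>For a basis reduced in the sense of Lagrange, dividing both vectors by
  \<open>N p\<close>, and then \<open>q\<close> alone by \<open>N q\<close>, keeps the lattice
  admissible, so both norms are 1. The sign of \<open>f\<^sub>2 \<bullet> p\<close> tells whether to
  work with \<open>p\<close> or with \<open>- p\<close>, that is, with \<open>q - p\<close> or with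
  \<open>q + p\<close>.\<close>

lemma reduced_basis_hexagon:
  assumes cr: "\<bar>cross2 p q\<bar> = 1"
    and adm: "\<And>x y :: int. x \<noteq> 0 \<or> y \<noteq> 0 \<Longrightarrow> N (of_int x *\<^sub>R p + of_int y *\<^sub>R q) \<ge> 1"
    and red: "N p \<le> N q" "N q \<le> N (q - p)" "N q \<le> N (q + p)"
  shows "N p = 1 \<and> N q = 1 \<and> (N (q - p) = 1 \<or> N (q + p) = 1)"
proof -
  obtain f\<^sub>1 where f1: "f\<^sub>1 \<in> dual_ball" "f\<^sub>1 \<bullet> p = N p"
    by (rule support_functional)
  obtain f\<^sub>2 where f2: "f\<^sub>2 \<in> dual_ball" "f\<^sub>2 \<bullet> q = N q"
    by (rule support_functional)
  have Np: "N p \<ge> 1"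
    using adm[of 1 0] by simp
  have main: "N p = 1 \<and> N q = 1"
    if cr: "\<bar>cross2 p q\<bar> = 1" and red: "N p \<le> N q" "N q \<le> N (q - p)" and Np: "N p \<ge> 1"
      and f1: "f\<^sub>1 \<in> dual_ball" "f\<^sub>1 \<bullet> p = N p" and f2p: "f\<^sub>2 \<bullet> p \<ge> 0" for p f\<^sub>1
  proof -
    obtain f\<^sub>3 where f3: "f\<^sub>3 \<in> dual_ball" "f\<^sub>3 \<bullet> (q - p) = N (q - p)"
      by (rule support_functional)
    have f3pq: "f\<^sub>3 \<bullet> p \<le> 0" "f\<^sub>3 \<bullet> q \<ge> 0"
      using f3 red dual_ballD[OF f3(1), of q] dual_ballD_minus[OF f3(1), of p]
      by (auto simp: inner_diff_right)
    have f3pq': "f\<^sub>3 \<bullet> q - f\<^sub>3 \<bullet> p = N (q - p)"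
      using f3(2) by (simp add: inner_diff_right)
    have one: "N p = 1"
    proof -
      let ?P = "(1 / N p) *\<^sub>R p" and ?Q = "(1 / N p) *\<^sub>R q"
      have c: "cross2 ?P ?Q = cross2 p q / (N p)^2"
        using Np by (simp add: cross2_def field_simps power2_eq_square)
      have "\<bar>cross2 ?P ?Q\<bar> \<ge> 1"
      proof (rule critical_criterion[OF f1(1) f2(1) f3(1)])
        show "cross2 ?P ?Q \<noteq> 0"
          unfolding c using cr Np by auto
        show "1 \<le> f\<^sub>3 \<bullet> (?Q - ?P)"
          using Np red f3pq' by (simp add: inner_diff_right field_simps)
        show "f\<^sub>3 \<bullet> ?P \<le> 0"
          using f3pq Np by (simp add: field_simps)
      qed (use f1 f2 f2p Np red f3pq in auto)
      then have "(N p)^2 \<le> 1"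
        unfolding c using cr Np by (simp add: field_simps)
      then show ?thesis
        using Np by (simp add: power_le_one_iff)
    qed
    moreover have "N q = 1"
    proof -
      let ?Q = "(1 / N q) *\<^sub>R q"
      have c: "cross2 p ?Q = cross2 p q / N q"
        by (simp add: cross2_def diff_divide_distrib)
      have Nq: "N q \<ge> 1"
        using Np red by simp
      have "\<bar>cross2 p ?Q\<bar> \<ge> 1"
      proof (rule critical_criterion[OF f1(1) f2(1) f3(1)])
        show "cross2 p ?Q \<noteq> 0"
          unfolding c using cr Nq by auto
        \<comment> \<open>Shrinking \<open>q\<close> costs \<open>f\<^sub>3\<close> at most
          \<open>N q - 1\<close>, and \<open>N (q - p)\<close> is at least
          \<open>N q\<close>.\<close>
        have "(1 - 1 / N q) * (f\<^sub>3 \<bullet> q) \<le> (1 - 1 / N q) * N q"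
          using dual_ballD[OF f3(1), of q] Nq by (intro mult_left_mono) (auto simp: field_simps)
        then have "(f\<^sub>3 \<bullet> q) - (f\<^sub>3 \<bullet> q) / N q \<le> N q - 1"
          using Nq by (simp add: algebra_simps)
        then show "1 \<le> f\<^sub>3 \<bullet> (?Q - p)"
          using Nq red f3pq' by (simp add: inner_diff_right)
      qed (use f1 f2 f2p Np red f3pq Nq in \<open>auto\<close>)
      then have "N q \<le> 1"
        unfolding c using cr Nq by (simp add: field_simps)
      then show ?thesis
        using Nq by simp
    qed
    ultimately show ?thesis by simp
  qed
  have cr': "\<bar>cross2 (- p) q\<bar> = 1"
    using cr by (simp add: cross2_def abs_minus_commute)
  have 1: "N p = 1 \<and> N q = 1"
  proof (cases "f\<^sub>2 \<bullet> p \<ge> 0")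
    case True
    then show ?thesis using main[of p f\<^sub>1] cr red Np f1 by simp
  next
    case False
    then show ?thesis
      using main[of "- p" "- f\<^sub>1"] cr' red Np f1 by (simp add: dual_ball_uminus)
  qed
  moreover have "N (q - p) = 1 \<or> N (q + p) = 1"
  proof (rule ccontr)
    assume "\<not> ?thesis"
    then have s: "N (q - p) > 1" "N (q + p) > 1"
      using red 1 by linarith+
    show False
    proof (cases "f\<^sub>2 \<bullet> p > 0 \<or> f\<^sub>2 \<bullet> p = 0 \<and> f\<^sub>1 \<bullet> q \<ge> 0")
      case True
      then show False
        using reduced_basis_slack[of p q f\<^sub>1 f\<^sub>2] cr 1 s f1 f2 by simp
    next
      case False
      then show False
        using reduced_basis_slack[of "- p" q "- f\<^sub>1" f\<^sub>2] cr' 1 s f1 f2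
        by (force simp: dual_ball_uminus)
    qed
  qed
  ultimately show ?thesis by blast
qed

text \<open>The vertices of the hexagon are \<open>\<plusminus> p\<close>, \<open>\<plusminus> q\<close>, \<open>\<plusminus> (q - p)\<close>.\<close>

definition hexagon :: "real^2 \<Rightarrow> real^2 \<Rightarrow> bool" where
  "hexagon p q \<longleftrightarrow> \<bar>cross2 p q\<bar> = 1 \<and> N p = 1 \<and> N q = 1 \<and> N (q - p) = 1"

text \<open>Moves the labels on by one vertex. Since \<open>hexagon\<close> ignores orientation,
  this and the reflection below transfer a fact about one edge to the others.\<close>

lemma hexagon_rotate: "hexagon p q \<Longrightarrow> hexagon q (q - p)"
  by (simp add: hexagon_def cross2_def algebra_simps abs_minus_commute)

lemma hexagon_reflect: "hexagon p q \<Longrightarrow> hexagon (- p) (q - p)"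
  by (simp add: hexagon_def cross2_def algebra_simps abs_minus_commute)

lemma hexagon_support_range:
  assumes "hexagon p q" "f \<in> dual_ball" "f \<bullet> p = 1"
  shows "0 \<le> f \<bullet> q" "f \<bullet> q \<le> 1"
  using assms dual_ballD[OF assms(2), of q] dual_ballD_minus[OF assms(2), of "q - p"]
  by (auto simp: hexagon_def inner_diff_right)

text \<open>
  Otherwise, sliding \<open>q\<close> along its edge to the end and turning the lattice slightly around the
  corner would decrease the covolume.
\<close>

lemma flat_edge_long:
  assumes hex: "hexagon p q" and f: "f \<in> dual_ball" "f \<bullet> q = 1" "f \<bullet> p = 0"
    and f1: "f\<^sub>1 \<in> dual_ball" "f\<^sub>1 \<bullet> p = 1"
  shows "N (q + (1 - f\<^sub>1 \<bullet> q) *\<^sub>R p) \<le> 1"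
proof (rule ccontr)
  assume long: "\<not> ?thesis"
  define \<alpha> where "\<alpha> = f\<^sub>1 \<bullet> q"
  define \<kappa> where "\<kappa> = N (q + (1 - \<alpha>) *\<^sub>R p) - 1"
  have \<kappa>: "\<kappa> > 0"
    using long by (simp add: \<kappa>_def \<alpha>_def)
  have \<alpha>: "0 \<le> \<alpha>" "\<alpha> \<le> 1"
    using hexagon_support_range[OF hex f1] by (auto simp: \<alpha>_def)
  obtain k where k: "k \<in> dual_ball" "k \<bullet> (q + (1 - \<alpha>) *\<^sub>R p) = 1 + \<kappa>"
    using support_functional[of "q + (1 - \<alpha>) *\<^sub>R p"] by (auto simp: \<kappa>_def)
  have kq: "k \<bullet> q \<le> 1"
    using dual_ballD[OF k(1), of q] hex by (simp add: hexagon_def)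
  have kp': "(1 - \<alpha>) * (k \<bullet> p) \<ge> \<kappa>"
    using k(2) kq by (simp add: inner_simps)
  then have "k \<bullet> p > 0"
    using \<kappa> \<alpha> by (smt (verit) mult_nonneg_nonpos)
  then have kp: "k \<bullet> p \<ge> \<kappa>"
    using kp' \<alpha> by (smt (verit) mult_left_le_one_le)
  \<comment> \<open>The factor \<open>1 - \<epsilon>\<close> brings the corner
    \<open>q + (1 - \<alpha>) p\<close>, of norm \<open>1 + \<kappa>\<close>, back to the unit
    sphere. The vector \<open>P\<close> stays on the line where \<open>f\<^sub>1\<close> is 1, and
    \<open>f\<close> takes the value 1 at \<open>Q - P\<close>, while the determinant falls to
    \<open>1 - \<epsilon>^2\<close>.\<close>
  define \<epsilon> where "\<epsilon> = \<kappa> / (1 + \<kappa>)"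
  have \<epsilon>: "0 < \<epsilon>" "\<epsilon> < 1" "\<epsilon> \<le> \<kappa>" "(1 - \<epsilon>) * (1 + \<kappa>) = 1"
    using \<kappa> by (auto simp: \<epsilon>_def field_simps)
  define P where "P = (1 + \<alpha> * \<epsilon>) *\<^sub>R p + (- \<epsilon>) *\<^sub>R q"
  define Q where "Q = ((1 - \<epsilon>) * (1 - \<alpha>)) *\<^sub>R p + (1 - \<epsilon>) *\<^sub>R q"
  have "cross2 P Q = ((1 + \<alpha> * \<epsilon>) * (1 - \<epsilon>) - (1 - \<epsilon>) * (1 - \<alpha>) * (- \<epsilon>)) * cross2 p q"
    unfolding P_def Q_def by (rule cross2_lincomb)
  also have "\<dots> = (1 - \<epsilon>\<^sup>2) * cross2 p q"
    by (simp add: algebra_simps power2_eq_square)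
  finally have c: "\<bar>cross2 P Q\<bar> = 1 - \<epsilon>\<^sup>2"
    using hex \<epsilon> by (simp add: hexagon_def abs_mult power_le_one)
  have "\<bar>cross2 P Q\<bar> \<ge> 1"
  proof (rule critical_criterion[OF f1(1) k(1) f(1)])
    show "1 \<le> f\<^sub>1 \<bullet> P"
      using f1(2) by (simp add: P_def inner_simps \<alpha>_def)
    have "Q = (1 - \<epsilon>) *\<^sub>R (q + (1 - \<alpha>) *\<^sub>R p)"
      by (simp add: Q_def algebra_simps)
    then show "1 \<le> k \<bullet> Q"
      using k(2) \<epsilon>(4) by simp
    have "\<epsilon> * (k \<bullet> q) \<le> \<epsilon> * 1"
      using kq \<epsilon> by (intro mult_left_mono) auto
    moreover have "\<alpha> * \<epsilon> * (k \<bullet> p) \<ge> 0"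
      using \<alpha> \<epsilon> \<open>k \<bullet> p > 0\<close> by simp
    moreover have "k \<bullet> P = k \<bullet> p + \<alpha> * \<epsilon> * (k \<bullet> p) - \<epsilon> * (k \<bullet> q)"
      by (simp add: P_def inner_simps algebra_simps)
    ultimately show "0 \<le> k \<bullet> P"
      using kp \<epsilon> by linarith
    show "cross2 P Q \<noteq> 0"
      using c \<epsilon> by (auto simp: power2_eq_1_iff)
  qed (use f \<epsilon> in \<open>auto simp: P_def Q_def inner_simps\<close>)
  then show False
    using c \<epsilon> by simp
qed

text \<open>Otherwise \<open>f\<close> would be 1 on the edge from \<open>q - p\<close> to
  \<open>q\<close>. By \<open>flat_edge_long\<close> for the hexagon and for its mirror image, the
  ball contains the corners of the parallelogram on which \<open>f\<close> and
  \<open>f\<^sub>1\<close> are at most 1 in absolute value. As the ball lies inside that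
  parallelogram, both coincide.\<close>

lemma no_flat_edge:
  assumes hex: "hexagon p q" and f: "f \<in> dual_ball" "f \<bullet> q = 1"
  shows "f \<bullet> p \<noteq> 0"
proof
  assume f0: "f \<bullet> p = 0"
  obtain f\<^sub>1 where f1: "f\<^sub>1 \<in> dual_ball" "f\<^sub>1 \<bullet> p = 1"
    using support_functional[of p] hex by (auto simp: hexagon_def)
  define \<alpha> where "\<alpha> = f\<^sub>1 \<bullet> q"
  let ?A = "q + (1 - \<alpha>) *\<^sub>R p" and ?C = "q - (1 + \<alpha>) *\<^sub>R p"
  have A: "N ?A \<le> 1"
    unfolding \<alpha>_def by (rule flat_edge_long[OF hex f f0 f1])
  have "N (q - p + (1 - (- f\<^sub>1) \<bullet> (q - p)) *\<^sub>R (- p)) \<le> 1"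
    by (rule flat_edge_long[OF hexagon_reflect[OF hex] f(1)])
      (use f f0 f1 in \<open>auto simp: inner_simps dual_ball_uminus\<close>)
  also have "q - p + (1 - (- f\<^sub>1) \<bullet> (q - p)) *\<^sub>R (- p) = ?C"
    using f1(2) by (simp add: \<alpha>_def algebra_simps inner_simps)
  finally have C: "N ?C \<le> 1" .
  \<comment> \<open>Sides of the parallelogram with vertices \<open>- ?A\<close>,
    \<open>- ?C\<close>, \<open>?A\<close>, \<open>?C\<close>, starting at
    \<open>- ?A\<close>.\<close>
  let ?a = "2 *\<^sub>R p" and ?b = "2 *\<^sub>R (q - \<alpha> *\<^sub>R p)"
  have cr: "cross2 p q \<noteq> 0"
    using hex by (auto simp: hexagon_def)
  have cab: "cross2 ?a ?b = 4 * cross2 p q"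
    by (simp add: cross2_def algebra_simps)
  have ind: "?a \<noteq> ?b" "independent {?a, ?b}"
  proof -
    have "cross2 ?a ?a = 0"
      by (simp add: cross2_def)
    then show "?a \<noteq> ?b"
      using cab cr by force
    have "?a \<notin> span {?b}"
    proof
      assume "?a \<in> span {?b}"
      then obtain c where "?a = c *\<^sub>R ?b"
        by (auto simp: span_singleton)
      then have "cross2 ?a ?b = 0"
        by (metis cross2_scale_self)
      then show False using cab cr by simp
    qed
    moreover have "?b \<noteq> 0"
      using cab cr by (auto simp: cross2_def)
    ultimately show "independent {?a, ?b}"
      using \<open>?a \<noteq> ?b\<close> by (simp add: independent_insert)
  qed
  have "{v. N v \<le> 1} = {- ?A + s *\<^sub>R ?a + t *\<^sub>R ?b | s t. s \<in> {0..1} \<and> t \<in> {0..1}}" (is "?L = ?R")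
  proof (intro equalityI subsetI)
    fix v assume v: "v \<in> ?L"
    obtain x y where xy: "v = x *\<^sub>R p + y *\<^sub>R q"
      using cross2_expand[OF cr] by blast
    have "\<bar>y\<bar> \<le> 1"
      using dual_ballD[OF f(1), of v] dual_ballD_minus[OF f(1), of v] v f f0
      by (simp add: xy inner_simps)
    moreover have "\<bar>x + \<alpha> * y\<bar> \<le> 1"
      using dual_ballD[OF f1(1), of v] dual_ballD_minus[OF f1(1), of v] v f1
      by (simp add: xy inner_simps \<alpha>_def mult.commute)
    moreover have "v = - ?A + ((x + \<alpha> * y + 1) / 2) *\<^sub>R ?a + ((y + 1) / 2) *\<^sub>R ?b"
      by (intro vec2_eqI) (simp_all add: xy field_simps)
    ultimately have "v = - ?A + ((x + \<alpha> * y + 1) / 2) *\<^sub>R ?a + ((y + 1) / 2) *\<^sub>R ?b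
        \<and> (x + \<alpha> * y + 1) / 2 \<in> {0..1} \<and> (y + 1) / 2 \<in> {0..1}"
      by (simp add: abs_le_iff)
    then show "v \<in> ?R"
      by blast
  next
    fix v assume "v \<in> ?R"
    then obtain s t where st: "v = - ?A + s *\<^sub>R ?a + t *\<^sub>R ?b" "s \<in> {0..1}" "t \<in> {0..1}"
      by blast
    \<comment> \<open>Bilinear interpolation of the four corners, with opposite corners
      collected.\<close>
    have v: "v = (s * t - (1 - s) * (1 - t)) *\<^sub>R ?A + ((1 - s) * t - s * (1 - t)) *\<^sub>R ?C"
      unfolding st(1) by (rule vec2_eqI) (simp_all add: algebra_simps)
    have "N v \<le> \<bar>s * t - (1 - s) * (1 - t)\<bar> * N ?A + \<bar>(1 - s) * t - s * (1 - t)\<bar> * N ?C"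
      unfolding v using triangle by (metis (no_types) scale)
    also have "\<dots> \<le> \<bar>s * t - (1 - s) * (1 - t)\<bar> * 1 + \<bar>(1 - s) * t - s * (1 - t)\<bar> * 1"
      using A C by (intro add_mono mult_left_mono) auto
    also have "\<dots> = \<bar>s + t - 1\<bar> + \<bar>t - s\<bar>"
      by (simp add: algebra_simps)
    also have "\<dots> \<le> 1"
      using st by auto
    finally show "v \<in> ?L" by simp
  qed
  then have "parallelogram {v. N v \<le> 1}"
    unfolding parallelogram_def using ind by blast
  then show False
    using not_parallelogram by blast
qed

text \<open>At an extreme value \<open>f\<close> would be constant on an edge ending in
  \<open>p\<close>: the one to \<open>p - q\<close> if \<open>f \<bullet> q\<close> is 0, the one to
  \<open>q\<close> if it is 1.\<close>

lemma hexagon_support_strict: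
  assumes hex: "hexagon p q" and f: "f \<in> dual_ball" "f \<bullet> p = 1"
  shows "0 < f \<bullet> q" "f \<bullet> q < 1"
proof -
  have "(- f) \<bullet> (q - p) = 1" if "f \<bullet> q = 0"
    using that f by (simp add: inner_simps)
  then have "f \<bullet> q \<noteq> 0"
    using no_flat_edge[OF hexagon_rotate[OF hex], of "- f"] f dual_ball_uminus by auto
  then show "0 < f \<bullet> q"
    using hexagon_support_range[OF assms] by simp
  have "hexagon (q - p) (- p)"
    using hexagon_rotate[OF hexagon_rotate[OF hex]] by simp
  then have "f \<bullet> (q - p) \<noteq> 0"
    using no_flat_edge[of "q - p" "- p" "- f"] f dual_ball_uminus by auto
  then show "f \<bullet> q < 1"
    using hexagon_support_range[OF assms] f by (simp add: inner_simps)
qed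

end

section \<open>Support functionals and chords\<close>

lemma closed_det_eq: "closed {g :: real^2^2. det g = c}"
  unfolding det_2 by (intro closed_Collect_eq continuous_intros)

lemma det_eq_cross2: "det (g :: real^2^2) = cross2 (column 1 g) (column 2 g)"
  by (simp add: det_2 cross2_def column_def algebra_simps)

lemma column_inject_2: "column 1 g = column 1 h \<Longrightarrow> column 2 g = column 2 h \<Longrightarrow> g = (h :: 'a^2^2)"
  by (simp add: column_def vec_eq_iff forall_2)

lemma column_diff: "column j (g - h) = column j g - column j (h :: real^2^2)"
  and column_scaleR: "column j (c *\<^sub>R g) = c *\<^sub>R column j (g :: real^2^2)"
  by (simp_all add: column_def vec_eq_iff)

lemma tendsto_column [tendsto_intros]:
  "(g \<longlongrightarrow> (x :: real^2^2)) F \<Longrightarrow> ((\<lambda>a. column j (g a)) \<longlongrightarrow> column j x) F"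
  unfolding column_def by (intro tendsto_intros)

lemma continuous_on_column [continuous_intros]:
  "continuous_on S g \<Longrightarrow> continuous_on S (\<lambda>a. column j (g a :: real^2^2))"
  unfolding continuous_on_def by (auto intro: tendsto_column)

lemma norm_matrix_le: "norm (g :: real^2^2) \<le> 2 * (norm (column 1 g) + norm (column 2 g))"
proof -
  have "norm (g $ i) \<le> norm (column 1 g) + norm (column 2 g)" for i
  proof -
    have "norm (g $ i) \<le> \<bar>g $ i $ 1\<bar> + \<bar>g $ i $ 2\<bar>"
      using norm_le_l1_cart[of "g $ i"] by (simp add: sum_2)
    also have "\<dots> \<le> norm (column 1 g) + norm (column 2 g)"
      using component_le_norm_cart[of "column 1 g" i] component_le_norm_cart[of "column 2 g" i]
      by (simp add: column_def)
    finally show ?thesis .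
  qed
  moreover have "norm g \<le> norm (g $ 1) + norm (g $ 2)"
    using L2_set_le_sum[of UNIV "\<lambda>i. norm (g $ i)"] by (simp add: norm_vec_def sum_2)
  ultimately show ?thesis
    by (smt (verit))
qed

definition frame :: "real^2 \<Rightarrow> real^2 \<Rightarrow> real^2^2" where
  "frame p q = (\<chi> i j. if j = 1 then p$i else q$i)"

lemma column_frame [simp]: "column 1 (frame p q) = p" "column 2 (frame p q) = q"
  by (simp_all add: frame_def column_def vec_eq_iff)

lemma tendsto_frame [tendsto_intros]:
  assumes "(p \<longlongrightarrow> x) F" "(q \<longlongrightarrow> y) F"
  shows "((\<lambda>a. frame (p a) (q a)) \<longlongrightarrow> frame x y) F"
  unfolding frame_def
proof (intro vec_tendstoI)
  fix i j :: 2
  show "((\<lambda>a. (\<chi> i j. if j = 1 then p a $ i else q a $ i) $ i $ j) \<longlongrightarrow> (\<chi> i j. if j = 1 then x $ i else y $ i) $ i $ j) F"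
    using assms by (simp add: tendsto_vec_nth)
qed

lemma cross2_scale_left: "cross2 (c *\<^sub>R v) w = c * cross2 v w"
  and cross2_scale_right: "cross2 v (c *\<^sub>R w) = c * cross2 v w"
  by (simp_all add: cross2_def algebra_simps)

definition rot90 :: "real^2 \<Rightarrow> real^2" where
  "rot90 v = vector [- v$2, v$1]"

lemma cross2_rot90_left: "cross2 (rot90 f) q = - (f \<bullet> q)"
  and cross2_rot90_right: "cross2 p (rot90 f) = f \<bullet> p"
  by (simp_all add: cross2_def rot90_def inner_2 algebra_simps)

lemma tendsto_rot90 [tendsto_intros]:
  "(f \<longlongrightarrow> x) F \<Longrightarrow> ((\<lambda>a. rot90 (f a)) \<longlongrightarrow> rot90 x) F"
proof (rule vec_tendstoI)
  fix i assume "(f \<longlongrightarrow> x) F"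
  then show "((\<lambda>a. rot90 (f a) $ i) \<longlongrightarrow> rot90 x $ i) F"
    using exhaust_2[of i] by (elim disjE) (simp_all add: rot90_def tendsto_vec_nth tendsto_minus)
qed

lemma orthogonal_imp_rot90_multiple:
  assumes "f \<noteq> 0" "f \<bullet> v = 0"
  shows "\<exists>c. v = c *\<^sub>R rot90 f"
proof -
  have n: "f$1 * f$1 + f$2 * f$2 \<noteq> 0"
    using assms(1) inner_eq_zero_iff[of f] by (simp add: inner_2)
  have o: "f$1 * v$1 = - (f$2 * v$2)"
    using assms(2) by (simp add: inner_2)
  let ?c = "(f$1 * v$2 - f$2 * v$1) / (f$1 * f$1 + f$2 * f$2)"
  have "v$1 * (f$1 * f$1 + f$2 * f$2) = - (f$1 * v$2 - f$2 * v$1) * f$2"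
    using arg_cong[OF o, of "\<lambda>z. f$1 * z"] by (simp add: algebra_simps)
  moreover have "v$2 * (f$1 * f$1 + f$2 * f$2) = (f$1 * v$2 - f$2 * v$1) * f$1"
    using arg_cong[OF o, of "\<lambda>z. f$2 * z"] by (simp add: algebra_simps)
  ultimately have "v = ?c *\<^sub>R rot90 f"
    using n by (intro vec2_eqI) (simp_all add: rot90_def field_simps)
  then show ?thesis ..
qed

context critical_norm
begin

lemma hexagon_support_strict2:
  assumes hex: "hexagon p q" and f: "f \<in> dual_ball" "f \<bullet> q = 1"
  shows "0 < f \<bullet> p" "f \<bullet> p < 1"
  using hexagon_support_strict[OF hexagon_rotate[OF hex] f] f by (auto simp: inner_simps)

lemma hexagon_support_strict3:
  assumes hex: "hexagon p q" and f: "f \<in> dual_ball" "f \<bullet> (q - p) = 1"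
  shows "0 < - (f \<bullet> p)" "- (f \<bullet> p) < 1"
  using hexagon_support_strict[OF hexagon_rotate[OF hexagon_rotate[OF hex]] f] f
  by (auto simp: inner_simps)

text \<open>
  First order optimality of the covolume. Without this relation (which is Ceva's relation for
  the three support lines), the neutral motion of \<open>p\<close> and \<open>q\<close> along their support lines pushes
  \<open>q - p\<close> to one side, so that one of its two directions leaves room to shrink the lattice.
\<close>

lemma hexagon_support_relation:
  assumes hex: "hexagon p q"
    and f1: "f\<^sub>1 \<in> dual_ball" "f\<^sub>1 \<bullet> p = 1"
    and f2: "f\<^sub>2 \<in> dual_ball" "f\<^sub>2 \<bullet> q = 1"
    and f3: "f\<^sub>3 \<in> dual_ball" "f\<^sub>3 \<bullet> (q - p) = 1"
  defines "\<alpha> \<equiv> f\<^sub>1 \<bullet> q" and "\<beta> \<equiv> f\<^sub>2 \<bullet> p" and "\<gamma> \<equiv> - (f\<^sub>3 \<bullet> p)"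
  shows "\<gamma> * \<alpha> * (1 - \<beta>) = \<beta> * (1 - \<gamma>) * (1 - \<alpha>)"
proof (rule ccontr)
  assume ne: "\<gamma> * \<alpha> * (1 - \<beta>) \<noteq> \<beta> * (1 - \<gamma>) * (1 - \<alpha>)"
  have \<alpha>: "0 < \<alpha>" "\<alpha> < 1" and \<beta>: "0 < \<beta>" "\<beta> < 1" and \<gamma>: "0 < \<gamma>" "\<gamma> < 1"
    using hexagon_support_strict[OF hex f1] hexagon_support_strict2[OF hex f2]
      hexagon_support_strict3[OF hex f3] by (auto simp: \<alpha>_def \<beta>_def \<gamma>_def)
  have f3': "f\<^sub>3 \<bullet> p = - \<gamma>" "f\<^sub>3 \<bullet> q = 1 - \<gamma>"
    using f3(2) by (auto simp: \<gamma>_def inner_simps)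
  \<comment> \<open>Moving \<open>p\<close> and \<open>q\<close> along their support lines with
    trace zero changes \<open>f\<^sub>3 \<bullet> (q - p)\<close> at the rate \<open>c * K\<close>,
    where \<open>c\<close> is the speed of \<open>p\<close> in the direction of \<open>q\<close>;
    the sign of \<open>K\<close> makes this a gain.\<close>
  define K where "K = (\<gamma> * \<alpha> * (1 - \<beta>) - \<beta> * (1 - \<gamma>) * (1 - \<alpha>)) / \<beta>"
  have K: "K \<noteq> 0"
    using ne \<beta> by (simp add: K_def)
  define c where "c = sgn K"
  \<comment> \<open>The gain is spent on shrinking: lowering \<open>d\<close> by
    \<open>\<eta>\<close>, with \<open>b\<close> adjusted to keep \<open>q\<close> on its line,
    costs exactly \<open>\<bar>K\<bar>\<close> and makes the trace \<open>a + d\<close> equal to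
    \<open>- \<eta>\<close>.\<close>
  define \<eta> where "\<eta> = \<bar>K\<bar> / (\<gamma> / \<beta> + (1 - \<gamma>))"
  define a where "a = - (\<alpha> * c)"
  define d where "d = \<alpha> * c - \<eta>"
  define b where "b = - d / \<beta>"
  have pos: "\<gamma> / \<beta> + (1 - \<gamma>) > 0"
    using \<gamma> \<beta> by (simp add: add_pos_pos)
  have \<eta>: "\<eta> > 0" "\<eta> * (\<gamma> / \<beta> + (1 - \<gamma>)) = \<bar>K\<bar>"
    using pos K by (auto simp: \<eta>_def)
  have cK: "c * K = \<bar>K\<bar>"
    by (simp add: c_def abs_sgn mult.commute)
  have "(b - a) * (- \<gamma>) + (d - c) * (1 - \<gamma>) = c * K - \<eta> * (\<gamma> / \<beta> + (1 - \<gamma>))"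
    using \<beta> by (simp add: a_def b_def d_def K_def field_simps)
  then have lin3: "(b - a) * (- \<gamma>) + (d - c) * (1 - \<gamma>) = 0"
    using cK \<eta> by simp
  have lin2: "b * \<beta> + d = 0"
    using \<beta> by (simp add: b_def)
  have ev: "\<forall>\<^sub>F e in at_right (0::real). 0 < \<beta> + e * (a * \<beta> + c)
      \<and> - \<gamma> + e * (a * (- \<gamma>) + c * (1 - \<gamma>)) < 0
      \<and> 0 < (1 - \<gamma>) + e * (b * (- \<gamma>) + d * (1 - \<gamma>))
      \<and> - \<eta> + e * (a * d - b * c) < 0"
    using \<beta> \<gamma> \<eta>
    by (intro eventually_conj eventually_less_affine_at_right eventually_affine_less_at_right) auto
  have ev2: "\<forall>\<^sub>F e in at_right (0::real). 0 < (1 + e * a) * (1 + e * d) - e * b * (e * c)"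
    by (rule order_tendstoD(1)[of _ "(1 + 0 * a) * (1 + 0 * d) - 0 * b * (0 * c)"])
      (auto intro!: tendsto_eq_intros)
  have "\<forall>\<^sub>F e in at_right (0::real). e > 0"
    by (simp add: eventually_at_right_less)
  then have "\<exists>e>0. 0 < \<beta> + e * (a * \<beta> + c)
      \<and> - \<gamma> + e * (a * (- \<gamma>) + c * (1 - \<gamma>)) < 0
      \<and> 0 < (1 - \<gamma>) + e * (b * (- \<gamma>) + d * (1 - \<gamma>))
      \<and> - \<eta> + e * (a * d - b * c) < 0 \<and> 0 < (1 + e * a) * (1 + e * d) - e * b * (e * c)"
    using eventually_happens[OF eventually_conj[OF eventually_conj[OF ev ev2]]] by fastforce
  then obtain e where e: "e > 0" "0 < \<beta> + e * (a * \<beta> + c)"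
      "- \<gamma> + e * (a * (- \<gamma>) + c * (1 - \<gamma>)) < 0"
      "0 < (1 - \<gamma>) + e * (b * (- \<gamma>) + d * (1 - \<gamma>))"
      "- \<eta> + e * (a * d - b * c) < 0" "0 < (1 + e * a) * (1 + e * d) - e * b * (e * c)"
    by blast
  have "(1 + e * a) * (1 + e * d) - e * b * (e * c) = 1 + e * (- \<eta> + e * (a * d - b * c))"
    by (simp add: a_def d_def algebra_simps)
  then have det: "(1 + e * a) * (1 + e * d) - e * b * (e * c) < 1"
    using e by (simp add: mult_pos_neg)
  show False
  proof (rule no_shrinking_perturbation[OF _ f1(1) f2(1) f3(1), where e = e and a = a and b = b and c = c and d = d])
    show "\<bar>cross2 p q\<bar> = 1"
      using hex by (simp add: hexagon_def)
    show "1 \<le> f\<^sub>1 \<bullet> p + e * (a * (f\<^sub>1 \<bullet> p) + c * (f\<^sub>1 \<bullet> q))"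
      using f1 by (simp add: \<alpha>_def[symmetric] a_def)
    show "1 \<le> f\<^sub>2 \<bullet> q + e * (b * (f\<^sub>2 \<bullet> p) + d * (f\<^sub>2 \<bullet> q))"
      using f2 lin2 by (simp add: \<beta>_def[symmetric])
    show "0 \<le> f\<^sub>2 \<bullet> p + e * (a * (f\<^sub>2 \<bullet> p) + c * (f\<^sub>2 \<bullet> q))"
      using f2 e(2) by (simp add: \<beta>_def[symmetric])
    show "1 \<le> f\<^sub>3 \<bullet> (q - p) + e * ((b - a) * (f\<^sub>3 \<bullet> p) + (d - c) * (f\<^sub>3 \<bullet> q))"
      unfolding f3 f3' lin3 by simp
  qed (use e det f3' in auto)
qed

text \<open>With the functionals at \<open>q\<close> and \<open>q - p\<close> fixed, Ceva's relation
  is an affine equation for \<open>f \<bullet> q\<close> with positive leading coefficient, and the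
  value at \<open>p\<close> is prescribed.\<close>

lemma hexagon_support_unique:
  assumes hex: "hexagon p q"
    and f: "f \<in> dual_ball" "f \<bullet> p = 1" and f': "f' \<in> dual_ball" "f' \<bullet> p = 1"
  shows "f = f'"
proof -
  obtain f\<^sub>2 where f2: "f\<^sub>2 \<in> dual_ball" "f\<^sub>2 \<bullet> q = 1"
    using support_functional[of q] hex by (auto simp: hexagon_def)
  obtain f\<^sub>3 where f3: "f\<^sub>3 \<in> dual_ball" "f\<^sub>3 \<bullet> (q - p) = 1"
    using support_functional[of "q - p"] hex by (auto simp: hexagon_def)
  define \<beta> where "\<beta> = f\<^sub>2 \<bullet> p"
  define \<gamma> where "\<gamma> = - (f\<^sub>3 \<bullet> p)"
  have \<beta>: "0 < \<beta>" "\<beta> < 1" and \<gamma>: "0 < \<gamma>" "\<gamma> < 1"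
    using hexagon_support_strict2[OF hex f2] hexagon_support_strict3[OF hex f3]
    by (auto simp: \<beta>_def \<gamma>_def)
  have "(\<gamma> * (1 - \<beta>) + \<beta> * (1 - \<gamma>)) * (f \<bullet> q) = \<beta> * (1 - \<gamma>)"
    "(\<gamma> * (1 - \<beta>) + \<beta> * (1 - \<gamma>)) * (f' \<bullet> q) = \<beta> * (1 - \<gamma>)"
    using hexagon_support_relation[OF hex f f2 f3] hexagon_support_relation[OF hex f' f2 f3]
    unfolding \<beta>_def[symmetric] \<gamma>_def[symmetric] by (simp_all add: algebra_simps)
  moreover have "\<gamma> * (1 - \<beta>) + \<beta> * (1 - \<gamma>) > 0"
    using \<beta> \<gamma> by (simp add: add_pos_pos)
  ultimately have "f \<bullet> q = f' \<bullet> q"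
    by (metis less_irrefl mult_cancel_left)
  then show ?thesis
    using hex f f' by (intro inner_eq_on_basis[of p q]) (auto simp: hexagon_def)
qed

text \<open>
  The trace \<open>cross2 p' q + cross2 p q'\<close> of the linear map taking \<open>(p, q)\<close> to \<open>(p', q')\<close> is a
  positive combination of the values of the three support functionals at \<open>p'\<close>, \<open>q'\<close>, \<open>q' - p'\<close>.
\<close>

lemma hexagon_trace_rigidity:
  assumes hex: "hexagon p q" "cross2 p q = 1" and hex': "hexagon p' q'" "cross2 p' q' = 1"
    and tr: "cross2 p' q + cross2 p q' \<ge> 2"
  shows "p' = p \<and> q' = q"
proof -
  obtain f\<^sub>1 where f1: "f\<^sub>1 \<in> dual_ball" "f\<^sub>1 \<bullet> p = 1"
    using support_functional[of p] hex by (auto simp: hexagon_def)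
  obtain f\<^sub>2 where f2: "f\<^sub>2 \<in> dual_ball" "f\<^sub>2 \<bullet> q = 1"
    using support_functional[of q] hex by (auto simp: hexagon_def)
  obtain f\<^sub>3 where f3: "f\<^sub>3 \<in> dual_ball" "f\<^sub>3 \<bullet> (q - p) = 1"
    using support_functional[of "q - p"] hex by (auto simp: hexagon_def)
  define \<alpha> where "\<alpha> = f\<^sub>1 \<bullet> q"
  define \<beta> where "\<beta> = f\<^sub>2 \<bullet> p"
  define \<gamma> where "\<gamma> = - (f\<^sub>3 \<bullet> p)"
  have \<alpha>: "0 < \<alpha>" "\<alpha> < 1" and \<beta>: "0 < \<beta>" "\<beta> < 1" and \<gamma>: "0 < \<gamma>" "\<gamma> < 1"
    using hexagon_support_strict[OF hex(1) f1] hexagon_support_strict2[OF hex(1) f2]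
      hexagon_support_strict3[OF hex(1) f3] by (auto simp: \<alpha>_def \<beta>_def \<gamma>_def)
  have f3': "f\<^sub>3 \<bullet> p = - \<gamma>" "f\<^sub>3 \<bullet> q = 1 - \<gamma>"
    using f3(2) by (auto simp: \<gamma>_def inner_simps)
  have ceva: "\<gamma> * \<alpha> * (1 - \<beta>) = \<beta> * (1 - \<gamma>) * (1 - \<alpha>)"
    using hexagon_support_relation[OF hex(1) f1 f2 f3] by (simp add: \<alpha>_def \<beta>_def \<gamma>_def)
  define x where "x = cross2 p' q"
  define y where "y = cross2 p p'"
  define b where "b = cross2 q' q"
  define d where "d = cross2 p q'"
  have p': "p' = x *\<^sub>R p + y *\<^sub>R q" and q': "q' = b *\<^sub>R p + d *\<^sub>R q"
    using cross2_expand[of p q p'] cross2_expand[of p q q'] hex(2)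
    by (auto simp: x_def y_def b_def d_def)
  have det: "x * d - b * y = 1"
    using cross2_lincomb[of x p y q b d] hex' hex unfolding p'[symmetric] q'[symmetric] by simp
  have i1: "x + \<alpha> * y \<le> 1"
    using dual_ballD[OF f1(1), of p'] hex' f1 by (simp add: p' hexagon_def inner_simps \<alpha>_def mult.commute)
  have i2: "\<beta> * b + d \<le> 1"
    using dual_ballD[OF f2(1), of q'] hex' f2 by (simp add: q' hexagon_def inner_simps \<beta>_def mult.commute)
  have "f\<^sub>3 \<bullet> (q' - p') \<le> 1"
    using dual_ballD[OF f3(1), of "q' - p'"] hex' by (simp add: hexagon_def)
  also have "f\<^sub>3 \<bullet> (q' - p') = (1 - \<gamma>) * (d - y) - \<gamma> * (b - x)"
    unfolding p' q' inner_simps f3' by (simp add: algebra_simps)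
  finally have i3: "(1 - \<gamma>) * (d - y) - \<gamma> * (b - x) \<le> 1" .
  \<comment> \<open>Ceva's relation in the form that makes \<open>b\<close> and \<open>y\<close>
    cancel from the weighted sum of the three slacks, leaving the trace
    \<open>x + d\<close>.\<close>
  have g1: "(\<alpha> + \<beta> - 2 * \<alpha> * \<beta>) * \<gamma> = (1 - \<alpha>) * \<beta>"
    and g2: "(\<alpha> + \<beta> - 2 * \<alpha> * \<beta>) * (1 - \<gamma>) = \<alpha> * (1 - \<beta>)"
    using ceva by (simp_all add: algebra_simps)
  have nonneg: "1 - \<beta> > 0" "1 - \<alpha> > 0" "\<alpha> + \<beta> - 2 * \<alpha> * \<beta> > 0"
  proof -
    have "\<alpha> * (1 - \<beta>) + \<beta> * (1 - \<alpha>) > 0"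
      using \<alpha> \<beta> by (simp add: add_pos_pos)
    then show "\<alpha> + \<beta> - 2 * \<alpha> * \<beta> > 0"
      by (simp add: algebra_simps)
  qed (use \<alpha> \<beta> in auto)
  have j1: "0 \<le> (1 - \<beta>) * (1 - (x + \<alpha> * y))" and j2: "0 \<le> (1 - \<alpha>) * (1 - (\<beta> * b + d))"
    and j3: "0 \<le> (\<alpha> + \<beta> - 2 * \<alpha> * \<beta>) * (1 - ((1 - \<gamma>) * (d - y) - \<gamma> * (b - x)))"
    using i1 i2 i3 nonneg by simp_all
  have "(\<alpha> + \<beta> - 2 * \<alpha> * \<beta>) * (1 - ((1 - \<gamma>) * (d - y) - \<gamma> * (b - x)))
    = (\<alpha> + \<beta> - 2 * \<alpha> * \<beta>) - ((\<alpha> + \<beta> - 2 * \<alpha> * \<beta>) * (1 - \<gamma>)) * (d - y) + ((\<alpha> + \<beta> - 2 * \<alpha> * \<beta>) * \<gamma>) * (b - x)"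
    by (simp add: algebra_simps)
  then have sum: "(1 - \<beta>) * (1 - (x + \<alpha> * y)) + (1 - \<alpha>) * (1 - (\<beta> * b + d))
     + (\<alpha> + \<beta> - 2 * \<alpha> * \<beta>) * (1 - ((1 - \<gamma>) * (d - y) - \<gamma> * (b - x))) = (1 - \<alpha> * \<beta>) * (2 - (x + d))"
    unfolding g1 g2 by (simp add: algebra_simps)
  have \<alpha>\<beta>: "1 - \<alpha> * \<beta> > 0"
    using \<alpha> \<beta> mult_strict_mono[of \<alpha> 1 \<beta> 1] by simp
  then have "(1 - \<alpha> * \<beta>) * (2 - (x + d)) \<le> 0"
    using tr by (simp add: mult_nonneg_nonpos x_def d_def)
  then have "(1 - \<beta>) * (1 - (x + \<alpha> * y)) = 0" "(1 - \<alpha>) * (1 - (\<beta> * b + d)) = 0"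
    "(1 - \<alpha> * \<beta>) * (2 - (x + d)) = 0"
    using sum j1 j2 j3 by linarith+
  \<comment> \<open>The equality case: with the first two slacks and the trace defect equal to 0,
    the determinant condition reduces to
    \<open>\<alpha> (1 - \<alpha> \<beta>) y^2 = 0\<close>.\<close>
  then have eqs: "x = 1 - \<alpha> * y" "\<beta> * b = 1 - d" "d = 2 - x"
    using nonneg \<alpha>\<beta> by auto
  then have "\<beta> * b = - (\<alpha> * y)" "d = 1 + \<alpha> * y"
    by simp_all
  moreover have "\<beta> * (x * d - b * y) = \<beta> * (x * d) - (\<beta> * b) * y"
    by (simp add: algebra_simps)
  ultimately have "\<beta> * (x * d - b * y) = \<beta> * ((1 - \<alpha> * y) * (1 + \<alpha> * y)) + \<alpha> * y * y"
    using eqs(1) by simp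
  then have "\<alpha> * (1 - \<alpha> * \<beta>) * (y * y) = 0"
    using det by (simp add: algebra_simps)
  then have "y = 0"
    using \<alpha> \<alpha>\<beta> by simp
  then show ?thesis
    using eqs \<beta> by (simp add: p' q')
qed

text \<open>Strictness of the support inequalities: on the lattice points with
  \<open>y \<ge> 1\<close> the functional at \<open>q\<close> (for \<open>x \<ge> 0\<close>) or at
  \<open>q - p\<close> (for \<open>x < 0\<close>) is at least 1, and it grows strictly with every
  step away from its vertex.\<close>

lemma hexagon_lattice_points:
  fixes x y :: int
  assumes hex: "hexagon p q" and N1: "N (of_int x *\<^sub>R p + of_int y *\<^sub>R q) = 1"
  shows "(x, y) \<in> {(1, 0), (-1, 0), (0, 1), (0, -1), (-1, 1), (1, -1)}"
proof -
  obtain f\<^sub>2 where f2: "f\<^sub>2 \<in> dual_ball" "f\<^sub>2 \<bullet> q = 1"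
    using support_functional[of q] hex by (auto simp: hexagon_def)
  obtain f\<^sub>3 where f3: "f\<^sub>3 \<in> dual_ball" "f\<^sub>3 \<bullet> (q - p) = 1"
    using support_functional[of "q - p"] hex by (auto simp: hexagon_def)
  define \<beta> where "\<beta> = f\<^sub>2 \<bullet> p"
  define \<gamma> where "\<gamma> = - (f\<^sub>3 \<bullet> p)"
  have \<beta>: "0 < \<beta>" "\<beta> < 1" and \<gamma>: "0 < \<gamma>" "\<gamma> < 1"
    using hexagon_support_strict2[OF hex f2] hexagon_support_strict3[OF hex f3]
    by (auto simp: \<beta>_def \<gamma>_def)
  have f3': "f\<^sub>3 \<bullet> p = - \<gamma>" "f\<^sub>3 \<bullet> q = 1 - \<gamma>"
    using f3(2) by (auto simp: \<gamma>_def inner_simps)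
  have pos: "(x, y) \<in> {(0, 1), (-1, 1)}"
    if N1: "N (of_int x *\<^sub>R p + of_int y *\<^sub>R q) = 1" and y: "y \<ge> 1" for x y :: int
  proof (cases "x \<ge> 0")
    case True
    have "of_int x * \<beta> + of_int y \<le> 1"
      using dual_ballD[OF f2(1), of "of_int x *\<^sub>R p + of_int y *\<^sub>R q"] N1 f2
      by (simp add: inner_simps \<beta>_def)
    moreover have "of_int x * \<beta> \<ge> 0" "of_int y \<ge> (1::real)"
      using True \<beta> y by auto
    ultimately have "of_int x * \<beta> = 0" "of_int y = (1::real)"
      by linarith+
    then show ?thesis
      using \<beta> by simp
  next
    case False
    define u where "u = real_of_int (- x) - 1"
    define v where "v = real_of_int y - 1"
    have uv: "u \<ge> 0" "v \<ge> 0"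
      using False y by (auto simp: u_def v_def)
    have "f\<^sub>3 \<bullet> (of_int x *\<^sub>R p + of_int y *\<^sub>R q) \<le> 1"
      using dual_ballD[OF f3(1), of "of_int x *\<^sub>R p + of_int y *\<^sub>R q"] N1 by simp
    also have "f\<^sub>3 \<bullet> (of_int x *\<^sub>R p + of_int y *\<^sub>R q) = 1 + u * \<gamma> + v * (1 - \<gamma>)"
      unfolding inner_simps f3' by (simp add: u_def v_def algebra_simps)
    finally have "u * \<gamma> + v * (1 - \<gamma>) \<le> 0"
      by simp
    moreover have "u * \<gamma> \<ge> 0" "v * (1 - \<gamma>) \<ge> 0"
      using uv \<gamma> by auto
    ultimately have "u * \<gamma> = 0" "v * (1 - \<gamma>) = 0"
      by linarith+
    then have "real_of_int x = - 1" "real_of_int y = 1"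
      using \<gamma> by (auto simp: u_def v_def)
    then have "x = - 1" "y = 1"
      by linarith+
    then show ?thesis by simp
  qed
  consider "y \<ge> 1" | "y \<le> -1" | "y = 0"
    by linarith
  then show ?thesis
  proof cases
    case 1
    then show ?thesis using pos[OF N1] by auto
  next
    case 2
    have "of_int (- x) *\<^sub>R p + of_int (- y) *\<^sub>R q = - (of_int x *\<^sub>R p + of_int y *\<^sub>R q)"
      by simp
    then have "N (of_int (- x) *\<^sub>R p + of_int (- y) *\<^sub>R q) = 1"
      using N1 by (simp only: minus)
    then have "(- x, - y) \<in> {(0, 1), (-1, 1)}"
      using 2 by (intro pos) auto
    then show ?thesis by auto
  next
    case 3
    then have "\<bar>real_of_int x\<bar> = 1"
      using N1 hex by (simp add: scale hexagon_def)
    then show ?thesis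
      using 3 by auto
  qed
qed

section \<open>The compact set of frames and its tangent directions\<close>

definition hex_frames :: "(real^2^2) set" where
  "hex_frames = {g. det g = 1 \<and> hexagon (column 1 g) (column 2 g)}"

lemma compact_hex_frames: "compact hex_frames"
proof -
  have eq: "hex_frames = {g. det g = 1} \<inter> {g. N (column 1 g) = 1} \<inter> {g. N (column 2 g) = 1}
     \<inter> {g. N (column 2 g - column 1 g) = 1}"
    by (auto simp: hex_frames_def hexagon_def det_eq_cross2)
  have cl: "closed {g :: real^2^2. N (h g) = 1}" if "continuous_on UNIV h" for h
    by (intro closed_Collect_eq continuous_on_const continuous_on_compose2[OF continuous that]) auto
  have "closed hex_frames"
    unfolding eq by (intro closed_Int closed_det_eq cl continuous_intros)
  moreover obtain C where C: "C > 0" "\<And>v. norm v \<le> C * N v"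
    using norm_le by blast
  have "norm g \<le> 2 * (C + C)" if "g \<in> hex_frames" for g
    using norm_matrix_le[of g] C(2)[of "column 1 g"] C(2)[of "column 2 g"] that
    by (simp add: hex_frames_def hexagon_def)
  then have "bounded hex_frames"
    by (auto simp: bounded_iff)
  ultimately show ?thesis
    by (simp add: compact_eq_bounded_closed)
qed

text \<open>An arbitrary choice in general, but at the vertices of a hexagon the functional is
  unique, and there the choice becomes continuous.\<close>

definition support :: "real^2 \<Rightarrow> real^2" where
  "support v = (SOME f. f \<in> dual_ball \<and> f \<bullet> v = N v)"

lemma support: "support v \<in> dual_ball" "support v \<bullet> v = N v"
  using someI_ex[of "\<lambda>f. f \<in> dual_ball \<and> f \<bullet> v = N v"] support_functional[of v]
  unfolding support_def by blast+

text \<open>Uniqueness identifies the graph with the closed set of all pairs of a frame and a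
  functional supporting its vertex; as the functionals form a compact set, the closed graph gives
  continuity.\<close>

lemma continuous_on_support:
  assumes h: "continuous_on UNIV h"
    and vertex: "\<And>g. g \<in> hex_frames \<Longrightarrow> \<exists>q. hexagon (h g) q"
  shows "continuous_on hex_frames (\<lambda>g. support (h g))"
proof (rule continuous_from_closed_graph[OF compact_dual_ball])
  have N1: "N (h g) = 1" if "g \<in> hex_frames" for g
    using vertex[OF that] by (auto simp: hexagon_def)
  have "(\<lambda>g. (g, support (h g))) ` hex_frames
    = (hex_frames \<times> dual_ball) \<inter> {z. snd z \<bullet> h (fst z) = 1}" (is "?L = ?R")
  proof (intro equalityI subsetI)
    fix z assume "z \<in> ?R"
    then obtain g f where z: "z = (g, f)" "g \<in> hex_frames" "f \<in> dual_ball" "f \<bullet> h g = 1"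
      by auto
    obtain q where "hexagon (h g) q"
      using vertex z by blast
    then have "support (h g) = f"
      using hexagon_support_unique[of "h g" q] support[of "h g"] z N1 by metis
    then show "z \<in> ?L"
      using z by auto
  qed (use support N1 in auto)
  moreover have "closed \<dots>"
    using compact_hex_frames compact_dual_ball
    by (intro closed_Int closed_Times compact_imp_closed closed_Collect_eq
        continuous_intros continuous_on_compose2[OF h]) auto
  ultimately show "closed ((\<lambda>g. (g, support (h g))) ` hex_frames)"
    by simp
qed (use support in auto)


text \<open>The infinitesimal motion of a frame: each column moves along its own support line, whose
  direction is the rotated functional, and the two speeds are balanced so that the determinant is
  stationary.\<close>

definition tangent_frame :: "real^2^2 \<Rightarrow> real^2^2" where
  "tangent_frame g = frame
     ((support (column 2 g) \<bullet> column 1 g) *\<^sub>R rot90 (support (column 1 g)))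
     ((support (column 1 g) \<bullet> column 2 g) *\<^sub>R rot90 (support (column 2 g)))"

lemma hex_frames_support:
  assumes "g \<in> hex_frames"
  shows "support (column 1 g) \<bullet> column 1 g = 1" "support (column 2 g) \<bullet> column 2 g = 1"
    "0 < support (column 1 g) \<bullet> column 2 g" "support (column 1 g) \<bullet> column 2 g < 1"
    "0 < support (column 2 g) \<bullet> column 1 g" "support (column 2 g) \<bullet> column 1 g < 1"
proof -
  have hex: "hexagon (column 1 g) (column 2 g)"
    using assms by (simp add: hex_frames_def)
  show 1: "support (column 1 g) \<bullet> column 1 g = 1" "support (column 2 g) \<bullet> column 2 g = 1"
    using support hex by (auto simp: hexagon_def)
  show "0 < support (column 1 g) \<bullet> column 2 g" "support (column 1 g) \<bullet> column 2 g < 1"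
    using hexagon_support_strict[OF hex support(1) 1(1)] by auto
  show "0 < support (column 2 g) \<bullet> column 1 g" "support (column 2 g) \<bullet> column 1 g < 1"
    using hexagon_support_strict2[OF hex support(1) 1(2)] by auto
qed

lemma det_tangent_frame:
  assumes "g \<in> hex_frames"
  shows "det (tangent_frame g) > 0"
    and "cross2 (column 1 (tangent_frame g)) (column 2 g) + cross2 (column 1 g) (column 2 (tangent_frame g)) = 0"
proof -
  let ?f = "support (column 1 g)" and ?h = "support (column 2 g)"
  let ?\<alpha> = "?f \<bullet> column 2 g" and ?\<beta> = "?h \<bullet> column 1 g"
  have "det g = 1"
    using assms by (simp add: hex_frames_def)
  \<comment> \<open>A product of two determinants is the determinant of the pairings of
    \<open>?f\<close> and \<open>?h\<close> with the columns of \<open>g\<close>.\<close>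
  then have "cross2 ?f ?h = cross2 ?f ?h * cross2 (column 1 g) (column 2 g)"
    by (simp add: det_eq_cross2)
  also have "\<dots> = (?f \<bullet> column 1 g) * (?h \<bullet> column 2 g) - ?\<alpha> * ?\<beta>"
    by (simp add: cross2_def inner_2 algebra_simps)
  finally have "cross2 ?f ?h = 1 - ?\<alpha> * ?\<beta>"
    using hex_frames_support[OF assms] by simp
  moreover have "?\<alpha> * ?\<beta> < 1"
    using hex_frames_support[OF assms] mult_strict_mono[of ?\<alpha> 1 ?\<beta> 1] by simp
  moreover have "det (tangent_frame g) = ?\<alpha> * ?\<beta> * cross2 ?f ?h"
    by (simp add: det_eq_cross2 tangent_frame_def) (simp add: cross2_def rot90_def algebra_simps)
  ultimately show "det (tangent_frame g) > 0"
    using hex_frames_support[OF assms] by simp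
  show "cross2 (column 1 (tangent_frame g)) (column 2 g) + cross2 (column 1 g) (column 2 (tangent_frame g)) = 0"
    by (simp add: tangent_frame_def cross2_scale_left cross2_scale_right cross2_rot90_left cross2_rot90_right)
qed

text \<open>If the second row of the velocity were proportional to that of \<open>g\<close>, the
  velocity would be \<open>X ** g\<close> with \<open>X\<close> upper triangular and of trace 0, and
  its determinant could not be positive.\<close>

lemma tangent_frame_transversal:
  assumes "g \<in> hex_frames"
  shows "cross2 (tangent_frame g $ 2) (g $ 2) \<noteq> 0"
proof
  assume c: "cross2 (tangent_frame g $ 2) (g $ 2) = 0"
  let ?w = "tangent_frame g"
  have "det g = 1"
    using assms by (simp add: hex_frames_def)
  then have d: "g$1$1 * g$2$2 - g$1$2 * g$2$1 = 1"
    by (simp add: det_2)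
  define \<mu> where "\<mu> = g$1$1 * ?w$2$2 - g$1$2 * ?w$2$1"
  have 1: "?w$2$1 = \<mu> * g$2$1" and 2: "?w$2$2 = \<mu> * g$2$2"
    using c d unfolding \<mu>_def cross2_def by algebra+
  have "?w$1$1 * g$2$2 - ?w$2$1 * g$1$2 + (g$1$1 * ?w$2$2 - g$2$1 * ?w$1$2) = 0"
    using det_tangent_frame(2)[OF assms] by (simp add: cross2_def column_def)
  then have "?w$1$1 * ?w$2$2 - ?w$1$2 * ?w$2$1 = - (\<mu> * \<mu>)"
    using d 1 2 by algebra
  then have "det ?w \<le> 0"
    by (simp add: det_2)
  then show False
    using det_tangent_frame(1)[OF assms] by simp
qed

text \<open>
  Each chord \<open>p' - p\<close> between boundary points is annihilated by a convex combination of their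
  support functionals, and the determinant is bilinear. Hence the chord of \<open>hex_frames\<close> solves
  the linear equations for a tangent vector with slightly perturbed coefficients.
\<close>

lemma interpolated_support:
  defines "\<psi> \<equiv> \<lambda>v w. let a = support v \<bullet> (w - v); b = support w \<bullet> (w - v) in
      support v + (if a = b then 0 else - a / (b - a)) *\<^sub>R (support w - support v)"
  shows "N v = N w \<Longrightarrow> \<psi> v w \<bullet> (w - v) = 0" "N v = N w \<Longrightarrow> norm (\<psi> v w - support v) \<le> norm (support w - support v)"
proof -
  assume eq: "N v = N w"
  define a where "a = support v \<bullet> (w - v)"
  define b where "b = support w \<bullet> (w - v)"
  \<comment> \<open>Since \<open>a \<le> 0 \<le> b\<close>, the weight lies between 0 and 1. If
    \<open>a = b\<close>, both are 0 and \<open>support v\<close> itself annihilates the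
    chord.\<close>
  define \<mu> where "\<mu> = (if a = b then 0 else - a / (b - a))"
  have a: "a \<le> 0" and b: "b \<ge> 0"
    using dual_ballD[OF support(1), of v w] dual_ballD[OF support(1), of w v] support(2)[of v] support(2)[of w] eq
    by (auto simp: a_def b_def inner_diff_right)
  have \<psi>: "\<psi> v w = support v + \<mu> *\<^sub>R (support w - support v)"
    by (simp add: \<psi>_def a_def b_def \<mu>_def Let_def)
  have "\<psi> v w \<bullet> (w - v) = a + \<mu> * (b - a)"
    by (simp add: \<psi> inner_add_left inner_diff_left a_def b_def)
  also have "\<dots> = 0"
    using a b by (auto simp: \<mu>_def)
  finally show "\<psi> v w \<bullet> (w - v) = 0" .
  have "\<bar>\<mu>\<bar> \<le> 1"
    using a b by (auto simp: \<mu>_def abs_if divide_simps)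
  then show "norm (\<psi> v w - support v) \<le> norm (support w - support v)"
    by (simp add: \<psi> mult_left_le_one_le)
qed

text \<open>Both ends of the chord move, as strict differentiability at \<open>x\<close> demands.
  The scalar \<open>\<kappa>\<close> absorbs the length of the chord, so that
  \<open>\<omega>\<close> has a limit.\<close>

lemma secant_direction:
  assumes G: "(G \<longlongrightarrow> x) F" "\<forall>\<^sub>F a in F. G a \<in> hex_frames"
    and H: "(H \<longlongrightarrow> x) F" "\<forall>\<^sub>F a in F. H a \<in> hex_frames"
    and x: "x \<in> hex_frames"
  shows "\<exists>\<kappa> \<omega>. (\<omega> \<longlongrightarrow> tangent_frame x) F \<and> (\<forall>\<^sub>F a in F. H a - G a = \<kappa> a *\<^sub>R \<omega> a)"
proof -
  define \<psi> where "\<psi> = (\<lambda>v w. let a = support v \<bullet> (w - v); b = support w \<bullet> (w - v) in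
      support v + (if a = b then 0 else - a / (b - a)) *\<^sub>R (support w - support v))"
  have c1: "continuous_on hex_frames (\<lambda>g. support (column 1 g))"
    by (rule continuous_on_support) (auto simp: hex_frames_def intro!: continuous_intros)
  have c2: "continuous_on hex_frames (\<lambda>g. support (column 2 g))"
    by (rule continuous_on_support) (auto simp: hex_frames_def intro!: continuous_intros dest: hexagon_rotate)
  have N1: "N (column j g) = 1" if "g \<in> hex_frames" for j g
    using that exhaust_2[of j] by (auto simp: hex_frames_def hexagon_def)
  have lim: "((\<lambda>a. \<psi> (column j (G a)) (column j (H a))) \<longlongrightarrow> support (column j x)) F" for j
  proof -
    have c: "continuous_on hex_frames (\<lambda>g. support (column j g))"
      using c1 c2 exhaust_2[of j] by auto
    have sG: "((\<lambda>a. support (column j (G a))) \<longlongrightarrow> support (column j x)) F"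
      and sH: "((\<lambda>a. support (column j (H a))) \<longlongrightarrow> support (column j x)) F"
      by (rule continuous_on_tendsto_compose[OF c]; use G H x in blast)+
    have "((\<lambda>a. \<psi> (column j (G a)) (column j (H a)) - support (column j (G a))) \<longlongrightarrow> 0) F"
    proof (rule Lim_null_comparison)
      show "\<forall>\<^sub>F a in F. norm (\<psi> (column j (G a)) (column j (H a)) - support (column j (G a)))
        \<le> norm (support (column j (H a)) - support (column j (G a)))"
        using G(2) H(2)
        by eventually_elim (unfold \<psi>_def, rule interpolated_support(2), simp add: N1)
      show "((\<lambda>a. norm (support (column j (H a)) - support (column j (G a)))) \<longlongrightarrow> 0) F"
        using tendsto_norm[OF tendsto_diff[OF sH sG]] by simp
    qed
    from tendsto_add[OF this sG] show ?thesis
      by simp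
  qed
  define \<psi>1 where "\<psi>1 = (\<lambda>a. \<psi> (column 1 (G a)) (column 1 (H a)))"
  define \<psi>2 where "\<psi>2 = (\<lambda>a. \<psi> (column 2 (G a)) (column 2 (H a)))"
  \<comment> \<open>With midpoints the product rule for the determinant holds exactly for finite
    differences.\<close>
  define P where "P = (\<lambda>a. (1/2) *\<^sub>R (column 1 (G a) + column 1 (H a)))"
  define Q where "Q = (\<lambda>a. (1/2) *\<^sub>R (column 2 (G a) + column 2 (H a)))"
  define \<omega> where "\<omega> = (\<lambda>a. frame ((\<psi>2 a \<bullet> P a) *\<^sub>R rot90 (\<psi>1 a)) ((\<psi>1 a \<bullet> Q a) *\<^sub>R rot90 (\<psi>2 a)))"
  have limP: "(P \<longlongrightarrow> column 1 x) F"
  proof -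
    have "(P \<longlongrightarrow> (1/2) *\<^sub>R (column 1 x + column 1 x)) F"
      unfolding P_def by (intro tendsto_intros G H)
    then show ?thesis
      by (simp add: scaleR_2[symmetric])
  qed
  have limQ: "(Q \<longlongrightarrow> column 2 x) F"
  proof -
    have "(Q \<longlongrightarrow> (1/2) *\<^sub>R (column 2 x + column 2 x)) F"
      unfolding Q_def by (intro tendsto_intros G H)
    then show ?thesis
      by (simp add: scaleR_2[symmetric])
  qed
  have lim\<omega>: "(\<omega> \<longlongrightarrow> tangent_frame x) F"
    unfolding \<omega>_def tangent_frame_def \<psi>1_def \<psi>2_def
    by (intro tendsto_intros limP limQ lim)
  have pos1: "\<forall>\<^sub>F a in F. \<psi>1 a \<bullet> Q a > 0"
    using hex_frames_support[OF x] unfolding \<psi>1_def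
    by (intro order_tendstoD(1)[OF tendsto_inner[OF lim limQ]])
  have pos2: "\<forall>\<^sub>F a in F. \<psi>2 a \<bullet> P a > 0"
    using hex_frames_support[OF x] unfolding \<psi>2_def
    by (intro order_tendstoD(1)[OF tendsto_inner[OF lim limP]])
  have "\<forall>\<^sub>F a in F. \<exists>k. H a - G a = k *\<^sub>R \<omega> a"
    using pos1 pos2 G(2) H(2)
  proof eventually_elim
    case (elim a)
    have "\<psi>1 a \<noteq> 0" "\<psi>2 a \<noteq> 0"
      using elim by auto
    moreover have "\<psi>1 a \<bullet> (column 1 (H a) - column 1 (G a)) = 0"
      unfolding \<psi>1_def \<psi>_def by (rule interpolated_support(1)) (use elim N1 in simp)
    moreover have "\<psi>2 a \<bullet> (column 2 (H a) - column 2 (G a)) = 0"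
      unfolding \<psi>2_def \<psi>_def by (rule interpolated_support(1)) (use elim N1 in simp)
    ultimately obtain c e where c: "column 1 (H a) - column 1 (G a) = c *\<^sub>R rot90 (\<psi>1 a)"
      and e: "column 2 (H a) - column 2 (G a) = e *\<^sub>R rot90 (\<psi>2 a)"
      using orthogonal_imp_rot90_multiple by blast
    have "cross2 (column 1 (H a)) (column 2 (H a)) = 1" "cross2 (column 1 (G a)) (column 2 (G a)) = 1"
      using elim by (auto simp: hex_frames_def det_eq_cross2)
    then have "cross2 (column 1 (H a) - column 1 (G a)) (Q a) + cross2 (P a) (column 2 (H a) - column 2 (G a)) = 0"
      unfolding P_def Q_def cross2_def by (simp add: field_simps)
    then have ce: "c * (\<psi>1 a \<bullet> Q a) = e * (\<psi>2 a \<bullet> P a)"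
      unfolding c e cross2_scale_left cross2_scale_right cross2_rot90_left cross2_rot90_right by simp
    \<comment> \<open>The equality of determinants leaves one degree of freedom, and
      \<open>k\<close> is the common factor of the two displacements.\<close>
    define k where "k = c / (\<psi>2 a \<bullet> P a)"
    have "c = k * (\<psi>2 a \<bullet> P a)" "e = k * (\<psi>1 a \<bullet> Q a)"
      using elim ce by (auto simp: k_def field_simps)
    then have "H a - G a = k *\<^sub>R \<omega> a"
      using c e by (intro column_inject_2) (simp_all add: column_diff column_scaleR \<omega>_def)
    then show ?case ..
  qed
  then have "\<forall>\<^sub>F a in F. H a - G a = (SOME k. H a - G a = k *\<^sub>R \<omega> a) *\<^sub>R \<omega> a"
    by eventually_elim (rule someI_ex)
  then show ?thesis
    using lim\<omega> by (intro exI[of _ "\<lambda>a. SOME k. H a - G a = k *\<^sub>R \<omega> a"] exI[of _ \<omega>] conjI)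
qed

end

section \<open>Whitney extension on the line\<close>

text \<open>Two distinct points of \<open>C\<close> approach \<open>x\<close> independently; a limit
  of difference quotients along this filter is strict differentiability relative to
  \<open>C\<close>. At an isolated point of \<open>C\<close> the filter is trivial and every slope
  qualifies.\<close>

definition secant_filter :: "real set \<Rightarrow> real \<Rightarrow> (real \<times> real) filter" where
  "secant_filter C x = inf (nhds (x, x)) (principal {(s, t). s \<in> C \<and> t \<in> C \<and> s \<noteq> t})"

lemma eventually_secant_filter:
  "eventually P (secant_filter C x) \<longleftrightarrow>
    (\<exists>d>0. \<forall>s\<in>C. \<forall>t\<in>C. \<bar>s - x\<bar> < d \<longrightarrow> \<bar>t - x\<bar> < d \<longrightarrow> s \<noteq> t \<longrightarrow> P (s, t))"
proof -
  have "eventually P (secant_filter C x) \<longleftrightarrow>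
     (\<forall>\<^sub>F z in nhds x \<times>\<^sub>F nhds x. fst z \<in> C \<and> snd z \<in> C \<and> fst z \<noteq> snd z \<longrightarrow> P z)"
    by (simp add: secant_filter_def eventually_inf_principal nhds_prod case_prod_beta)
  also have "\<dots> \<longleftrightarrow> (\<exists>d>0. \<forall>s\<in>C. \<forall>t\<in>C. \<bar>s - x\<bar> < d \<longrightarrow> \<bar>t - x\<bar> < d \<longrightarrow> s \<noteq> t \<longrightarrow> P (s, t))"
  proof
    assume "\<forall>\<^sub>F z in nhds x \<times>\<^sub>F nhds x. fst z \<in> C \<and> snd z \<in> C \<and> fst z \<noteq> snd z \<longrightarrow> P z"
    then obtain Q R where QR: "eventually Q (nhds x)" "eventually R (nhds x)"
      "\<And>s t. Q s \<Longrightarrow> R t \<Longrightarrow> s \<in> C \<and> t \<in> C \<and> s \<noteq> t \<longrightarrow> P (s, t)"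
      unfolding eventually_prod_filter by auto
    from QR(1,2) obtain d e where "d > 0" "e > 0" "\<And>s. \<bar>s - x\<bar> < d \<Longrightarrow> Q s" "\<And>s. \<bar>s - x\<bar> < e \<Longrightarrow> R s"
      unfolding eventually_nhds_metric dist_real_def by blast
    with QR(3) show "\<exists>d>0. \<forall>s\<in>C. \<forall>t\<in>C. \<bar>s - x\<bar> < d \<longrightarrow> \<bar>t - x\<bar> < d \<longrightarrow> s \<noteq> t \<longrightarrow> P (s, t)"
      by (intro exI[of _ "min d e"]) auto
  next
    assume "\<exists>d>0. \<forall>s\<in>C. \<forall>t\<in>C. \<bar>s - x\<bar> < d \<longrightarrow> \<bar>t - x\<bar> < d \<longrightarrow> s \<noteq> t \<longrightarrow> P (s, t)"
    then obtain d where d: "d > 0" "\<And>s t. s \<in> C \<Longrightarrow> t \<in> C \<Longrightarrow> \<bar>s - x\<bar> < d \<Longrightarrow> \<bar>t - x\<bar> < d \<Longrightarrow> s \<noteq> t \<Longrightarrow> P (s, t)"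
      by blast
    then have "\<forall>\<^sub>F s in nhds x. \<bar>s - x\<bar> < d"
      unfolding eventually_nhds_metric dist_real_def by blast
    then show "\<forall>\<^sub>F z in nhds x \<times>\<^sub>F nhds x. fst z \<in> C \<and> snd z \<in> C \<and> fst z \<noteq> snd z \<longrightarrow> P z"
      unfolding eventually_prod_filter using d(2) by auto
  qed
  finally show ?thesis .
qed

lemma tendsto_secant_filter_iff:
  "((\<lambda>(s, t). (f s - f t) / (s - t)) \<longlongrightarrow> D) (secant_filter C x) \<longleftrightarrow>
    (\<forall>e>0. \<exists>d>0. \<forall>s\<in>C. \<forall>t\<in>C. \<bar>s - x\<bar> < d \<longrightarrow> \<bar>t - x\<bar> < d \<longrightarrow> \<bar>f s - f t - D * (s - t)\<bar> \<le> e * \<bar>s - t\<bar>)"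
    (is "?L \<longleftrightarrow> ?R") for f :: "real \<Rightarrow> real"
proof -
  have eq: "\<bar>(f s - f t) / (s - t) - D\<bar> \<le> e \<longleftrightarrow> \<bar>f s - f t - D * (s - t)\<bar> \<le> e * \<bar>s - t\<bar>" if "s \<noteq> t" for s t e
  proof -
    have "(f s - f t) / (s - t) - D = (f s - f t - D * (s - t)) / (s - t)"
      using that by (simp add: field_simps)
    then show ?thesis
      using that by (simp add: abs_divide pos_divide_le_eq)
  qed
  show ?thesis
  proof
    assume ?L
    show ?R
    proof (intro allI impI)
      fix e :: real assume "e > 0"
      with \<open>?L\<close> have "\<forall>\<^sub>F z in secant_filter C x. \<bar>(case z of (s, t) \<Rightarrow> (f s - f t) / (s - t)) - D\<bar> < e"
        by (auto simp: tendsto_iff dist_real_def)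
      then obtain d where "d > 0" "\<forall>s\<in>C. \<forall>t\<in>C. \<bar>s - x\<bar> < d \<longrightarrow> \<bar>t - x\<bar> < d \<longrightarrow> s \<noteq> t \<longrightarrow> \<bar>(f s - f t) / (s - t) - D\<bar> < e"
        unfolding eventually_secant_filter by auto
      moreover from this have "\<bar>f s - f t - D * (s - t)\<bar> \<le> e * \<bar>s - t\<bar>"
        if "s \<in> C" "t \<in> C" "\<bar>s - x\<bar> < d" "\<bar>t - x\<bar> < d" for s t
        using eq[of s t e] less_imp_le that by (cases "s = t") auto
      ultimately show "\<exists>d>0. \<forall>s\<in>C. \<forall>t\<in>C. \<bar>s - x\<bar> < d \<longrightarrow> \<bar>t - x\<bar> < d \<longrightarrow> \<bar>f s - f t - D * (s - t)\<bar> \<le> e * \<bar>s - t\<bar>"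
        by blast
    qed
  next
    assume ?R
    show ?L
      unfolding tendsto_iff dist_real_def
    proof (intro allI impI)
      fix e :: real assume "e > 0"
      with \<open>?R\<close> obtain d where "d > 0" and d: "\<forall>s\<in>C. \<forall>t\<in>C. \<bar>s - x\<bar> < d \<longrightarrow> \<bar>t - x\<bar> < d \<longrightarrow> \<bar>f s - f t - D * (s - t)\<bar> \<le> (e / 2) * \<bar>s - t\<bar>"
        by (meson half_gt_zero)
      have "\<bar>(f s - f t) / (s - t) - D\<bar> < e" if "s \<in> C" "t \<in> C" "\<bar>s - x\<bar> < d" "\<bar>t - x\<bar> < d" "s \<noteq> t" for s t
        using d that eq[of s t "e/2"] \<open>e > 0\<close> by force
      then show "\<forall>\<^sub>F z in secant_filter C x. \<bar>(case z of (s, t) \<Rightarrow> (f s - f t) / (s - t)) - D\<bar> < e"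
        unfolding eventually_secant_filter using \<open>d > 0\<close> by auto
    qed
  qed
qed

text \<open>The estimate at \<open>x\<close> controls difference quotients between any two points
  near \<open>x\<close>, hence also the derivatives at those points: continuity of \<open>D\<close>
  comes for free.\<close>

lemma strictly_differentiable_imp_C1:
  fixes f :: "real \<Rightarrow> real"
  assumes "\<And>x e. e > 0 \<Longrightarrow> \<exists>d>0. \<forall>s t. \<bar>s - x\<bar> < d \<longrightarrow> \<bar>t - x\<bar> < d \<longrightarrow> \<bar>f s - f t - D x * (s - t)\<bar> \<le> e * \<bar>s - t\<bar>"
  shows "(f has_real_derivative D x) (at x)" "continuous_on UNIV D"
proof -
  show der: "(f has_real_derivative D x) (at x)" for x
    unfolding has_field_derivative_def has_derivative_at_alt
  proof (intro conjI allI impI bounded_linear_mult_right)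
    fix e :: real assume "e > 0"
    then obtain d where d: "d > 0" "\<And>s t. \<bar>s - x\<bar> < d \<Longrightarrow> \<bar>t - x\<bar> < d \<Longrightarrow> \<bar>f s - f t - D x * (s - t)\<bar> \<le> e * \<bar>s - t\<bar>"
      using assms by meson
    then show "\<exists>d>0. \<forall>y. norm (y - x) < d \<longrightarrow> norm (f y - f x - D x * (y - x)) \<le> e * norm (y - x)"
      using d(2)[of _ x] by (intro exI[of _ d]) auto
  qed
  show "continuous_on UNIV D"
    unfolding continuous_on_iff
  proof (intro ballI allI impI)
    fix x e :: real assume "e > 0"
    then obtain d where d: "d > 0" "\<And>s t. \<bar>s - x\<bar> < d \<Longrightarrow> \<bar>t - x\<bar> < d \<Longrightarrow> \<bar>f s - f t - D x * (s - t)\<bar> \<le> (e / 2) * \<bar>s - t\<bar>"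
      using assms by (meson half_gt_zero)
    have "\<bar>D y - D x\<bar> \<le> e / 2" if y: "\<bar>y - x\<bar> < d" for y
    proof (rule tendsto_upperbound[where F = "at y"])
      have "((\<lambda>z. (f z - f y) / (z - y)) \<longlongrightarrow> D y) (at y)"
        using der[of y] by (simp add: has_field_derivative_iff)
      then show "((\<lambda>z. \<bar>(f z - f y) / (z - y) - D x\<bar>) \<longlongrightarrow> \<bar>D y - D x\<bar>) (at y)"
        by (intro tendsto_intros)
      have "\<forall>\<^sub>F z in nhds y. \<bar>z - x\<bar> < d"
        by (intro order_tendstoD(2)[of _ "\<bar>y - x\<bar>"] tendsto_intros filterlim_ident y)
      then have "\<forall>\<^sub>F z in at y. \<bar>z - x\<bar> < d"
        by (auto simp: eventually_at_filter elim: eventually_mono)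
      moreover have "\<forall>\<^sub>F z in at y. z \<noteq> y"
        by (simp add: eventually_at_filter)
      ultimately show "\<forall>\<^sub>F z in at y. \<bar>(f z - f y) / (z - y) - D x\<bar> \<le> e / 2"
      proof eventually_elim
        case (elim z)
        have "(f z - f y) / (z - y) - D x = (f z - f y - D x * (z - y)) / (z - y)"
          using elim by (simp add: field_simps)
        then show ?case
          using d(2)[of z y] elim y by (simp add: abs_divide pos_divide_le_eq)
      qed
    qed simp
    then show "\<exists>d>0. \<forall>x'\<in>UNIV. dist x' x < d \<longrightarrow> dist (D x') (D x) < e"
      using d(1) \<open>e > 0\<close> by (intro exI[of _ d]) (force simp: dist_real_def)
  qed
qed


lemma C1_imp_strictly_differentiable:
  fixes h h' :: "real \<Rightarrow> real"
  assumes der: "\<And>t. (h has_real_derivative h' t) (at t)" and cont: "continuous_on UNIV h'" and "e > 0"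
  shows "\<exists>d>0. \<forall>s t. \<bar>s - x\<bar> < d \<longrightarrow> \<bar>t - x\<bar> < d \<longrightarrow> \<bar>h s - h t - h' x * (s - t)\<bar> \<le> e * \<bar>s - t\<bar>"
proof -
  obtain d where d: "d > 0" "\<And>t. \<bar>t - x\<bar> < d \<Longrightarrow> \<bar>h' t - h' x\<bar> < e"
    using cont \<open>e > 0\<close> unfolding continuous_on_iff dist_real_def by (meson UNIV_I)
  have less: "\<bar>h s - h t - h' x * (s - t)\<bar> \<le> e * \<bar>s - t\<bar>" if "\<bar>s - x\<bar> < d" "\<bar>t - x\<bar> < d" "s < t" for s t
  proof -
    obtain z where z: "s < z" "z < t" "h t - h s = (t - s) * h' z"
      using MVT2[OF \<open>s < t\<close>] der by blast
    then have "h s - h t - h' x * (s - t) = (h' z - h' x) * (s - t)"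
      by (simp add: algebra_simps)
    then have "\<bar>h s - h t - h' x * (s - t)\<bar> = \<bar>h' z - h' x\<bar> * \<bar>s - t\<bar>"
      by (simp only: abs_mult)
    also have "\<dots> \<le> e * \<bar>s - t\<bar>"
    proof -
      have "\<bar>z - x\<bar> < d"
        using z that by linarith
      then show ?thesis
        using d(2)[of z] by (intro mult_right_mono) auto
    qed
    finally show ?thesis .
  qed
  have "\<bar>h s - h t - h' x * (s - t)\<bar> \<le> e * \<bar>s - t\<bar>" if "\<bar>s - x\<bar> < d" "\<bar>t - x\<bar> < d" for s t
    using less[of s t] less[of t s] that by (cases s t rule: linorder_cases) (auto simp: algebra_simps)
  then show ?thesis
    using d(1) by blast
qed

text \<open>Unboundedness in both directions, which periodicity will supply, gives every real number
  a neighbour in \<open>C\<close> on either side, so all gaps are bounded.\<close>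

locale whitney_data =
  fixes C :: "real set" and f D :: "real \<Rightarrow> real"
  assumes closed: "closed C"
    and unbounded: "\<And>t. \<exists>c\<in>C. c \<le> t" "\<And>t. \<exists>c\<in>C. t \<le> c"
    and strict: "\<And>x. x \<in> C \<Longrightarrow> ((\<lambda>(s, t). (f s - f t) / (s - t)) \<longlongrightarrow> D x) (secant_filter C x)"
    and cont: "continuous_on C D"
begin

definition lo :: "real \<Rightarrow> real" where "lo t = Sup (C \<inter> {..t})"
definition hi :: "real \<Rightarrow> real" where "hi t = Inf (C \<inter> {t..})"

lemma lo: "lo t \<in> C" "lo t \<le> t" "\<And>c. c \<in> C \<Longrightarrow> c \<le> t \<Longrightarrow> c \<le> lo t"
proof -
  have ne: "C \<inter> {..t} \<noteq> {}" and bdd: "bdd_above (C \<inter> {..t})"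
    using unbounded(1)[of t] by auto
  have "lo t \<in> C \<inter> {..t}"
    unfolding lo_def by (intro closed_contains_Sup ne bdd closed_Int closed) auto
  then show "lo t \<in> C" "lo t \<le> t" by auto
  show "c \<le> lo t" if "c \<in> C" "c \<le> t" for c
    unfolding lo_def using that by (intro cSup_upper bdd) auto
qed

lemma hi: "hi t \<in> C" "t \<le> hi t" "\<And>c. c \<in> C \<Longrightarrow> t \<le> c \<Longrightarrow> hi t \<le> c"
proof -
  have ne: "C \<inter> {t..} \<noteq> {}" and bdd: "bdd_below (C \<inter> {t..})"
    using unbounded(2)[of t] by auto
  have "hi t \<in> C \<inter> {t..}"
    unfolding hi_def by (intro closed_contains_Inf ne bdd closed_Int closed) auto
  then show "hi t \<in> C" "t \<le> hi t" by auto
  show "hi t \<le> c" if "c \<in> C" "t \<le> c" for c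
    unfolding hi_def using that by (intro cInf_lower bdd) auto
qed

lemma lo_eqI: "a \<in> C \<Longrightarrow> a \<le> t \<Longrightarrow> (\<And>c. c \<in> C \<Longrightarrow> c \<le> t \<Longrightarrow> c \<le> a) \<Longrightarrow> lo t = a"
  by (meson lo order_antisym)

lemma hi_eqI: "a \<in> C \<Longrightarrow> t \<le> a \<Longrightarrow> (\<And>c. c \<in> C \<Longrightarrow> t \<le> c \<Longrightarrow> a \<le> c) \<Longrightarrow> hi t = a"
  by (meson hi order_antisym)

section \<open>Cubic interpolation across the gaps\<close>

definition slope :: "real \<Rightarrow> real \<Rightarrow> real" where
  "slope a b = (f b - f a) / (b - a)"

text \<open>
  The cubic Hermite interpolant. For \<open>a = b\<close> the junk value \<open>x / 0 = 0\<close> turns it into the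
  affine function with value \<open>f a\<close> and slope \<open>D a\<close> at \<open>a\<close>, which is what is wanted at points of \<open>C\<close>.
\<close>

definition hermite :: "real \<Rightarrow> real \<Rightarrow> real \<Rightarrow> real" where
  "hermite a b t = f a + D a * (t - a) + (3 * slope a b - 2 * D a - D b) / (b - a) * (t - a)^2
     + (D a + D b - 2 * slope a b) / (b - a)^2 * (t - a)^3"

definition hermite' :: "real \<Rightarrow> real \<Rightarrow> real \<Rightarrow> real" where
  "hermite' a b t = D a + (3 * slope a b - 2 * D a - D b) / (b - a) * (2 * (t - a))
     + (D a + D b - 2 * slope a b) / (b - a)^2 * (3 * (t - a)^2)"

lemma hermite_derivative: "(hermite a b has_real_derivative hermite' a b t) (at t)"
proof -
  have "((\<lambda>t. p + q * (t - a) + r * (t - a)^2 + s * (t - a)^3) has_real_derivative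
      q + r * (2 * (t - a)) + s * (3 * (t - a)^2)) (at t)" for p q r s
    by (auto intro!: derivative_eq_intros)
  then show ?thesis
    unfolding hermite_def hermite'_def .
qed

lemma continuous_hermite': "continuous_on UNIV (hermite' a b)"
  unfolding hermite'_def by (intro continuous_intros)

lemma hermite_left [simp]: "hermite a b a = f a" "hermite' a b a = D a"
  by (simp_all add: hermite_def hermite'_def)

lemma hermite_right:
  assumes "a < b"
  shows "hermite a b b = f b" "hermite' a b b = D b"
proof -
  define L where "L = b - a"
  have L: "L > 0" "b - a = L" using assms by (auto simp: L_def)
  have s: "slope a b * L = f b - f a"
    using L by (simp add: slope_def)
  have "hermite a b b = f a + D a * L + (3 * slope a b - 2 * D a - D b) * L + (D a + D b - 2 * slope a b) * L"
    unfolding hermite_def L(2) using L by (simp add: power2_eq_square power3_eq_cube)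
  also have "\<dots> = f a + slope a b * L"
    by (simp add: algebra_simps)
  finally show "hermite a b b = f b"
    using s by simp
  show "hermite' a b b = D b"
    unfolding hermite'_def L(2) using L by (simp add: power2_eq_square)
qed

text \<open>The derivative is an affine combination of \<open>D a\<close>, \<open>D b\<close> and
  \<open>slope a b\<close> with coefficients summing to 1, so \<open>c\<close> can be subtracted
  from each of them. The constant is \<open>1 + 2 * 6 + 3 * 4 = 25\<close>.\<close>

lemma hermite'_bound:
  assumes "a < b" "a \<le> t" "t \<le> b" "\<bar>D a - c\<bar> \<le> e" "\<bar>D b - c\<bar> \<le> e" "\<bar>slope a b - c\<bar> \<le> e"
  shows "\<bar>hermite' a b t - c\<bar> \<le> 25 * e"
proof -
  define \<tau> where "\<tau> = (t - a) / (b - a)"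
  have \<tau>: "0 \<le> \<tau>" "\<tau> \<le> 1"
    using assms by (auto simp: \<tau>_def)
  have "\<tau> * \<tau> \<le> 1 * 1"
    using \<tau> by (intro mult_mono) auto
  then have \<tau>2: "0 \<le> \<tau> * \<tau>" "\<tau> * \<tau> \<le> 1"
    using \<tau> by auto
  define A where "A = 3 * (slope a b - c) - 2 * (D a - c) - (D b - c)"
  define B where "B = (D a - c) + (D b - c) - 2 * (slope a b - c)"
  have AB: "\<bar>A\<bar> \<le> 6 * e" "\<bar>B\<bar> \<le> 4 * e"
    using assms(4-6) by (simp_all add: A_def B_def)
  have "hermite' a b t - c = (D a - c) + 2 * (\<tau> * A) + 3 * ((\<tau> * \<tau>) * B)"
    unfolding hermite'_def A_def B_def \<tau>_def by (simp add: power2_eq_square field_simps)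
  moreover have "\<bar>\<tau> * A\<bar> \<le> 6 * e"
    using \<tau> AB(1) by (simp add: abs_mult) (meson abs_ge_zero mult_left_le_one_le order_trans)
  moreover have "\<bar>(\<tau> * \<tau>) * B\<bar> \<le> 4 * e"
    using \<tau>2 AB(2) unfolding abs_mult[of "\<tau> * \<tau>"]
    by (metis abs_ge_zero abs_of_nonneg mult_left_le_one_le order_trans)
  ultimately show ?thesis
    using assms(4) by linarith
qed

definition ext :: "real \<Rightarrow> real" where "ext t = hermite (lo t) (hi t) t"
definition ext' :: "real \<Rightarrow> real" where "ext' t = hermite' (lo t) (hi t) t"

lemma ext_on_C:
  assumes "t \<in> C"
  shows "ext t = f t" "ext' t = D t"
proof -
  have "lo t = t"
    using assms by (intro lo_eqI) auto
  then show "ext t = f t" "ext' t = D t"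
    by (simp_all add: ext_def ext'_def)
qed

text \<open>At the two ends of the gap \<open>ext\<close> is computed from the degenerate
  interpolant with \<open>lo t = hi t = t\<close>; the agreement there is the matching of values and
  slopes.\<close>

lemma ext_on_gap:
  assumes ab: "a \<in> C" "b \<in> C" "a < b" "C \<inter> {a<..<b} = {}" and t: "a \<le> t" "t \<le> b"
  shows "ext t = hermite a b t" "ext' t = hermite' a b t"
proof -
  consider "t = a" | "t = b" | "a < t" "t < b"
    using t by linarith
  then have "ext t = hermite a b t \<and> ext' t = hermite' a b t"
  proof cases
    case 3
    have "lo t = a"
      by (rule lo_eqI) (use ab 3 in \<open>force+\<close>)
    moreover have "hi t = b"
      by (rule hi_eqI) (use ab 3 in \<open>force+\<close>)
    ultimately show ?thesis
      by (simp add: ext_def ext'_def)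
  qed (use ab ext_on_C hermite_right in auto)
  then show "ext t = hermite a b t" "ext' t = hermite' a b t" by auto
qed

lemma ext_gap_bound:
  assumes ab: "a \<in> C" "b \<in> C" "a < b" "C \<inter> {a<..<b} = {}"
    and st: "a \<le> s" "s \<le> t" "t \<le> b"
    and bd: "\<bar>D a - c\<bar> \<le> e" "\<bar>D b - c\<bar> \<le> e" "\<bar>f b - f a - c * (b - a)\<bar> \<le> e * (b - a)"
  shows "\<bar>ext t - ext s - c * (t - s)\<bar> \<le> 25 * e * (t - s)"
proof (cases "s = t")
  case False
  then have "s < t" using st by simp
  then obtain z where z: "s < z" "z < t" "hermite a b t - hermite a b s = (t - s) * hermite' a b z"
    using MVT2[OF \<open>s < t\<close>] hermite_derivative by blast
  have "slope a b - c = (f b - f a - c * (b - a)) / (b - a)"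
    using ab by (simp add: slope_def field_simps)
  then have "\<bar>slope a b - c\<bar> \<le> e"
    using bd(3) ab by (simp add: abs_divide pos_divide_le_eq)
  then have "\<bar>hermite' a b z - c\<bar> \<le> 25 * e"
    using z st bd ab by (intro hermite'_bound) auto
  moreover have "ext t - ext s - c * (t - s) = (hermite' a b z - c) * (t - s)"
    using ext_on_gap(1)[OF ab, of t] ext_on_gap(1)[OF ab, of s] st z(3) by (simp add: algebra_simps)
  ultimately show ?thesis
    using \<open>s < t\<close> by (simp add: abs_mult)
qed simp

text \<open>The interval is cut at the first and the last point of \<open>C\<close> in it. The outer
  pieces lie in single gaps, the middle one has both ends in \<open>C\<close>, and the three
  estimates add up.\<close>

lemma ext_interval_bound:
  assumes uv: "u \<in> C" "v \<in> C" and st: "u \<le> s" "s \<le> t" "t \<le> v" and e: "e \<ge> 0"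
    and bdD: "\<And>s. s \<in> C \<Longrightarrow> u \<le> s \<Longrightarrow> s \<le> v \<Longrightarrow> \<bar>D s - c\<bar> \<le> e"
    and bdf: "\<And>s t. s \<in> C \<Longrightarrow> t \<in> C \<Longrightarrow> u \<le> s \<Longrightarrow> s \<le> t \<Longrightarrow> t \<le> v \<Longrightarrow> \<bar>f t - f s - c * (t - s)\<bar> \<le> e * (t - s)"
  shows "\<bar>ext t - ext s - c * (t - s)\<bar> \<le> 25 * e * (t - s)"
proof -
  have gap: "\<bar>ext t - ext s - c * (t - s)\<bar> \<le> 25 * e * (t - s)"
    if st: "u \<le> s" "s \<le> t" "t \<le> v" and nogap: "C \<inter> {s<..<t} = {}" for s t
  proof (cases "s = t")
    case False
    define a where "a = lo s"
    define b where "b = hi t"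
    have a: "a \<in> C" "u \<le> a" "a \<le> s" and b: "b \<in> C" "t \<le> b" "b \<le> v"
      using lo(1,2)[of s] hi(1,2)[of t] lo(3)[OF uv(1), of s] hi(3)[OF uv(2), of t] st
      by (auto simp: a_def b_def)
    have "c \<notin> {a<..<b}" if c: "c \<in> C" for c
      using lo(3)[OF c, of s] hi(3)[OF c, of t] nogap c by (force simp: a_def b_def not_le)
    then have "C \<inter> {a<..<b} = {}" by blast
    then show ?thesis
      using a b st False by (intro ext_gap_bound[of a b]) (auto intro!: bdD bdf)
  qed simp
  show ?thesis
  proof (cases "C \<inter> {s<..<t} = {}")
    case True
    then show ?thesis using gap st by blast
  next
    case False
    define p where "p = hi s"
    define q where "q = lo t"
    obtain m where m: "m \<in> C" "s < m" "m < t"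
      using False by auto
    have p: "p \<in> C" "s \<le> p" "p \<le> m" and q: "q \<in> C" "q \<le> t" "m \<le> q"
      using hi(1,2)[of s] lo(1,2)[of t] hi(3)[OF m(1), of s] lo(3)[OF m(1), of t] m
      by (auto simp: p_def q_def)
    have "\<not> (s < c' \<and> c' < p)" "\<not> (q < c' \<and> c' < t)" if "c' \<in> C" for c'
      using hi(3)[OF that, of s] lo(3)[OF that, of t] by (auto simp: p_def q_def)
    then have "C \<inter> {s<..<p} = {}" "C \<inter> {q<..<t} = {}"
      by auto
    then have "\<bar>ext p - ext s - c * (p - s)\<bar> \<le> 25 * e * (p - s)"
      and "\<bar>ext t - ext q - c * (t - q)\<bar> \<le> 25 * e * (t - q)"
      using gap[of s p] gap[of q t] p q m st by auto
    moreover have "\<bar>ext q - ext p - c * (q - p)\<bar> \<le> 25 * e * (q - p)"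
    proof -
      have "\<bar>ext q - ext p - c * (q - p)\<bar> \<le> e * (q - p)"
        using bdf[of p q] p q m st by (simp add: ext_on_C)
      also have "\<dots> \<le> 25 * e * (q - p)"
        using p q m e by (intro mult_right_mono) auto
      finally show ?thesis .
    qed
    ultimately show ?thesis
      by (simp add: algebra_simps)
  qed
qed


text \<open>Off \<open>C\<close> the extension is locally a cubic. At a point of \<open>C\<close>
  each side is treated separately: either a point of \<open>C\<close> lies close on that side and
  bounds an interval for \<open>ext_interval_bound\<close>, or \<open>x\<close> is the end of a gap
  and a single cubic is in charge. Estimates on both sides add up across \<open>x\<close>.\<close>

lemma ext_strictly_differentiable:
  assumes e: "e > 0"
  shows "\<exists>d>0. \<forall>s t. \<bar>s - x\<bar> < d \<longrightarrow> \<bar>t - x\<bar> < d \<longrightarrow> \<bar>ext s - ext t - ext' x * (s - t)\<bar> \<le> e * \<bar>s - t\<bar>"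
proof (cases "x \<in> C")
  case False
  define a where "a = lo x"
  define b where "b = hi x"
  have a: "a \<in> C" "a < x" and b: "b \<in> C" "x < b"
    using lo(1,2)[of x] hi(1,2)[of x] False by (auto simp: a_def b_def less_le)
  have gap: "C \<inter> {a<..<b} = {}"
    using lo(3)[of _ x] hi(3)[of _ x] unfolding a_def b_def by (fastforce simp: not_le)
  obtain d where d: "d > 0"
    "\<forall>s t. \<bar>s - x\<bar> < d \<longrightarrow> \<bar>t - x\<bar> < d \<longrightarrow> \<bar>hermite a b s - hermite a b t - hermite' a b x * (s - t)\<bar> \<le> e * \<bar>s - t\<bar>"
    using C1_imp_strictly_differentiable[OF hermite_derivative continuous_hermite' e] by blast
  have "\<bar>ext s - ext t - ext' x * (s - t)\<bar> \<le> e * \<bar>s - t\<bar>"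
    if st: "\<bar>s - x\<bar> < min d (min (x - a) (b - x))" "\<bar>t - x\<bar> < min d (min (x - a) (b - x))" for s t
  proof -
    have "ext s = hermite a b s" "ext t = hermite a b t" "ext' x = hermite' a b x"
      using ext_on_gap[OF a(1) b(1) _ gap] st a b by auto
    then show ?thesis
      using d(2) st by simp
  qed
  then show ?thesis
    using d(1) a b by (intro exI[of _ "min d (min (x - a) (b - x))"]) auto
next
  case x: True
  then have ext'x: "ext' x = D x"
    by (rule ext_on_C)
  define e' where "e' = e / 25"
  have e': "e' > 0" "25 * e' = e"
    using e by (auto simp: e'_def)
  obtain d1 where d1: "d1 > 0"
    "\<And>s t. s \<in> C \<Longrightarrow> t \<in> C \<Longrightarrow> \<bar>s - x\<bar> < d1 \<Longrightarrow> \<bar>t - x\<bar> < d1 \<Longrightarrow> \<bar>f s - f t - D x * (s - t)\<bar> \<le> e' * \<bar>s - t\<bar>"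
    using strict[OF x] e'(1) unfolding tendsto_secant_filter_iff by meson
  obtain d2 where d2: "d2 > 0" "\<And>s. s \<in> C \<Longrightarrow> \<bar>s - x\<bar> < d2 \<Longrightarrow> \<bar>D s - D x\<bar> < e'"
    using cont x e'(1) unfolding continuous_on_iff dist_real_def by meson
  define \<delta> where "\<delta> = min d1 d2"
  have \<delta>: "\<delta> > 0" using d1 d2 by (simp add: \<delta>_def)
  have bound: "\<bar>ext t - ext s - D x * (t - s)\<bar> \<le> e * (t - s)"
    if "u \<in> C" "v \<in> C" "x - \<delta> < u" "v < x + \<delta>" "u \<le> s" "s \<le> t" "t \<le> v" for u v s t
  proof -
    have "\<bar>ext t - ext s - D x * (t - s)\<bar> \<le> 25 * e' * (t - s)"
    proof (rule ext_interval_bound[OF that(1,2,5-7)])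
      fix s assume "s \<in> C" "u \<le> s" "s \<le> v"
      then have "\<bar>s - x\<bar> < d2"
        using that by (auto simp: \<delta>_def)
      then show "\<bar>D s - D x\<bar> \<le> e'"
        using d2(2)[of s] \<open>s \<in> C\<close> by simp
    next
      fix s t assume "s \<in> C" "t \<in> C" "u \<le> s" "s \<le> t" "t \<le> v"
      moreover from this have "\<bar>s - x\<bar> < d1" "\<bar>t - x\<bar> < d1"
        using that by (auto simp: \<delta>_def)
      ultimately show "\<bar>f t - f s - D x * (t - s)\<bar> \<le> e' * (t - s)"
        using d1(2)[of t s] by simp
    qed (use e' in simp)
    then show ?thesis
      by (simp add: e'(2))
  qed
  have right: "\<exists>d>0. \<forall>s t. x \<le> s \<longrightarrow> s \<le> t \<longrightarrow> t < x + d \<longrightarrow> \<bar>ext t - ext s - D x * (t - s)\<bar> \<le> e * (t - s)"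
  proof (cases "C \<inter> {x<..<x + \<delta>} = {}")
    case False
    then obtain v where "v \<in> C" "x < v" "v < x + \<delta>"
      by auto
    then show ?thesis
      using bound[OF x] \<delta> by (intro exI[of _ "v - x"]) auto
  next
    case True
    \<comment> \<open>As \<open>C\<close> has no point between \<open>x\<close> and
      \<open>x + \<delta>\<close>, this is the next point of \<open>C\<close> after
      \<open>x\<close>.\<close>
    define b where "b = hi (x + \<delta> / 2)"
    have b: "b \<in> C" "x < b"
      using hi(1,2)[of "x + \<delta> / 2"] \<delta> by (auto simp: b_def)
    have "C \<inter> {x<..<b} = {}"
    proof -
      have "c \<notin> {x<..<b}" if c: "c \<in> C" for c
      proof
        assume "c \<in> {x<..<b}"
        then have "\<not> x + \<delta> / 2 \<le> c" "x < c"
          using hi(3)[OF c, of "x + \<delta> / 2"] by (auto simp: b_def)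
        then show False
          using True c \<delta> by auto
      qed
      then show ?thesis by blast
    qed
    note g = ext_on_gap[OF x b this]
    obtain d where d: "d > 0"
      "\<And>s t. \<bar>s - x\<bar> < d \<Longrightarrow> \<bar>t - x\<bar> < d \<Longrightarrow> \<bar>hermite x b s - hermite x b t - hermite' x b x * (s - t)\<bar> \<le> e * \<bar>s - t\<bar>"
      using C1_imp_strictly_differentiable[OF hermite_derivative continuous_hermite' e] by blast
    have "\<bar>ext t - ext s - D x * (t - s)\<bar> \<le> e * (t - s)" if "x \<le> s" "s \<le> t" "t < x + min d (b - x)" for s t
      using d(2)[of t s] g[of s] g[of t] that by simp
    then show ?thesis
      using d b by (intro exI[of _ "min d (b - x)"]) auto
  qed
  have left: "\<exists>d>0. \<forall>s t. x - d < s \<longrightarrow> s \<le> t \<longrightarrow> t \<le> x \<longrightarrow> \<bar>ext t - ext s - D x * (t - s)\<bar> \<le> e * (t - s)"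
  proof (cases "C \<inter> {x - \<delta><..<x} = {}")
    case False
    then obtain u where "u \<in> C" "u < x" "x - \<delta> < u"
      by auto
    then show ?thesis
      using bound[OF _ x] \<delta> by (intro exI[of _ "x - u"]) auto
  next
    case True
    define a where "a = lo (x - \<delta> / 2)"
    have a: "a \<in> C" "a < x"
      using lo(1,2)[of "x - \<delta> / 2"] \<delta> by (auto simp: a_def)
    have "C \<inter> {a<..<x} = {}"
    proof -
      have "c \<notin> {a<..<x}" if c: "c \<in> C" for c
      proof
        assume "c \<in> {a<..<x}"
        then have "\<not> c \<le> x - \<delta> / 2" "c < x"
          using lo(3)[OF c, of "x - \<delta> / 2"] by (auto simp: a_def)
        then show False
          using True c \<delta> by auto
      qed
      then show ?thesis by blast
    qed
    note g = ext_on_gap[OF a(1) x a(2) this]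
    obtain d where d: "d > 0"
      "\<And>s t. \<bar>s - x\<bar> < d \<Longrightarrow> \<bar>t - x\<bar> < d \<Longrightarrow> \<bar>hermite a x s - hermite a x t - hermite' a x x * (s - t)\<bar> \<le> e * \<bar>s - t\<bar>"
      using C1_imp_strictly_differentiable[OF hermite_derivative continuous_hermite' e] by blast
    have "\<bar>ext t - ext s - D x * (t - s)\<bar> \<le> e * (t - s)" if "x - min d (x - a) < s" "s \<le> t" "t \<le> x" for s t
      using d(2)[of t s] g[of s] g[of t] that hermite_right(2)[OF a(2)] by simp
    then show ?thesis
      using d a by (intro exI[of _ "min d (x - a)"]) auto
  qed
  obtain dr where dr: "dr > 0" "\<And>s t. x \<le> s \<Longrightarrow> s \<le> t \<Longrightarrow> t < x + dr \<Longrightarrow> \<bar>ext t - ext s - D x * (t - s)\<bar> \<le> e * (t - s)"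
    using right by blast
  obtain dl where dl: "dl > 0" "\<And>s t. x - dl < s \<Longrightarrow> s \<le> t \<Longrightarrow> t \<le> x \<Longrightarrow> \<bar>ext t - ext s - D x * (t - s)\<bar> \<le> e * (t - s)"
    using left by blast
  have le: "\<bar>ext t - ext s - D x * (t - s)\<bar> \<le> e * (t - s)" if "\<bar>s - x\<bar> < min dl dr" "\<bar>t - x\<bar> < min dl dr" "s \<le> t" for s t
  proof -
    consider "x \<le> s" | "t \<le> x" | "s < x" "x < t"
      by linarith
    then show ?thesis
    proof cases
      case 3
      then have "\<bar>ext t - ext x - D x * (t - x)\<bar> \<le> e * (t - x)" "\<bar>ext x - ext s - D x * (x - s)\<bar> \<le> e * (x - s)"
        using dr(2)[of x t] dl(2)[of s x] that by auto
      then show ?thesis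
        by (simp add: algebra_simps)
    qed (use dr(2)[of s t] dl(2)[of s t] that in auto)
  qed
  have "\<bar>ext s - ext t - D x * (s - t)\<bar> \<le> e * \<bar>s - t\<bar>" if "\<bar>s - x\<bar> < min dl dr" "\<bar>t - x\<bar> < min dl dr" for s t
    using le[of s t] le[of t s] that by (cases "s \<le> t") (auto simp: algebra_simps)
  then show ?thesis
    unfolding ext'x using dl(1) dr(1) by (intro exI[of _ "min dl dr"]) simp
qed

lemmas ext_derivative = strictly_differentiable_imp_C1(1)[OF ext_strictly_differentiable]
  and continuous_ext' = strictly_differentiable_imp_C1(2)[OF ext_strictly_differentiable]

lemma ext_periodic:
  assumes C: "\<And>t. t + T \<in> C \<longleftrightarrow> t \<in> C" and per: "\<And>t. t \<in> C \<Longrightarrow> f (t + T) = f t" "\<And>t. t \<in> C \<Longrightarrow> D (t + T) = D t"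
  shows "ext (t + T) = ext t"
proof -
  have C': "c - T \<in> C \<longleftrightarrow> c \<in> C" for c
    using C[of "c - T"] by simp
  have "lo (t + T) = lo t + T"
  proof (rule lo_eqI)
    fix c assume "c \<in> C" "c \<le> t + T"
    then show "c \<le> lo t + T"
      using lo(3)[of "c - T" t] C' by simp
  qed (use lo C in auto)
  moreover have "hi (t + T) = hi t + T"
  proof (rule hi_eqI)
    fix c assume "c \<in> C" "t + T \<le> c"
    then show "hi t + T \<le> c"
      using hi(3)[of "c - T" t] C' by simp
  qed (use hi C in auto)
  ultimately show ?thesis
    using lo(1)[of t] hi(1)[of t] by (simp add: ext_def hermite_def slope_def per)
qed

end

section \<open>Iwasawa coordinates adapted to the hexagonal lattice\<close>

text \<open>These vectors run through an ellipse on which \<open>hex_rotation\<close> acts as a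
  shift of the parameter by \<open>pi / 3\<close>, so \<open>t\<close> is the angle of a row in the
  geometry of the hexagonal lattice.\<close>

definition sin_row :: "real \<Rightarrow> real^2" where "sin_row t = vector [sin t, sin (t + pi / 3)]"
definition cos_row :: "real \<Rightarrow> real^2" where "cos_row t = vector [cos t, cos (t + pi / 3)]"

text \<open>The quadratic form of the hexagonal lattice.\<close>

definition hex_form :: "real^2 \<Rightarrow> real^2 \<Rightarrow> real" where
  "hex_form v w = v$1 * w$1 + v$2 * w$2 - (v$1 * w$2 + v$2 * w$1) / 2"

text \<open>Acting from the right it relabels a frame with columns \<open>p\<close>,
  \<open>q\<close> as the frame \<open>q\<close>, \<open>q - p\<close>: one step around the
  hexagon.\<close>

definition hex_rotation :: "real^2^2" where
  "hex_rotation = vector [vector [0, -1], vector [1, 1]]"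

text \<open>
  Iwasawa coordinates on \<open>SL\<^sub>2(\<real>)\<close>, with the rotation group replaced by its conjugate that
  contains \<open>hex_rotation\<close>.
\<close>

definition hex_scale :: real where "hex_scale = sqrt (2 / sqrt 3)"

definition iwasawa :: "real \<Rightarrow> real \<Rightarrow> real \<Rightarrow> real^2^2" where
  "iwasawa t y z = vector
     [(hex_scale * exp y) *\<^sub>R cos_row t + (z * (hex_scale * exp (- y))) *\<^sub>R sin_row t,
      (hex_scale * exp (- y)) *\<^sub>R sin_row t]"

text \<open>The inverse of the parametrization: the second row of \<open>iwasawa t y z\<close> has
  \<open>hex_form\<close> equal to \<open>sqrt 3 / 2 * exp (- 2 * y)\<close>. Since
  \<open>cos_row\<close> and \<open>sin_row\<close> are orthogonal for this form, the projection
  coefficient of the first row onto the second is \<open>z\<close>.\<close>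

definition height_coord :: "real^2^2 \<Rightarrow> real" where
  "height_coord g = - (ln (2 / sqrt 3 * hex_form (g$2) (g$2)) / 2)"

definition shear_coord :: "real^2^2 \<Rightarrow> real" where
  "shear_coord g = hex_form (g$1) (g$2) / hex_form (g$2) (g$2)"

lemma hex_scale: "hex_scale > 0" "hex_scale * hex_scale = 2 / sqrt 3"
  by (simp_all add: hex_scale_def)

lemma det_rows: "det (g :: real^2^2) = cross2 (g$1) (g$2)"
  by (simp add: det_2 cross2_def algebra_simps)

lemma sin_add_pi3: "sin (t + pi / 3) = sin t / 2 + sqrt 3 / 2 * cos t"
  and cos_add_pi3: "cos (t + pi / 3) = cos t / 2 - sqrt 3 / 2 * sin t"
  by (simp_all add: sin_add cos_add sin_60 cos_60)

lemma cross2_cos_sin_row: "cross2 (cos_row t) (sin_row t) = sqrt 3 / 2"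
proof -
  have "c * (s / 2 + r / 2 * c) - (c / 2 - r / 2 * s) * s = r / 2 * (c * c + s * s)" for c s r :: real
    by (simp add: field_simps)
  from this[of "cos t" "sin t" "sqrt 3"] show ?thesis
    by (simp add: cross2_def cos_row_def sin_row_def sin_add_pi3 cos_add_pi3)
qed

lemma cross2_sin_row: "cross2 (sin_row s) (sin_row t) = sqrt 3 / 2 * sin (s - t)"
  by (simp add: cross2_def sin_row_def sin_add_pi3 sin_diff algebra_simps)

lemma hex_form_sin_row: "hex_form (sin_row t) (sin_row t) = 3 / 4"
proof -
  have "s * s + (s / 2 + r / 2 * c) * (s / 2 + r / 2 * c) - (s * (s / 2 + r / 2 * c) + (s / 2 + r / 2 * c) * s) / 2
      = 3 / 4 * (s * s) + r * r / 4 * (c * c)" for c s r :: real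
    by (simp add: field_simps)
  from this[of "sin t" "sqrt 3" "cos t"]
  have "hex_form (sin_row t) (sin_row t) = 3 / 4 * (sin t * sin t) + 3 / 4 * (cos t * cos t)"
    by (simp add: hex_form_def sin_row_def sin_add_pi3)
  also have "\<dots> = 3 / 4"
    unfolding distrib_left[symmetric] by (simp add: add.commute)
  finally show ?thesis .
qed

lemma hex_form_cos_sin_row: "hex_form (cos_row t) (sin_row t) = 0"
proof -
  have "c * s + (c / 2 - r / 2 * s) * (s / 2 + r / 2 * c) - (c * (s / 2 + r / 2 * c) + (c / 2 - r / 2 * s) * s) / 2
      = (3 - r * r) / 4 * (c * s)" for c s r :: real
    by (simp add: field_simps)
  from this[of "cos t" "sin t" "sqrt 3"] show ?thesis
    by (simp add: hex_form_def sin_row_def cos_row_def sin_add_pi3 cos_add_pi3)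
qed

lemma hex_form_add_left: "hex_form (u + v) w = hex_form u w + hex_form v w"
  and hex_form_diff_left: "hex_form (u - v) w = hex_form u w - hex_form v w"
  and hex_form_scale_left: "hex_form (c *\<^sub>R u) w = c * hex_form u w"
  and hex_form_add_right: "hex_form w (u + v) = hex_form w u + hex_form w v"
  and hex_form_diff_right: "hex_form w (u - v) = hex_form w u - hex_form w v"
  and hex_form_scale_right: "hex_form w (c *\<^sub>R u) = c * hex_form w u"
  by (simp_all add: hex_form_def field_simps)

lemmas hex_form_simps = hex_form_add_left hex_form_diff_left hex_form_scale_left
  hex_form_add_right hex_form_diff_right hex_form_scale_right

lemma hex_form_pos: "v \<noteq> 0 \<Longrightarrow> hex_form v v > 0"
proof -
  assume "v \<noteq> 0"
  then have "v$1 - v$2 / 2 \<noteq> 0 \<or> v$2 \<noteq> 0"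
    by (auto simp: vec_eq_iff forall_2)
  then have "(v$1 - v$2 / 2)\<^sup>2 > 0 \<or> (v$2)\<^sup>2 > 0"
    by simp
  moreover have "(v$1 - v$2 / 2)\<^sup>2 \<ge> 0" "(v$2)\<^sup>2 \<ge> 0"
    by simp_all
  moreover have "hex_form v v = (v$1 - v$2 / 2)\<^sup>2 + 3 / 4 * (v$2)\<^sup>2"
    by (simp add: hex_form_def power2_eq_square field_simps)
  ultimately show ?thesis
    by linarith
qed

lemma row_nonzero: "det g = 1 \<Longrightarrow> (g :: real^2^2)$2 \<noteq> 0"
  by (auto simp: det_2)

lemma iwasawa_rows [simp]:
  "iwasawa t y z $ 1 = (hex_scale * exp y) *\<^sub>R cos_row t + (z * (hex_scale * exp (- y))) *\<^sub>R sin_row t"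
  "iwasawa t y z $ 2 = (hex_scale * exp (- y)) *\<^sub>R sin_row t"
  by (simp_all add: iwasawa_def)

lemma det_iwasawa: "det (iwasawa t y z) = 1"
proof -
  \<comment> \<open>The square of \<open>hex_scale\<close> is chosen to cancel the area
    \<open>sqrt 3 / 2\<close> of the two trigonometric rows.\<close>
  have "det (iwasawa t y z) = hex_scale * hex_scale * (exp y * exp (- y)) * cross2 (cos_row t) (sin_row t)"
    by (simp add: det_rows cross2_def algebra_simps)
  then show ?thesis
    by (simp add: hex_scale cross2_cos_sin_row exp_minus)
qed

lemma row_mult_hex_rotation: "(g ** hex_rotation) $ i = vector [g$i$2, g$i$2 - g$i$1]"
  by (rule vec2_eqI) (simp_all add: matrix_matrix_mult_def sum_2 hex_rotation_def)

lemma column_mult_hex_rotation: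
  "column 1 (g ** hex_rotation) = column 2 g" "column 2 (g ** hex_rotation) = column 2 g - column 1 g"
  by (simp_all add: column_def row_mult_hex_rotation vec_eq_iff)

text \<open>Addition theorems for a shift by \<open>pi / 3\<close>. Height and shear do not change,
  so functions of the angle with period \<open>pi / 3\<close> describe curves of lattices.\<close>

lemma iwasawa_hex_rotation: "iwasawa t y z ** hex_rotation = iwasawa (t + pi / 3) y z"
proof -
  have "sin_row (t + pi / 3) = vector [sin_row t $ 2, sin_row t $ 2 - sin_row t $ 1]"
    "cos_row (t + pi / 3) = vector [cos_row t $ 2, cos_row t $ 2 - cos_row t $ 1]"
    unfolding sin_row_def cos_row_def
    by (rule vec2_eqI; simp only: vector_2 sin_add_pi3 cos_add_pi3; simp add: field_simps)+
  then have "(iwasawa t y z ** hex_rotation) $ 1 = iwasawa (t + pi / 3) y z $ 1"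
    "(iwasawa t y z ** hex_rotation) $ 2 = iwasawa (t + pi / 3) y z $ 2"
    by (intro vec2_eqI; simp add: row_mult_hex_rotation algebra_simps)+
  then show ?thesis
    by (simp add: vec_eq_iff forall_2)
qed

lemma hex_form_rotation: "hex_form ((g ** hex_rotation)$i) ((h ** hex_rotation)$j) = hex_form (g$i) (h$j)"
  and cross2_rotation: "cross2 ((g ** hex_rotation)$i) ((h ** hex_rotation)$j) = cross2 (g$i) (h$j)"
  by (simp_all add: row_mult_hex_rotation hex_form_def cross2_def field_simps)

lemma iwasawa_coords:
  assumes det: "det g = 1" and row: "g$2 = s *\<^sub>R sin_row t" and s: "s > 0"
  shows "g = iwasawa t (height_coord g) (shear_coord g)"
proof -
  have n: "hex_form (g$2) (g$2) = 3 / 4 * (s * s)"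
    unfolding row hex_form_simps by (simp add: hex_form_sin_row)
  have e: "exp (- height_coord g) = sqrt (sqrt 3 / 2) * s"
  proof -
    have "2 / sqrt 3 * (3 / 4 * (s * s)) = (sqrt (sqrt 3 / 2) * s) ^ 2"
      by (simp add: power2_eq_square field_simps)
    moreover have pos: "sqrt (sqrt 3 / 2) * s > 0"
      using s by simp
    ultimately have "- height_coord g = ln (sqrt (sqrt 3 / 2) * s)"
      unfolding height_coord_def n by (simp add: ln_realpow)
    then show ?thesis
      using pos by simp
  qed
  have "hex_scale * sqrt (sqrt 3 / 2) = sqrt (2 / sqrt 3 * (sqrt 3 / 2))"
    unfolding hex_scale_def real_sqrt_mult ..
  then have hs: "hex_scale * exp (- height_coord g) = s"
    unfolding e by (simp add: mult.assoc[symmetric])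
  have hs': "hex_scale * exp (height_coord g) = 2 / (sqrt 3 * s)"
  proof -
    have "(hex_scale * exp (height_coord g)) * (hex_scale * exp (- height_coord g)) = hex_scale * hex_scale"
      by (simp add: exp_minus)
    then show ?thesis
      unfolding hs hex_scale using s by (simp add: field_simps)
  qed
  obtain a b where r1: "g$1 = a *\<^sub>R cos_row t + b *\<^sub>R sin_row t"
    using cross2_expand[of "cos_row t" "sin_row t" "g$1"] by (auto simp: cross2_cos_sin_row)
  have "det g = a * s * cross2 (cos_row t) (sin_row t)"
    unfolding det_rows r1 row by (simp add: cross2_def algebra_simps)
  then have a: "a = 2 / (sqrt 3 * s)"
    using det s by (simp add: cross2_cos_sin_row field_simps)
  have "hex_form (g$1) (g$2) = b * s * (3 / 4)"
    unfolding r1 row hex_form_simps by (simp add: hex_form_cos_sin_row hex_form_sin_row)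
  then have "shear_coord g * s = b"
    unfolding shear_coord_def n using s by (simp add: field_simps)
  then have "g$1 = iwasawa t (height_coord g) (shear_coord g) $ 1" "g$2 = iwasawa t (height_coord g) (shear_coord g) $ 2"
    using hs hs' a r1 row by simp_all
  then show ?thesis
    by (simp add: vec_eq_iff forall_2)
qed

lemma sin_row_polar:
  assumes "v \<noteq> 0"
  obtains s t where "s > 0" "v = s *\<^sub>R sin_row t"
proof -
  \<comment> \<open>The pair \<open>(d, v$1)\<close> consists of the Cartesian coordinates in which
    the ellipse of \<open>sin_row\<close> becomes the unit circle.\<close>
  define d where "d = (2 * v$2 - v$1) / sqrt 3"
  define s where "s = sqrt ((v$1)\<^sup>2 + d\<^sup>2)"
  have "v$1 \<noteq> 0 \<or> d \<noteq> 0"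
    using assms by (auto simp: vec_eq_iff forall_2 d_def)
  then have s: "s > 0"
    by (simp add: s_def sum_power2_gt_zero_iff)
  have "d\<^sup>2 + (v$1)\<^sup>2 = s\<^sup>2"
    by (simp add: s_def)
  then have "(d / s)\<^sup>2 + (v$1 / s)\<^sup>2 = s\<^sup>2 / s\<^sup>2"
    by (simp only: power_divide add_divide_distrib[symmetric])
  then have "(d / s)\<^sup>2 + (v$1 / s)\<^sup>2 = 1"
    using s by simp
  then obtain t where t: "d / s = cos t" "v$1 / s = sin t"
    using sincos_total_2pi by metis
  have "v = s *\<^sub>R sin_row t"
  proof (rule vec2_eqI)
    show "v$1 = (s *\<^sub>R sin_row t)$1"
      using t s by (simp add: sin_row_def field_simps)
    have "s * sin (t + pi / 3) = (s * sin t) / 2 + sqrt 3 / 2 * (s * cos t)"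
      by (simp add: sin_add_pi3 algebra_simps)
    also have "\<dots> = v$1 / 2 + sqrt 3 / 2 * d"
      using s by (simp add: t[symmetric])
    also have "\<dots> = v$2"
      by (simp add: d_def field_simps)
    finally show "v$2 = (s *\<^sub>R sin_row t)$2"
      by (simp add: sin_row_def)
  qed
  with s show ?thesis
    by (rule that)
qed

lemma tendsto_hex_form [tendsto_intros]:
  "(v \<longlongrightarrow> a) F \<Longrightarrow> (w \<longlongrightarrow> b) F \<Longrightarrow> ((\<lambda>x. hex_form (v x) (w x)) \<longlongrightarrow> hex_form a b) F"
  unfolding hex_form_def by (intro tendsto_intros) auto

lemma tendsto_cross2 [tendsto_intros]:
  "(v \<longlongrightarrow> a) F \<Longrightarrow> (w \<longlongrightarrow> b) F \<Longrightarrow> ((\<lambda>x. cross2 (v x) (w x)) \<longlongrightarrow> cross2 a b) F"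
  unfolding cross2_def by (intro tendsto_intros)

lemma continuous_on_hex_form [continuous_intros]:
  "continuous_on S v \<Longrightarrow> continuous_on S w \<Longrightarrow> continuous_on S (\<lambda>x. hex_form (v x) (w x))"
  unfolding hex_form_def by (intro continuous_intros) auto

lemma continuous_on_cross2 [continuous_intros]:
  "continuous_on S v \<Longrightarrow> continuous_on S w \<Longrightarrow> continuous_on S (\<lambda>x. cross2 (v x) (w x))"
  unfolding cross2_def by (intro continuous_intros)

lemma continuous_on_sin_row [continuous_intros]:
  fixes f :: "'a::t2_space \<Rightarrow> real"
  shows "continuous_on S f \<Longrightarrow> continuous_on S (\<lambda>x. sin_row (f x))"
proof -
  have "sin_row t = (\<chi> i. if i = 1 then sin t else sin (t + pi / 3))" for t
    by (rule vec2_eqI) (simp_all add: sin_row_def)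
  moreover assume "continuous_on S f"
  then have "continuous_on S (\<lambda>x. if i = (1::2) then sin (f x) else sin (f x + pi / 3))" for i
    by (cases "i = 1") (simp_all add: continuous_on_sin continuous_on_add)
  ultimately show ?thesis
    by (simp add: continuous_on_vec_lambda)
qed

text \<open>The mean value theorem for the logarithm, stated as a product so that it also covers
  \<open>u x = v x\<close>; the factor \<open>l\<close> has the derivative as its limit.\<close>

lemma ln_secant:
  fixes u v :: "'a \<Rightarrow> real"
  assumes "(u \<longlongrightarrow> a) F" "(v \<longlongrightarrow> a) F" "a > 0"
  shows "\<exists>l. (l \<longlongrightarrow> 1 / a) F \<and> (\<forall>\<^sub>F x in F. ln (u x) - ln (v x) = l x * (u x - v x))"
proof -
  have pos: "\<forall>\<^sub>F x in F. u x > 0 \<and> v x > 0"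
    using assms by (intro eventually_conj order_tendstoD) auto
  have mvt: "\<exists>z. min p q \<le> z \<and> z \<le> max p q \<and> ln p - ln q = (1 / z) * (p - q)" if pq: "p > 0" "q > (0::real)" for p q
  proof -
    have less: "\<exists>z. p < z \<and> z < q \<and> ln q - ln p = (q - p) * (1 / z)" if "0 < p" "p < q" for p q :: real
      using that MVT2[of p q ln "\<lambda>z. 1 / z"] DERIV_ln_divide by simp
    consider "p < q" | "p = q" | "q < p"
      by linarith
    then show ?thesis
    proof cases
      case 1
      then obtain z where z: "p < z" "z < q" "ln q - ln p = (q - p) * (1 / z)"
        using less[OF pq(1) 1] by blast
      then have "ln p - ln q = (1 / z) * (p - q)"
        by (simp add: algebra_simps diff_divide_distrib)
      then show ?thesis
        using z by (intro exI[of _ z]) auto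
    next
      case 3
      then obtain z where z: "q < z" "z < p" "ln p - ln q = (p - q) * (1 / z)"
        using less[OF pq(2) 3] by blast
      then have "ln p - ln q = (1 / z) * (p - q)"
        by simp
      then show ?thesis
        using z by (intro exI[of _ z]) auto
    qed auto
  qed
  define z where "z = (\<lambda>x. SOME z. min (u x) (v x) \<le> z \<and> z \<le> max (u x) (v x) \<and> ln (u x) - ln (v x) = (1 / z) * (u x - v x))"
  have z: "\<forall>\<^sub>F x in F. min (u x) (v x) \<le> z x \<and> z x \<le> max (u x) (v x) \<and> ln (u x) - ln (v x) = (1 / z x) * (u x - v x)"
    using pos
  proof eventually_elim
    case (elim x)
    then have "\<exists>z. min (u x) (v x) \<le> z \<and> z \<le> max (u x) (v x) \<and> ln (u x) - ln (v x) = (1 / z) * (u x - v x)"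
      by (intro mvt) auto
    then show ?case
      unfolding z_def by (rule someI_ex)
  qed
  have "(z \<longlongrightarrow> a) F"
  proof (rule tendsto_sandwich)
    show "((\<lambda>x. min (u x) (v x)) \<longlongrightarrow> a) F" "((\<lambda>x. max (u x) (v x)) \<longlongrightarrow> a) F"
      using tendsto_min[OF assms(1,2)] tendsto_max[OF assms(1,2)] by simp_all
  qed (use z in \<open>auto elim: eventually_mono\<close>)
  then have "((\<lambda>x. 1 / z x) \<longlongrightarrow> 1 / a) F"
    using \<open>a > 0\<close> by (intro tendsto_intros) auto
  then show ?thesis
    using z by (intro exI[of _ "\<lambda>x. 1 / z x"]) (auto elim: eventually_mono)
qed


section \<open>Frames as a function of the angle\<close>

context critical_norm
begin

lemma hex_frames_rotation_iff: "g ** hex_rotation \<in> hex_frames \<longleftrightarrow> g \<in> hex_frames"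
proof -
  have "det hex_rotation = 1"
    by (simp add: hex_rotation_def det_2)
  then have "det (g ** hex_rotation) = det g"
    by (simp add: det_mul)
  moreover have "hexagon (column 2 g) (column 2 g - column 1 g) \<longleftrightarrow> hexagon (column 1 g) (column 2 g)"
    by (auto simp: hexagon_def cross2_def algebra_simps)
  ultimately show ?thesis
    by (simp add: hex_frames_def column_mult_hex_rotation)
qed

text \<open>The matrix taking \<open>g\<close> to \<open>h\<close> from the left is upper triangular
  with diagonal \<open>1 / s\<close>, \<open>s\<close>; its trace is at least 2, so trace rigidity
  applies.\<close>

lemma hex_frames_row_inject:
  assumes g: "g \<in> hex_frames" and h: "h \<in> hex_frames" and row: "h$2 = s *\<^sub>R g$2" "s > 0"
  shows "h = g"
proof -
  have dg: "g$1$1 * g$2$2 - g$1$2 * g$2$1 = 1" and dh: "h$1$1 * h$2$2 - h$1$2 * h$2$1 = 1"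
    using g h by (auto simp: hex_frames_def det_2)
  have "g$1$1 * h$2$2 - g$1$2 * h$2$1 = s * (g$1$1 * g$2$2 - g$1$2 * g$2$1)"
    by (simp add: row algebra_simps)
  then have 1: "cross2 (column 1 g) (column 2 h) + cross2 (column 1 h) (column 2 g)
      = s + (h$1$1 * g$2$2 - h$1$2 * g$2$1)"
    using row dg by (simp add: cross2_def column_def algebra_simps)
  have "s * (h$1$1 * g$2$2 - h$1$2 * g$2$1) = 1"
    using dh by (simp add: row algebra_simps)
  then have 2: "h$1$1 * g$2$2 - h$1$2 * g$2$1 = 1 / s"
    using \<open>s > 0\<close> by (simp add: field_simps)
  have "0 \<le> (s - 1)\<^sup>2 / s"
    using \<open>s > 0\<close> by simp
  also have "\<dots> = s + 1 / s - 2"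
    using \<open>s > 0\<close> by (simp add: power2_eq_square field_simps)
  finally have "cross2 (column 1 h) (column 2 g) + cross2 (column 1 g) (column 2 h) \<ge> 2"
    using 1 2 by simp
  then have "column 1 h = column 1 g \<and> column 2 h = column 2 g"
    using g h by (intro hexagon_trace_rigidity) (auto simp: hex_frames_def det_eq_cross2)
  then show ?thesis
    by (auto intro: column_inject_2)
qed

definition frame_angle :: "real^2^2 \<Rightarrow> real \<Rightarrow> bool" where
  "frame_angle g t \<longleftrightarrow> g \<in> hex_frames \<and> (\<exists>s>0. g$2 = s *\<^sub>R sin_row t)"

text \<open>Taken on the line and not modulo \<open>2 * pi\<close>: a closed periodic set, to which
  extension on the line applies directly.\<close>

definition angles :: "real set" where
  "angles = {t. \<exists>g. frame_angle g t}"

definition frame_at :: "real \<Rightarrow> real^2^2" where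
  "frame_at t = (THE g. frame_angle g t)"

lemma frame_angle_unique: "frame_angle g t \<Longrightarrow> frame_angle h t \<Longrightarrow> h = g"
proof -
  assume "frame_angle g t" "frame_angle h t"
  then obtain r s where rs: "r > 0" "s > 0" "g$2 = r *\<^sub>R sin_row t" "h$2 = s *\<^sub>R sin_row t"
      "g \<in> hex_frames" "h \<in> hex_frames"
    by (auto simp: frame_angle_def)
  then have "h$2 = (s / r) *\<^sub>R g$2"
    by simp
  then show ?thesis
    using rs by (intro hex_frames_row_inject[of g h "s / r"]) auto
qed

lemma frame_at_eq: "frame_angle g t \<Longrightarrow> frame_at t = g"
  unfolding frame_at_def by (rule the_equality) (auto intro: frame_angle_unique)

lemma frame_at: "t \<in> angles \<Longrightarrow> frame_angle (frame_at t) t"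
  unfolding angles_def using frame_at_eq by auto

lemma frame_at_iwasawa:
  "t \<in> angles \<Longrightarrow> frame_at t = iwasawa t (height_coord (frame_at t)) (shear_coord (frame_at t))"
  using frame_at[of t] iwasawa_coords by (auto simp: frame_angle_def hex_frames_def)

lemma frame_angle_rotation: "frame_angle (g ** hex_rotation) (t + pi / 3) \<longleftrightarrow> frame_angle g t"
proof -
  have eq: "sin_row (t + pi / 3) = vector [sin_row t $ 2, sin_row t $ 2 - sin_row t $ 1]"
    unfolding sin_row_def
    by (rule vec2_eqI; simp only: vector_2 sin_add_pi3 cos_add_pi3; simp add: field_simps)
  have "(g ** hex_rotation)$2 = s *\<^sub>R sin_row (t + pi / 3) \<longleftrightarrow> g$2 = s *\<^sub>R sin_row t" for s
    unfolding eq row_mult_hex_rotation by (auto simp: vec_eq_iff forall_2 algebra_simps)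
  then show ?thesis
    by (simp add: frame_angle_def hex_frames_rotation_iff)
qed

lemma angles_periodic: "t + pi / 3 \<in> angles \<longleftrightarrow> t \<in> angles"
proof
  assume "t + pi / 3 \<in> angles"
  then obtain h where h: "frame_angle h (t + pi / 3)"
    by (auto simp: angles_def)
  let ?r = "vector [vector [1, 1], vector [-1, 0]] :: real^2^2"
  have "?r ** hex_rotation = mat 1"
    by (simp add: vec_eq_iff forall_2 matrix_matrix_mult_def sum_2 hex_rotation_def mat_def)
  then have "h = (h ** ?r) ** hex_rotation"
    by (simp add: matrix_mul_assoc[symmetric])
  then show "t \<in> angles"
    using h frame_angle_rotation by (metis (mono_tags, lifting) angles_def mem_Collect_eq)
next
  assume "t \<in> angles"
  then show "t + pi / 3 \<in> angles"
    using frame_angle_rotation by (auto simp: angles_def)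
qed

lemma frame_at_periodic: "t \<in> angles \<Longrightarrow> frame_at (t + pi / 3) = frame_at t ** hex_rotation"
  using frame_at frame_angle_rotation by (intro frame_at_eq) blast

text \<open>Since rows of frames do not vanish, the open condition \<open>s > 0\<close> can be
  replaced by a weak inequality, which makes the relation closed.\<close>

lemma frame_angle_iff_closed:
  "frame_angle g t \<longleftrightarrow> g \<in> hex_frames \<and> cross2 (g$2) (sin_row t) = 0 \<and> hex_form (g$2) (sin_row t) \<ge> 0"
proof -
  have "(\<exists>s>0. g$2 = s *\<^sub>R sin_row t) \<longleftrightarrow> cross2 (g$2) (sin_row t) = 0 \<and> hex_form (g$2) (sin_row t) \<ge> 0"
    if g: "g \<in> hex_frames"
  proof (safe)
    fix s assume "s > 0" "g$2 = s *\<^sub>R sin_row t"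
    then show "cross2 (g$2) (sin_row t) = 0" "hex_form (g$2) (sin_row t) \<ge> 0"
      by (simp_all add: cross2_scale_self hex_form_simps hex_form_sin_row)
  next
    assume c: "cross2 (g$2) (sin_row t) = 0" and p: "hex_form (g$2) (sin_row t) \<ge> 0"
    have nz: "cross2 (cos_row t) (sin_row t) \<noteq> 0"
      by (simp add: cross2_cos_sin_row)
    obtain b where b: "g$2 = b *\<^sub>R sin_row t"
      using cross2_expand[OF nz, of "g$2"] c by auto
    moreover have "b \<noteq> 0"
      using row_nonzero[of g] g b by (auto simp: hex_frames_def)
    moreover have "b \<ge> 0"
      using p by (simp add: b hex_form_simps hex_form_sin_row)
    ultimately show "\<exists>s>0. g$2 = s *\<^sub>R sin_row t"
      by (intro exI[of _ b]) auto
  qed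
  then show ?thesis
    by (auto simp: frame_angle_def)
qed

lemma closed_frame_angle: "closed {z. frame_angle (fst z) (snd z)}"
proof -
  have "{z. frame_angle (fst z) (snd z)} = (hex_frames \<times> UNIV) \<inter>
      ({z. cross2 (fst z $ 2) (sin_row (snd z)) = 0} \<inter> {z. 0 \<le> hex_form (fst z $ 2) (sin_row (snd z))})"
    by (auto simp: frame_angle_iff_closed)
  moreover have "closed \<dots>"
    by (intro closed_Int closed_Times closed_UNIV compact_imp_closed[OF compact_hex_frames]
        closed_Collect_eq closed_Collect_le continuous_intros)
  ultimately show ?thesis by simp
qed

lemma closed_angles: "closed angles"
proof -
  have "angles = {t. \<exists>g. g \<in> hex_frames \<and> (g, t) \<in> {z. frame_angle (fst z) (snd z)}}"
    by (auto simp: angles_def frame_angle_def)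
  then show ?thesis
    using closed_compact_projection[OF compact_hex_frames closed_frame_angle] by simp
qed

text \<open>The closed graph theorem with the compact set of frames as target; uniqueness of the
  frame at an angle identifies the graph with the closed relation.\<close>

lemma continuous_on_frame_at: "continuous_on angles frame_at"
proof (rule continuous_from_closed_graph[OF compact_hex_frames])
  have "(\<lambda>t. (t, frame_at t)) ` angles = prod.swap -` {z. frame_angle (fst z) (snd z)}" (is "?L = ?R")
  proof (intro equalityI subsetI)
    fix z assume "z \<in> ?R"
    then have "frame_angle (snd z) (fst z)"
      by simp
    then have "fst z \<in> angles" "z = (fst z, frame_at (fst z))"
      using frame_at_eq by (auto simp: angles_def prod_eq_iff)
    then show "z \<in> ?L"
      by blast
  qed (use frame_at in auto)
  moreover have "closed \<dots>"
    by (intro closed_vimage closed_frame_angle) (auto simp: prod.swap_def intro!: continuous_intros)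
  ultimately show "closed ((\<lambda>t. (t, frame_at t)) ` angles)"
    by simp
qed (use frame_at in \<open>auto simp: frame_angle_def\<close>)

text \<open>Ceva's relation makes the combination of the functionals at \<open>p\<close> and
  \<open>q\<close> that governs the motion of \<open>q - p\<close> a multiple of the functional at
  \<open>q - p\<close>. Hence \<open>q - p\<close> also moves along its support line, and the frame
  \<open>q\<close>, \<open>q - p\<close> has the same tangent line.\<close>

lemma tangent_frame_rotation:
  assumes g: "g \<in> hex_frames"
  shows "\<exists>c>0. tangent_frame (g ** hex_rotation) = c *\<^sub>R (tangent_frame g ** hex_rotation)"
proof -
  let ?p = "column 1 g" and ?q = "column 2 g"
  let ?f1 = "support ?p" and ?f2 = "support ?q" and ?f3 = "support (?q - ?p)"
  have hex: "hexagon ?p ?q"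
    using g by (simp add: hex_frames_def)
  have f3: "?f3 \<in> dual_ball" "?f3 \<bullet> (?q - ?p) = 1"
    using support[of "?q - ?p"] hex by (auto simp: hexagon_def)
  define \<alpha> where "\<alpha> = ?f1 \<bullet> ?q"
  define \<beta> where "\<beta> = ?f2 \<bullet> ?p"
  define \<gamma> where "\<gamma> = - (?f3 \<bullet> ?p)"
  note f = hex_frames_support[OF g]
  have \<alpha>: "0 < \<alpha>" "\<alpha> < 1" and \<gamma>: "0 < \<gamma>" "\<gamma> < 1"
    using f hexagon_support_strict3[OF hex f3] by (auto simp: \<alpha>_def \<gamma>_def)
  have ceva: "\<gamma> * \<alpha> * (1 - \<beta>) = \<beta> * (1 - \<gamma>) * (1 - \<alpha>)"
    using hexagon_support_relation[OF hex support(1) f(1) support(1) f(2) f3]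
    by (simp add: \<alpha>_def \<beta>_def \<gamma>_def)
  have f3p: "?f3 \<bullet> ?p = - \<gamma>" and f3q: "?f3 \<bullet> ?q = 1 - \<gamma>"
    using f3(2) by (auto simp: \<gamma>_def inner_simps)
  have lin: "(1 - \<gamma>) *\<^sub>R (\<alpha> *\<^sub>R ?f2 - \<beta> *\<^sub>R ?f1) = (\<alpha> * (1 - \<beta>)) *\<^sub>R ?f3"
  proof (rule inner_eq_on_basis[of ?p ?q])
    show "cross2 ?p ?q \<noteq> 0"
      using hex by (auto simp: hexagon_def)
    show "((1 - \<gamma>) *\<^sub>R (\<alpha> *\<^sub>R ?f2 - \<beta> *\<^sub>R ?f1)) \<bullet> ?p = ((\<alpha> * (1 - \<beta>)) *\<^sub>R ?f3) \<bullet> ?p"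
      unfolding inner_simps f3p f f(1) \<beta>_def[symmetric] using ceva by (simp add: algebra_simps)
    show "((1 - \<gamma>) *\<^sub>R (\<alpha> *\<^sub>R ?f2 - \<beta> *\<^sub>R ?f1)) \<bullet> ?q = ((\<alpha> * (1 - \<beta>)) *\<^sub>R ?f3) \<bullet> ?q"
      unfolding inner_simps f3q f(2) \<alpha>_def[symmetric] by (simp add: algebra_simps)
  qed
  have rot: "rot90 (a *\<^sub>R u) = a *\<^sub>R rot90 u" "rot90 (u - v) = rot90 u - rot90 v" for a u v
    by (auto simp: rot90_def vec_eq_iff forall_2)
  have lin': "(1 - \<gamma>) *\<^sub>R (\<alpha> *\<^sub>R rot90 ?f2 - \<beta> *\<^sub>R rot90 ?f1) = (\<alpha> * (1 - \<beta>)) *\<^sub>R rot90 ?f3"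
    using arg_cong[OF lin, of rot90] by (simp only: rot)
  \<comment> \<open>Read off from the first columns,
    \<open>(1 - \<gamma>) *\<^sub>R rot90 ?f2\<close> and
    \<open>\<alpha> *\<^sub>R rot90 ?f2\<close>.\<close>
  define c where "c = (1 - \<gamma>) / \<alpha>"
  have c: "c > 0" "c * \<alpha> = 1 - \<gamma>"
    using \<alpha> \<gamma> by (auto simp: c_def)
  have "column 1 (tangent_frame (g ** hex_rotation)) = (1 - \<gamma>) *\<^sub>R rot90 ?f2"
    using f3q by (simp add: tangent_frame_def column_mult_hex_rotation)
  also have "\<dots> = column 1 (c *\<^sub>R (tangent_frame g ** hex_rotation))"
    using c by (simp add: tangent_frame_def column_mult_hex_rotation column_scaleR \<alpha>_def[symmetric])
  finally have 1: "column 1 (tangent_frame (g ** hex_rotation)) = column 1 (c *\<^sub>R (tangent_frame g ** hex_rotation))" .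
  have "column 2 (tangent_frame (g ** hex_rotation)) = (1 - \<beta>) *\<^sub>R rot90 ?f3"
    using f(2) by (simp add: tangent_frame_def column_mult_hex_rotation inner_simps \<beta>_def)
  also have "\<dots> = (1 / \<alpha>) *\<^sub>R ((\<alpha> * (1 - \<beta>)) *\<^sub>R rot90 ?f3)"
    using \<alpha> by simp
  also have "\<dots> = c *\<^sub>R (\<alpha> *\<^sub>R rot90 ?f2 - \<beta> *\<^sub>R rot90 ?f1)"
    unfolding lin'[symmetric] by (simp add: c_def)
  also have "\<dots> = column 2 (c *\<^sub>R (tangent_frame g ** hex_rotation))"
    by (simp add: tangent_frame_def column_mult_hex_rotation column_scaleR \<alpha>_def \<beta>_def)
  finally show ?thesis
    using 1 c(1) by (intro exI[of _ c]) (simp add: column_inject_2)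
qed

lemma continuous_on_tangent_frame: "continuous_on hex_frames tangent_frame"
proof -
  have c1: "continuous_on hex_frames (\<lambda>g. support (column 1 g))"
    by (rule continuous_on_support) (auto simp: hex_frames_def intro!: continuous_intros)
  have c2: "continuous_on hex_frames (\<lambda>g. support (column 2 g))"
    by (rule continuous_on_support) (auto simp: hex_frames_def intro!: continuous_intros dest: hexagon_rotate)
  show ?thesis
    using c1 c2 unfolding continuous_on_def tangent_frame_def
    by (auto intro!: tendsto_intros)
qed

text \<open>The derivative of the angle along \<open>tangent_frame g\<close>. The two slopes below
  are the derivatives of height and shear in that direction divided by it, that is, derivatives with
  respect to the angle.\<close>

definition angle_speed :: "real^2^2 \<Rightarrow> real" where
  "angle_speed g = exp (2 * height_coord g) * cross2 (tangent_frame g $ 2) (g$2)"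

definition height_slope :: "real^2^2 \<Rightarrow> real" where
  "height_slope g = - (hex_form (tangent_frame g $ 2) (g$2) / hex_form (g$2) (g$2)) / angle_speed g"

definition shear_slope :: "real^2^2 \<Rightarrow> real" where
  "shear_slope g = (hex_form (tangent_frame g $ 1) (g$2) + hex_form (g$1) (tangent_frame g $ 2)
     - shear_coord g * (2 * hex_form (tangent_frame g $ 2) (g$2))) / hex_form (g$2) (g$2) / angle_speed g"

lemma height_coord_rotation: "height_coord (g ** hex_rotation) = height_coord g"
  and shear_coord_rotation: "shear_coord (g ** hex_rotation) = shear_coord g"
  by (simp_all add: height_coord_def shear_coord_def hex_form_rotation)

text \<open>The slopes are homogeneous of degree 0 in the tangent vector, so its rescaling under
  rotation cancels. This gives the interpolation data the period \<open>pi / 3\<close>.\<close>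

lemma slope_rotation:
  assumes "g \<in> hex_frames"
  shows "height_slope (g ** hex_rotation) = height_slope g" "shear_slope (g ** hex_rotation) = shear_slope g"
proof -
  obtain c where c: "c > 0" "tangent_frame (g ** hex_rotation) = c *\<^sub>R (tangent_frame g ** hex_rotation)"
    using tangent_frame_rotation[OF assms] by blast
  let ?w = "tangent_frame g"
  have s: "angle_speed (g ** hex_rotation) = c * angle_speed g"
    by (simp add: angle_speed_def c height_coord_rotation cross2_scale_left cross2_rotation)
  have n: "hex_form (tangent_frame (g ** hex_rotation) $ i) ((g ** hex_rotation)$j) = c * hex_form (?w$i) (g$j)"
    "hex_form ((g ** hex_rotation)$j) (tangent_frame (g ** hex_rotation) $ i) = c * hex_form (g$j) (?w$i)" for i j
    by (simp_all add: c hex_form_simps hex_form_rotation)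
  show "height_slope (g ** hex_rotation) = height_slope g"
    unfolding height_slope_def s n hex_form_rotation using c(1) by (simp add: field_simps)
  have "(c * a + c * b - z * (2 * (c * d))) / n / (c * v) = (a + b - z * (2 * d)) / n / v" for a b z d n v
  proof -
    have "c * a + c * b - z * (2 * (c * d)) = c * (a + b - z * (2 * d))"
      by (simp add: algebra_simps)
    then show ?thesis
      using c(1) by simp
  qed
  then show "shear_slope (g ** hex_rotation) = shear_slope g"
    unfolding shear_slope_def s n hex_form_rotation shear_coord_rotation by simp
qed

lemma angle_speed_nonzero: "g \<in> hex_frames \<Longrightarrow> angle_speed g \<noteq> 0"
  by (simp add: angle_speed_def tangent_frame_transversal)

lemma hex_frames_form_pos: "g \<in> hex_frames \<Longrightarrow> hex_form (g$2) (g$2) > 0"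
  by (simp add: hex_frames_def hex_form_pos row_nonzero)

lemma continuous_on_coords:
  "continuous_on hex_frames height_coord" "continuous_on hex_frames shear_coord"
  "continuous_on hex_frames height_slope" "continuous_on hex_frames shear_slope"
proof -
  have t: "continuous_on hex_frames (\<lambda>g. tangent_frame g $ i)" for i
    by (intro continuous_intros continuous_on_tangent_frame)
  have r: "continuous_on hex_frames (\<lambda>g :: real^2^2. g $ i)" for i
    by (intro continuous_intros)
  have n: "\<forall>g\<in>hex_frames. hex_form (g$2) (g$2) \<noteq> 0"
    using hex_frames_form_pos by force
  show h: "continuous_on hex_frames height_coord"
    unfolding height_coord_def[abs_def]
    by (intro continuous_intros r) (use hex_frames_form_pos in force)+
  show s: "continuous_on hex_frames shear_coord"
    unfolding shear_coord_def[abs_def] using n by (intro continuous_intros r) auto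
  have a: "continuous_on hex_frames angle_speed"
    unfolding angle_speed_def[abs_def] by (intro continuous_intros r t h)
  show "continuous_on hex_frames height_slope"
    unfolding height_slope_def[abs_def] using n angle_speed_nonzero by (intro continuous_intros r t a) auto
  show "continuous_on hex_frames shear_slope"
    unfolding shear_slope_def[abs_def] using n angle_speed_nonzero by (intro continuous_intros r t a s) auto
qed

end

section \<open>The curve of critical lattices\<close>

text \<open>The last limit replaces \<open>sin (s - t)\<close>, which is what the second rows of two
  frames determine, by \<open>s - t\<close>.\<close>

lemma secant_filter_basics:
  shows "\<forall>\<^sub>F z in secant_filter C x. fst z \<in> C \<and> snd z \<in> C \<and> fst z \<noteq> snd z"
    and "(fst \<longlongrightarrow> x) (secant_filter C x)" "(snd \<longlongrightarrow> x) (secant_filter C x)"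
    and "((\<lambda>z. sin (fst z - snd z) / (fst z - snd z)) \<longlongrightarrow> 1) (secant_filter C x)"
proof -
  show ev: "\<forall>\<^sub>F z in secant_filter C x. fst z \<in> C \<and> snd z \<in> C \<and> fst z \<noteq> snd z"
    unfolding eventually_secant_filter by (intro exI[of _ 1]) simp
  have le: "secant_filter C x \<le> nhds (x, x)"
    by (simp add: secant_filter_def)
  have id: "((\<lambda>z. z) \<longlongrightarrow> (x, x)) (secant_filter C x)"
    using le by (simp add: filterlim_def)
  show f: "(fst \<longlongrightarrow> x) (secant_filter C x)"
    using tendsto_fst[OF id] by simp
  show s: "(snd \<longlongrightarrow> x) (secant_filter C x)"
    using tendsto_snd[OF id] by simp
  have "filterlim (\<lambda>z. fst z - snd z) (at 0) (secant_filter C x)"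
  proof (rule filterlim_atI)
    show "((\<lambda>z. fst z - snd z) \<longlongrightarrow> 0) (secant_filter C x)"
      using tendsto_diff[OF f s] by simp
    show "\<forall>\<^sub>F z in secant_filter C x. fst z - snd z \<noteq> 0"
      using ev by eventually_elim auto
  qed
  moreover have "((\<lambda>h. sin h / h) \<longlongrightarrow> (1::real)) (at 0)"
    using DERIV_sin[of "0::real"] by (simp add: has_field_derivative_iff)
  ultimately show "((\<lambda>z. sin (fst z - snd z) / (fst z - snd z)) \<longlongrightarrow> 1) (secant_filter C x)"
    by (rule filterlim_compose[rotated])
qed

context critical_norm
begin

lemma frame_at_hex: "t \<in> angles \<Longrightarrow> frame_at t \<in> hex_frames"
  using frame_at by (simp add: frame_angle_def)

lemma frame_at_cross2:
  assumes "s \<in> angles" "t \<in> angles"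
  shows "cross2 (frame_at s $ 2) (frame_at t $ 2)
    = exp (- height_coord (frame_at s)) * exp (- height_coord (frame_at t)) * sin (s - t)"
proof -
  have "cross2 (iwasawa s y z $ 2) (iwasawa t y' z' $ 2) = exp (- y) * exp (- y') * sin (s - t)" for y z y' z'
  proof -
    have "cross2 (iwasawa s y z $ 2) (iwasawa t y' z' $ 2) =
       hex_scale * hex_scale * exp (- y) * exp (- y') * cross2 (sin_row s) (sin_row t)"
      by (simp add: cross2_scale_left cross2_scale_right mult_ac)
    then show ?thesis
      by (simp add: cross2_sin_row hex_scale(2))
  qed
  then show ?thesis
    using frame_at_iwasawa assms by metis
qed

text \<open>The coordinate differences and \<open>sin (s - t)\<close> are multiples of one and the
  same \<open>\<kappa>\<close>, with cofactors that converge; the quotients converge to the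
  quotients of the limits, and transversality keeps the denominator away from 0.\<close>

lemma secant_slopes:
  assumes x: "x \<in> angles"
  shows "((\<lambda>(s, t). (height_coord (frame_at s) - height_coord (frame_at t)) / (s - t)) \<longlongrightarrow> height_slope (frame_at x))
      (secant_filter angles x)"
    and "((\<lambda>(s, t). (shear_coord (frame_at s) - shear_coord (frame_at t)) / (s - t)) \<longlongrightarrow> shear_slope (frame_at x))
      (secant_filter angles x)"
proof -
  let ?F = "secant_filter angles x" and ?x = "frame_at x"
  define H where "H = (\<lambda>z :: real \<times> real. frame_at (fst z))"
  define G where "G = (\<lambda>z :: real \<times> real. frame_at (snd z))"
  note F = secant_filter_basics[where C = angles and x = x]
  have x': "?x \<in> hex_frames"
    by (rule frame_at_hex[OF x])
  have evH: "\<forall>\<^sub>F z in ?F. H z \<in> hex_frames" and evG: "\<forall>\<^sub>F z in ?F. G z \<in> hex_frames"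
    using F(1) by (eventually_elim, simp add: H_def G_def frame_at_hex)+
  have limH: "(H \<longlongrightarrow> ?x) ?F"
    unfolding H_def using F(1)
    by (intro continuous_on_tendsto_compose[OF continuous_on_frame_at F(2) x]) (auto elim: eventually_mono)
  have limG: "(G \<longlongrightarrow> ?x) ?F"
    unfolding G_def using F(1)
    by (intro continuous_on_tendsto_compose[OF continuous_on_frame_at F(3) x]) (auto elim: eventually_mono)
  obtain \<kappa> \<omega> where \<omega>: "(\<omega> \<longlongrightarrow> tangent_frame ?x) ?F" and HG: "\<forall>\<^sub>F z in ?F. H z - G z = \<kappa> z *\<^sub>R \<omega> z"
    using secant_direction[OF limG evG limH evH x'] by blast
  have coord: "((\<lambda>z. f (H z)) \<longlongrightarrow> f ?x) ?F" "((\<lambda>z. f (G z)) \<longlongrightarrow> f ?x) ?F"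
    if "continuous_on hex_frames f" for f :: "real^2^2 \<Rightarrow> real"
    using continuous_on_tendsto_compose[OF that limH x' evH] continuous_on_tendsto_compose[OF that limG x' evG]
    by auto
  note height = coord[OF continuous_on_coords(1)] and shear = coord[OF continuous_on_coords(2)]
  define \<tau> where "\<tau> = (\<lambda>z. exp (height_coord (H z)) * exp (height_coord (G z)) * cross2 (\<omega> z $ 2) (G z $ 2))"
  have lim\<tau>: "(\<tau> \<longlongrightarrow> angle_speed ?x) ?F"
  proof -
    have "(\<tau> \<longlongrightarrow> exp (height_coord ?x) * exp (height_coord ?x) * cross2 (tangent_frame ?x $ 2) (?x $ 2)) ?F"
      unfolding \<tau>_def by (intro tendsto_intros height \<omega> limG)
    then show ?thesis
      by (simp only: angle_speed_def mult_2 exp_add)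
  qed
  have \<tau>nz: "\<forall>\<^sub>F z in ?F. \<tau> z \<noteq> 0"
    using lim\<tau> angle_speed_nonzero[OF x'] by (rule tendsto_imp_eventually_ne)
  have sin_eq: "\<forall>\<^sub>F z in ?F. sin (fst z - snd z) = \<kappa> z * \<tau> z"
    using HG F(1)
  proof eventually_elim
    case (elim z)
    have "H z $ 2 = G z $ 2 + \<kappa> z *\<^sub>R \<omega> z $ 2"
      using arg_cong[OF elim(1), of "\<lambda>g. g $ 2"] by (simp add: algebra_simps)
    then have "cross2 (H z $ 2) (G z $ 2) = \<kappa> z * cross2 (\<omega> z $ 2) (G z $ 2)"
      by (simp add: cross2_def algebra_simps)
    moreover have "cross2 (H z $ 2) (G z $ 2) = exp (- height_coord (H z)) * exp (- height_coord (G z)) * sin (fst z - snd z)"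
      unfolding H_def G_def using elim by (intro frame_at_cross2) auto
    ultimately have "exp (- height_coord (H z)) * exp (- height_coord (G z)) * sin (fst z - snd z) = \<kappa> z * cross2 (\<omega> z $ 2) (G z $ 2)"
      by simp
    then show ?case
      unfolding \<tau>_def exp_minus by (simp add: field_simps)
  qed
  have quotient: "((\<lambda>(s, t). (f (frame_at s) - f (frame_at t)) / (s - t)) \<longlongrightarrow> e / angle_speed ?x) ?F"
    if \<eta>: "(\<eta> \<longlongrightarrow> e) ?F" and f: "\<forall>\<^sub>F z in ?F. f (H z) - f (G z) = \<kappa> z * \<eta> z" for f :: "real^2^2 \<Rightarrow> real" and \<eta> e
  proof -
    have "((\<lambda>z. \<eta> z / \<tau> z * (sin (fst z - snd z) / (fst z - snd z))) \<longlongrightarrow> e / angle_speed ?x * 1) ?F"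
      by (intro tendsto_intros \<eta> lim\<tau> F(4) angle_speed_nonzero[OF x'])
    then have "((\<lambda>z. \<eta> z / \<tau> z * (sin (fst z - snd z) / (fst z - snd z))) \<longlongrightarrow> e / angle_speed ?x) ?F"
      by simp
    \<comment> \<open>The factor \<open>\<kappa>\<close> is never divided by: multiplying
      \<open>\<eta> z / \<tau> z\<close> by the sine turns it into
      \<open>\<kappa> z * \<eta> z\<close>.\<close>
    moreover have "\<forall>\<^sub>F z in ?F. \<eta> z / \<tau> z * (sin (fst z - snd z) / (fst z - snd z)) = (case z of (s, t) \<Rightarrow> (f (frame_at s) - f (frame_at t)) / (s - t))"
      using f sin_eq \<tau>nz by eventually_elim (simp add: case_prod_beta H_def G_def)
    ultimately show ?thesis
      by (rule Lim_transform_eventually)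
  qed
  define n where "n = (\<lambda>g :: real^2^2. hex_form (g$2) (g$2))"
  have npos: "n g > 0" if "g \<in> hex_frames" for g
    unfolding n_def using hex_frames_form_pos[OF that] .
  have limnH: "((\<lambda>z. n (H z)) \<longlongrightarrow> n ?x) ?F" and limnG: "((\<lambda>z. n (G z)) \<longlongrightarrow> n ?x) ?F"
    unfolding n_def by (intro tendsto_intros limH limG)+
  \<comment> \<open>A difference of squares for the quadratic form: the difference of its values is
    its pairing of \<open>H - G\<close> with \<open>H + G\<close>.\<close>
  define \<nu> where "\<nu> = (\<lambda>z. hex_form (\<omega> z $ 2) (H z $ 2) + hex_form (\<omega> z $ 2) (G z $ 2))"
  have lim\<nu>: "(\<nu> \<longlongrightarrow> 2 * hex_form (tangent_frame ?x $ 2) (?x $ 2)) ?F"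
  proof -
    have "(\<nu> \<longlongrightarrow> hex_form (tangent_frame ?x $ 2) (?x $ 2) + hex_form (tangent_frame ?x $ 2) (?x $ 2)) ?F"
      unfolding \<nu>_def by (intro tendsto_intros limH limG \<omega>)
    then show ?thesis by simp
  qed
  have comm: "hex_form v w = hex_form w v" for v w
    by (simp add: hex_form_def algebra_simps)
  have n_eq: "\<forall>\<^sub>F z in ?F. n (H z) - n (G z) = \<kappa> z * \<nu> z"
    using HG
  proof eventually_elim
    case (elim z)
    have "H z $ 2 = G z $ 2 + \<kappa> z *\<^sub>R \<omega> z $ 2"
      using arg_cong[OF elim, of "\<lambda>g. g $ 2"] by (simp add: algebra_simps)
    then show ?case
      unfolding n_def \<nu>_def by (simp add: hex_form_simps comm[of "G z $ 2" "\<omega> z $ 2"] algebra_simps)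
  qed
  obtain l where l: "(l \<longlongrightarrow> 1 / n ?x) ?F" "\<forall>\<^sub>F z in ?F. ln (n (H z)) - ln (n (G z)) = l z * (n (H z) - n (G z))"
    using ln_secant[OF limnH limnG npos[OF x']] by blast
  have "((\<lambda>(s, t). (height_coord (frame_at s) - height_coord (frame_at t)) / (s - t)) \<longlongrightarrow>
      - (1 / n ?x * (2 * hex_form (tangent_frame ?x $ 2) (?x $ 2)) / 2) / angle_speed ?x) ?F"
  proof (rule quotient)
    show "((\<lambda>z. - (l z * \<nu> z / 2)) \<longlongrightarrow> - (1 / n ?x * (2 * hex_form (tangent_frame ?x $ 2) (?x $ 2)) / 2)) ?F"
      by (intro tendsto_intros l lim\<nu>) simp
    show "\<forall>\<^sub>F z in ?F. height_coord (H z) - height_coord (G z) = \<kappa> z * (- (l z * \<nu> z / 2))"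
      using l(2) n_eq evH evG
    proof eventually_elim
      case (elim z)
      have "height_coord g = - ((ln (2 / sqrt 3) + ln (n g)) / 2)" if "n g > 0" for g
        using that unfolding height_coord_def n_def by (subst ln_mult) auto
      then have "height_coord (H z) - height_coord (G z) = - (ln (n (H z)) - ln (n (G z))) / 2"
        using npos[OF elim(3)] npos[OF elim(4)] by (simp add: diff_divide_distrib add_divide_distrib)
      then show ?case
        using elim by simp
    qed
  qed
  then show "((\<lambda>(s, t). (height_coord (frame_at s) - height_coord (frame_at t)) / (s - t)) \<longlongrightarrow> height_slope ?x) ?F"
    by (simp add: height_slope_def n_def)
  show "((\<lambda>(s, t). (shear_coord (frame_at s) - shear_coord (frame_at t)) / (s - t)) \<longlongrightarrow> shear_slope ?x) ?F"
    unfolding shear_slope_def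
  proof (rule quotient)
    show "((\<lambda>z. (hex_form (\<omega> z $ 1) (H z $ 2) + hex_form (G z $ 1) (\<omega> z $ 2) - shear_coord (G z) * \<nu> z) / n (H z)) \<longlongrightarrow>
      (hex_form (tangent_frame ?x $ 1) (?x $ 2) + hex_form (?x $ 1) (tangent_frame ?x $ 2) -
       shear_coord ?x * (2 * hex_form (tangent_frame ?x $ 2) (?x $ 2))) / hex_form (?x $ 2) (?x $ 2)) ?F"
      using npos[OF x'] unfolding n_def
      by (intro tendsto_intros shear \<omega> limH limG lim\<nu>) auto
    show "\<forall>\<^sub>F z in ?F. shear_coord (H z) - shear_coord (G z) =
      \<kappa> z * ((hex_form (\<omega> z $ 1) (H z $ 2) + hex_form (G z $ 1) (\<omega> z $ 2) - shear_coord (G z) * \<nu> z) / n (H z))"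
      using HG n_eq evH evG
    proof eventually_elim
      case (elim z)
      have r: "H z $ i = G z $ i + \<kappa> z *\<^sub>R \<omega> z $ i" for i
        using arg_cong[OF elim(1), of "\<lambda>g. g $ i"] by (simp add: algebra_simps)
      have pos: "n (H z) > 0" "n (G z) > 0"
        using npos elim by auto
      have form: "hex_form (g $ 1) (g $ 2) = shear_coord g * n g" if "n g > 0" for g
        using that by (simp add: shear_coord_def n_def)
      have "hex_form (H z $ 1) (H z $ 2) - hex_form (G z $ 1) (G z $ 2)
          = \<kappa> z * (hex_form (\<omega> z $ 1) (H z $ 2) + hex_form (G z $ 1) (\<omega> z $ 2))"
        unfolding r by (simp add: hex_form_simps algebra_simps)
      then have "shear_coord (H z) * n (H z) - shear_coord (G z) * n (G z)
          = \<kappa> z * (hex_form (\<omega> z $ 1) (H z $ 2) + hex_form (G z $ 1) (\<omega> z $ 2))"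
        using form pos by simp
      \<comment> \<open>The product rule for finite differences, applied to the shear times the form
        of the second row.\<close>
      then have "(shear_coord (H z) - shear_coord (G z)) * n (H z)
          = \<kappa> z * (hex_form (\<omega> z $ 1) (H z $ 2) + hex_form (G z $ 1) (\<omega> z $ 2)) - shear_coord (G z) * (n (H z) - n (G z))"
        by (simp add: algebra_simps)
      also have "\<dots> = \<kappa> z * (hex_form (\<omega> z $ 1) (H z $ 2) + hex_form (G z $ 1) (\<omega> z $ 2) - shear_coord (G z) * \<nu> z)"
        unfolding elim(2) by (simp add: algebra_simps)
      finally show ?case
        using pos by (simp add: field_simps)
    qed
  qed
qed

lemma angles_unbounded:
  assumes "angles \<noteq> {}"
  shows "\<exists>c\<in>angles. c \<le> t" "\<exists>c\<in>angles. t \<le> c"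
proof -
  obtain a where a: "a \<in> angles"
    using assms by blast
  have up: "a + real n * (pi / 3) \<in> angles" for n
  proof (induction n)
    case (Suc n)
    moreover have "a + real (Suc n) * (pi / 3) = a + real n * (pi / 3) + pi / 3"
      by (simp add: field_simps)
    ultimately show ?case
      using angles_periodic by metis
  qed (use a in simp)
  have down: "a - real n * (pi / 3) \<in> angles" for n
  proof (induction n)
    case (Suc n)
    moreover have "a - real n * (pi / 3) = a - real (Suc n) * (pi / 3) + pi / 3"
      by (simp add: field_simps)
    ultimately show ?case
      using angles_periodic by metis
  qed (use a in simp)
  obtain n where "\<bar>t - a\<bar> < real n * (pi / 3)"
    using ex_less_of_nat_mult[of "pi / 3" "\<bar>t - a\<bar>"] by auto
  then have "a - real n * (pi / 3) \<le> t" "t \<le> a + real n * (pi / 3)"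
    by linarith+
  then show "\<exists>c\<in>angles. c \<le> t" "\<exists>c\<in>angles. t \<le> c"
    using up[of n] down[of n] by blast+
qed

lemma coordinate_extension:
  assumes "angles \<noteq> {}"
  shows "\<exists>y y' z z'. (\<forall>t. (y has_real_derivative y' t) (at t)) \<and> continuous_on UNIV y' \<and>
    (\<forall>t. (z has_real_derivative z' t) (at t)) \<and> continuous_on UNIV z' \<and>
    (\<forall>t. y (t + pi / 3) = y t) \<and> (\<forall>t. z (t + pi / 3) = z t) \<and>
    (\<forall>t\<in>angles. frame_at t = iwasawa t (y t) (z t))"
proof -
  let ?y = "\<lambda>t. height_coord (frame_at t)" and ?y' = "\<lambda>t. height_slope (frame_at t)"
  let ?z = "\<lambda>t. shear_coord (frame_at t)" and ?z' = "\<lambda>t. shear_slope (frame_at t)"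
  have cont: "continuous_on angles (\<lambda>t. f (frame_at t))" if "continuous_on hex_frames f" for f :: "real^2^2 \<Rightarrow> real"
    using that continuous_on_frame_at frame_at_hex by (auto intro: continuous_on_compose2)
  interpret Y: whitney_data angles ?y ?y'
    by unfold_locales (simp_all add: closed_angles angles_unbounded[OF assms] secant_slopes cont continuous_on_coords)
  interpret Z: whitney_data angles ?z ?z'
    by unfold_locales (simp_all add: closed_angles angles_unbounded[OF assms] secant_slopes cont continuous_on_coords)
  have per: "?y (t + pi / 3) = ?y t" "?y' (t + pi / 3) = ?y' t" "?z (t + pi / 3) = ?z t" "?z' (t + pi / 3) = ?z' t"
    if "t \<in> angles" for t
    using that frame_at_hex[OF that]
    by (simp_all add: frame_at_periodic height_coord_rotation shear_coord_rotation slope_rotation)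
  have "frame_at t = iwasawa t (Y.ext t) (Z.ext t)" if "t \<in> angles" for t
    using frame_at_iwasawa[OF that] Y.ext_on_C[OF that] Z.ext_on_C[OF that] by simp
  then show ?thesis
    using Y.ext_derivative Y.continuous_ext' Z.ext_derivative Z.continuous_ext'
      Y.ext_periodic[OF angles_periodic per(1,2)] Z.ext_periodic[OF angles_periodic per(3,4)]
    by blast
qed

end

section \<open>Charts\<close>

text \<open>The derivative of \<open>iwasawa\<close> at \<open>(t, y, z)\<close> in the direction \<open>(a, b, c)\<close>.\<close>

definition iwasawa_deriv :: "real \<Rightarrow> real \<Rightarrow> real \<Rightarrow> real \<Rightarrow> real \<Rightarrow> real \<Rightarrow> real^2^2" where
  "iwasawa_deriv t y z a b c = vector
     [(hex_scale * exp y) *\<^sub>R (b *\<^sub>R cos_row t - a *\<^sub>R sin_row t)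
       + (c * (hex_scale * exp (- y))) *\<^sub>R sin_row t
       + (z * (hex_scale * exp (- y))) *\<^sub>R (a *\<^sub>R cos_row t - b *\<^sub>R sin_row t),
      (hex_scale * exp (- y)) *\<^sub>R (a *\<^sub>R cos_row t - b *\<^sub>R sin_row t)]"

lemma vector_rows_eq: "(vector [v, w] :: real^2^2) = (\<chi> i. if i = 1 then v else w)"
  by (rule vec2_eqI) simp_all

lemma bounded_linear_rows: "bounded_linear (\<lambda>p. vector [fst p, snd p] :: real^2^2)"
  unfolding linear_conv_bounded_linear[symmetric] vector_rows_eq
  by (rule linearI) (simp_all add: vec_eq_iff)

lemma sin_row_eq: "sin_row t = sin t *\<^sub>R vector [1, 1 / 2] + cos t *\<^sub>R vector [0, sqrt 3 / 2]"
  and cos_row_eq: "cos_row t = cos t *\<^sub>R vector [1, 1 / 2] - sin t *\<^sub>R vector [0, sqrt 3 / 2]"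
  by (rule vec2_eqI; simp add: sin_row_def cos_row_def sin_add_pi3 cos_add_pi3)+

lemma has_derivative_sin_row:
  assumes "(T has_derivative T') (at x within S)"
  shows "((\<lambda>x. sin_row (T x)) has_derivative (\<lambda>h. T' h *\<^sub>R cos_row (T x))) (at x within S)"
  unfolding sin_row_eq cos_row_eq
  by (rule derivative_eq_intros assms refl | simp)+ (simp add: algebra_simps)

lemma has_derivative_cos_row:
  assumes "(T has_derivative T') (at x within S)"
  shows "((\<lambda>x. cos_row (T x)) has_derivative (\<lambda>h. - (T' h *\<^sub>R sin_row (T x)))) (at x within S)"
  unfolding sin_row_eq cos_row_eq
  by (rule derivative_eq_intros assms refl | simp)+ (simp add: algebra_simps)

lemma has_derivative_iwasawa:
  assumes T: "(T has_derivative T') (at x within S)" and Y: "(Y has_derivative Y') (at x within S)"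
    and Z: "(Z has_derivative Z') (at x within S)"
  shows "((\<lambda>x. iwasawa (T x) (Y x) (Z x)) has_derivative
     (\<lambda>h. iwasawa_deriv (T x) (Y x) (Z x) (T' h) (Y' h) (Z' h))) (at x within S)"
proof -
  let ?k = hex_scale
  have e: "((\<lambda>x. ?k * exp (Y x)) has_derivative (\<lambda>h. Y' h * (?k * exp (Y x)))) (at x within S)"
    by (rule derivative_eq_intros Y refl | simp add: mult_ac)+
  have e': "((\<lambda>x. ?k * exp (- Y x)) has_derivative (\<lambda>h. - (Y' h * (?k * exp (- Y x))))) (at x within S)"
    by (rule derivative_eq_intros Y refl | simp add: mult_ac)+
  have r2: "((\<lambda>x. (?k * exp (- Y x)) *\<^sub>R sin_row (T x)) has_derivative
      (\<lambda>h. (?k * exp (- Y x)) *\<^sub>R (T' h *\<^sub>R cos_row (T x) - Y' h *\<^sub>R sin_row (T x)))) (at x within S)"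
    by (rule has_derivative_eq_rhs[OF has_derivative_scaleR[OF e' has_derivative_sin_row[OF T]]])
      (simp add: algebra_simps)
  have r1: "((\<lambda>x. (?k * exp (Y x)) *\<^sub>R cos_row (T x) + (Z x * (?k * exp (- Y x))) *\<^sub>R sin_row (T x)) has_derivative
      (\<lambda>h. (?k * exp (Y x)) *\<^sub>R (Y' h *\<^sub>R cos_row (T x) - T' h *\<^sub>R sin_row (T x))
       + (Z' h * (?k * exp (- Y x))) *\<^sub>R sin_row (T x)
       + (Z x * (?k * exp (- Y x))) *\<^sub>R (T' h *\<^sub>R cos_row (T x) - Y' h *\<^sub>R sin_row (T x)))) (at x within S)"
    by (rule has_derivative_eq_rhs[OF has_derivative_add[OF
          has_derivative_scaleR[OF e has_derivative_cos_row[OF T]]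
          has_derivative_scaleR[OF has_derivative_mult[OF Z e'] has_derivative_sin_row[OF T]]]])
      (simp add: algebra_simps)
  show ?thesis
    using bounded_linear.has_derivative[OF bounded_linear_rows has_derivative_Pair[OF r1 r2]]
    unfolding iwasawa_def iwasawa_deriv_def by simp
qed

lemma iwasawa_deriv_eq_0:
  assumes "iwasawa_deriv t y z a b c = 0"
  shows "a = 0 \<and> b = 0 \<and> c = 0"
proof -
  have k: "hex_scale * exp u \<noteq> 0" for u
    using hex_scale(1) by simp
  have indep: "a = 0 \<and> b = 0" if "a *\<^sub>R cos_row t - b *\<^sub>R sin_row t = 0" for a b
  proof -
    have "cross2 (a *\<^sub>R cos_row t - b *\<^sub>R sin_row t) (sin_row t) = a * cross2 (cos_row t) (sin_row t)"
      by (simp add: cross2_def algebra_simps)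
    moreover have "cross2 (cos_row t) (a *\<^sub>R cos_row t - b *\<^sub>R sin_row t) = - b * cross2 (cos_row t) (sin_row t)"
      by (simp add: cross2_def algebra_simps)
    ultimately show ?thesis
      using that by (simp add: cross2_cos_sin_row) (simp add: cross2_def)
  qed
  have "iwasawa_deriv t y z a b c $ 2 = 0"
    using assms by simp
  then have "a *\<^sub>R cos_row t - b *\<^sub>R sin_row t = 0"
    using k[of "- y"] by (simp add: iwasawa_deriv_def)
  then have ab: "a = 0 \<and> b = 0"
    by (rule indep)
  moreover have "iwasawa_deriv t y z a b c $ 1 = 0"
    using assms by simp
  then have "c *\<^sub>R sin_row t = 0"
    using ab k by (simp add: iwasawa_deriv_def)
  then have "c = 0"
    using indep[of 0 c] by simp
  ultimately show ?thesis by simp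
qed

section \<open>Uniqueness of the Iwasawa coordinates\<close>

lemma coords_iwasawa: "height_coord (iwasawa t y z) = y" "shear_coord (iwasawa t y z) = z"
proof -
  let ?g = "iwasawa t y z" and ?e = "hex_scale * exp (- y)"
  have n: "hex_form (?g$2) (?g$2) = ?e * ?e * (3 / 4)"
    by (simp add: hex_form_simps hex_form_sin_row)
  have "2 / sqrt 3 * (?e * ?e * (3 / 4)) = (hex_scale * hex_scale) * (sqrt 3 / 2) * (exp (- y) * exp (- y))"
    by (simp add: field_simps)
  also have "\<dots> = exp (- y) * exp (- y)"
    by (simp add: hex_scale)
  also have "\<dots> = exp (- 2 * y)"
    by (simp add: exp_add[symmetric])
  finally show "height_coord ?g = y"
    unfolding height_coord_def n by simp
  have "hex_form (?g$1) (?g$2) = z * (?e * ?e * (3 / 4))"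
    by (simp add: hex_form_simps hex_form_sin_row hex_form_cos_sin_row)
  moreover have "?e * ?e * (3 / 4) \<noteq> 0"
    using hex_scale(1) by simp
  ultimately show "shear_coord ?g = z"
    unfolding shear_coord_def n by simp
qed

lemma sin_row_inject: "sin_row s = sin_row t \<Longrightarrow> \<exists>n::int. s = t + 2 * pi * n"
proof -
  assume "sin_row s = sin_row t"
  then have "sin s = sin t" "sin (s + pi / 3) = sin (t + pi / 3)"
    by (auto simp: sin_row_def vec_eq_iff forall_2)
  then show ?thesis
    unfolding sin_add_pi3 by (simp add: sin_cos_eq_iff[symmetric])
qed

lemma iwasawa_inject:
  assumes "iwasawa t y z = iwasawa t' y' z'"
  shows "y = y' \<and> z = z' \<and> (\<exists>n::int. t = t' + 2 * pi * n)"
proof -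
  have yz: "y = y'" "z = z'"
    using coords_iwasawa[of t y z] coords_iwasawa[of t' y' z'] assms by auto
  have "iwasawa t y z $ 2 = iwasawa t' y' z' $ 2"
    using assms by simp
  then have "sin_row t = sin_row t'"
    using yz hex_scale(1) by simp
  then show ?thesis
    using yz sin_row_inject by blast
qed

lemma iwasawa_periodic: "iwasawa (t + 2 * pi * of_int n) y z = iwasawa t y z"
proof -
  have "sin (t + 2 * pi * of_int n) = sin t" "cos (t + 2 * pi * of_int n) = cos t"
    using sin_cos_eq_iff by blast+
  then have "sin_row (t + 2 * pi * of_int n) = sin_row t" "cos_row (t + 2 * pi * of_int n) = cos_row t"
    unfolding sin_row_eq cos_row_eq by simp_all
  then show ?thesis
    by (simp add: iwasawa_def)
qed

text \<open>The powers of \<open>hex_rotation\<close>, encoded by their right multiplication, which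
  is how they meet \<open>iwasawa\<close>.\<close>

definition hex_rotations :: "(real^2^2) set" where
  "hex_rotations = {m. \<exists>n. \<forall>g :: real^2^2. g ** m = ((\<lambda>g. g ** hex_rotation) ^^ n) g}"

lemma iwasawa_hex_rotations:
  assumes "m \<in> hex_rotations"
  shows "\<exists>n::nat. \<forall>t y z. iwasawa t y z ** m = iwasawa (t + real n * (pi / 3)) y z"
proof -
  obtain n where n: "\<And>g :: real^2^2. g ** m = ((\<lambda>g. g ** hex_rotation) ^^ n) g"
    using assms by (auto simp: hex_rotations_def)
  have "((\<lambda>g. g ** hex_rotation) ^^ n) (iwasawa t y z) = iwasawa (t + real n * (pi / 3)) y z" for n t y z
  proof (induction n)
    case (Suc n)
    have "t + real n * (pi / 3) + pi / 3 = t + real (Suc n) * (pi / 3)"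
      by (simp add: field_simps)
    with Suc show ?case
      by (simp only: funpow.simps o_apply iwasawa_hex_rotation)
  qed simp
  then show ?thesis
    using n by auto
qed

text \<open>Only the part of the curve inside \<open>U\<close> is kept. By \<open>disc\<close>, two
  matrices in \<open>U\<close> that give the same lattice differ by a hexagon rotation, so the image
  in the quotient has no further identifications.\<close>

locale transversal_curve =
  fixes y y' z z' :: "real \<Rightarrow> real" and U :: "(real^2^2) set"
  assumes y: "\<And>t. (y has_real_derivative y' t) (at t)" "continuous_on UNIV y'" "\<And>t. y (t + pi / 3) = y t"
    and z: "\<And>t. (z has_real_derivative z' t) (at t)" "continuous_on UNIV z'" "\<And>t. z (t + pi / 3) = z t"
    and U: "open U"
    and disc: "\<And>g m. g \<in> SL2R \<Longrightarrow> g \<in> U \<Longrightarrow> m \<in> SL2Z \<Longrightarrow> g ** m \<in> U \<Longrightarrow> m \<in> hex_rotations"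
begin

definition \<Gamma> :: "real \<Rightarrow> real^2^2" where "\<Gamma> t = iwasawa t (y t) (z t)"

definition curve :: "(real^2) set set" where
  "curve = {act (\<Gamma> t) Z2 | t. \<Gamma> t \<in> U}"

lemma periodic_int: "y (t + of_int n * (pi / 3)) = y t" "z (t + of_int n * (pi / 3)) = z t"
proof -
  have per: "f (t + of_int n * (pi / 3)) = f t" if "\<And>t. f (t + pi / 3) = f t" for f :: "real \<Rightarrow> real"
  proof (induction n rule: int_induct[of _ 0])
    case (step1 i)
    have "t + of_int (i + 1) * (pi / 3) = t + of_int i * (pi / 3) + pi / 3"
      by (simp add: field_simps)
    then show ?case using step1 that by metis
  next
    case (step2 i)
    have "t + of_int i * (pi / 3) = t + of_int (i - 1) * (pi / 3) + pi / 3"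
      by (simp add: field_simps)
    then show ?case using step2 that by metis
  qed simp
  show "y (t + of_int n * (pi / 3)) = y t" "z (t + of_int n * (pi / 3)) = z t"
    by (rule per, rule y z)+
qed

lemma \<Gamma>_SL2R: "\<Gamma> t \<in> SL2R"
  by (simp add: \<Gamma>_def SL2R_def det_iwasawa)

text \<open>A hexagon rotation only shifts the angle, so inside \<open>U\<close> height and shear
  are determined by the lattice; the ambiguity \<open>2 * pi\<close> of the coordinates is six
  periods.\<close>

lemma same_lattice:
  assumes "iwasawa t a b \<in> U" "iwasawa t' a' b' \<in> U" "act (iwasawa t' a' b') Z2 = act (iwasawa t a b) Z2"
  shows "a' = a \<and> b' = b \<and> (\<exists>n::int. t' = t + of_int n * (pi / 3))"
proof -
  have sl: "iwasawa t a b \<in> SL2R" for t a b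
    by (simp add: SL2R_def det_iwasawa)
  obtain m where m: "m \<in> SL2Z" "iwasawa t' a' b' = iwasawa t a b ** m"
    using assms(3) act_Z2_eq_iff[OF sl sl] by blast
  then have "m \<in> hex_rotations"
    using assms disc sl by metis
  then obtain k :: nat where "iwasawa t a b ** m = iwasawa (t + real k * (pi / 3)) a b"
    using iwasawa_hex_rotations by blast
  then have "iwasawa t' a' b' = iwasawa (t + real k * (pi / 3)) a b"
    using m by simp
  then obtain j :: int where "a' = a" "b' = b" "t' = t + real k * (pi / 3) + 2 * pi * j"
    using iwasawa_inject by blast
  moreover from this have "t' = t + of_int (int k + 6 * j) * (pi / 3)"
    by (simp add: field_simps)
  ultimately show ?thesis by blast
qed

text \<open>Coordinates that straighten the curve: \<open>v$1\<close> runs along it, while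
  \<open>v$2\<close> and \<open>v$3\<close> are the offsets in height and shear.\<close>

definition chart :: "real \<Rightarrow> real^3 \<Rightarrow> real^2^2" where
  "chart t v = iwasawa (t + v$1) (y (t + v$1) + v$2) (z (t + v$1) + v$3)"

definition chart_deriv :: "real \<Rightarrow> real^3 \<Rightarrow> real^3 \<Rightarrow> real^2^2" where
  "chart_deriv t v h = iwasawa_deriv (t + v$1) (y (t + v$1) + v$2) (z (t + v$1) + v$3)
     (h$1) (y' (t + v$1) * h$1 + h$2) (z' (t + v$1) * h$1 + h$3)"

lemma chart_has_derivative: "(chart t has_derivative chart_deriv t v) (at v)"
proof -
  have n: "((\<lambda>v :: real^3. v $ i) has_derivative (\<lambda>h. h $ i)) (at v)" for i
    by (rule bounded_linear_imp_has_derivative[OF bounded_linear_vec_nth])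
  have T: "((\<lambda>v :: real^3. t + v$1) has_derivative (\<lambda>h. h$1)) (at v)"
    using has_derivative_add[OF has_derivative_const n[of 1]] by simp
  have Y: "((\<lambda>v :: real^3. y (t + v$1) + v$2) has_derivative (\<lambda>h. y' (t + v$1) * h$1 + h$2)) (at v)"
    using has_derivative_add[OF DERIV_compose_FDERIV[OF y(1) T] n[of 2]] by (simp add: mult.commute)
  have Z: "((\<lambda>v :: real^3. z (t + v$1) + v$3) has_derivative (\<lambda>h. z' (t + v$1) * h$1 + h$3)) (at v)"
    using has_derivative_add[OF DERIV_compose_FDERIV[OF z(1) T] n[of 3]] by (simp add: mult.commute)
  show ?thesis
    unfolding chart_def[abs_def] chart_deriv_def[abs_def] by (rule has_derivative_iwasawa[OF T Y Z])
qed

lemma continuous_y: "continuous_on UNIV y" and continuous_z: "continuous_on UNIV z"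
  using y(1) z(1) by (auto intro!: DERIV_continuous_on)

lemma continuous_on_iwasawa_deriv:
  fixes S :: "'a::t2_space set"
  assumes "continuous_on S t" "continuous_on S a" "continuous_on S b" "continuous_on S c" "continuous_on S d" "continuous_on S e"
  shows "continuous_on S (\<lambda>x. iwasawa_deriv (t x) (a x) (b x) (c x) (d x) (e x))"
proof -
  have rows: "continuous_on S (\<lambda>x. vector [f x, g x] :: real^2^2)" if "continuous_on S f" "continuous_on S g" for f g
    using bounded_linear.continuous_on[OF bounded_linear_rows continuous_on_Pair[OF that]] by simp
  show ?thesis
    unfolding iwasawa_deriv_def sin_row_eq cos_row_eq
    by (intro rows continuous_intros assms)
qed

text \<open>The bound \<open>pi / 6\<close> keeps the angles of two points of the chart less than
  one period \<open>pi / 3\<close> apart, which is what injectivity into the lattices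
  requires.\<close>

lemma chart_C1_chart:
  assumes V: "V = {v. \<bar>v$1\<bar> < pi / 6 \<and> chart t v \<in> U}"
  shows "C1_chart V (chart t)"
  unfolding C1_chart_def
proof (intro conjI exI)
  have cont: "continuous_on UNIV (chart t)"
    using chart_has_derivative by (meson has_derivative_continuous_on has_derivative_at_withinI)
  have "V = {v. \<bar>v$1\<bar> < pi / 6} \<inter> chart t -` U"
    by (auto simp: V)
  then show "open V"
    using open_vimage[OF U cont] by (simp add: open_Int open_Collect_less continuous_intros)
  show "chart t ` V \<subseteq> SL2R"
    by (auto simp: chart_def SL2R_def det_iwasawa)
  have bl: "bounded_linear (chart_deriv t v)" for v
    using chart_has_derivative by (rule has_derivative_bounded_linear)
  show "\<forall>v\<in>V. (chart t has_derivative blinfun_apply (Blinfun (chart_deriv t v))) (at v)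
      \<and> inj (blinfun_apply (Blinfun (chart_deriv t v)))"
  proof
    fix v
    have "inj (chart_deriv t v)"
    proof (subst linear_injective_0)
      show "linear (chart_deriv t v)"
        using bl by (rule bounded_linear.linear)
      show "\<forall>h. chart_deriv t v h = 0 \<longrightarrow> h = 0"
      proof (intro allI impI)
        fix h assume "chart_deriv t v h = 0"
        then have "h$1 = 0 \<and> y' (t + v$1) * h$1 + h$2 = 0 \<and> z' (t + v$1) * h$1 + h$3 = 0"
          unfolding chart_deriv_def by (rule iwasawa_deriv_eq_0)
        then show "h = 0"
          by (auto simp: vec_eq_iff forall_3)
      qed
    qed
    then show "(chart t has_derivative blinfun_apply (Blinfun (chart_deriv t v))) (at v)
      \<and> inj (blinfun_apply (Blinfun (chart_deriv t v)))"
      using chart_has_derivative by (simp add: bounded_linear_Blinfun_apply[OF bl])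
  qed
  show "continuous_on V (\<lambda>v. Blinfun (chart_deriv t v))"
  proof (rule continuous_on_blinfun_componentwise)
    fix i :: "real^3"
    have "continuous_on V (\<lambda>v. chart_deriv t v i)"
      unfolding chart_deriv_def
      by (intro continuous_on_iwasawa_deriv continuous_intros continuous_on_compose2[OF y(2)]
          continuous_on_compose2[OF z(2)] continuous_on_compose2[OF continuous_y] continuous_on_compose2[OF continuous_z]) auto
    then show "continuous_on V (\<lambda>v. blinfun_apply (Blinfun (chart_deriv t v)) i)"
      by (simp add: bounded_linear_Blinfun_apply[OF bl])
  qed
  show "inj_on (\<lambda>v. act (chart t v) Z2) V"
  proof (rule inj_onI)
    fix v w assume vw: "v \<in> V" "w \<in> V" "act (chart t v) Z2 = act (chart t w) Z2"
    have "y (t + v$1) + v$2 = y (t + w$1) + w$2 \<and> z (t + v$1) + v$3 = z (t + w$1) + w$3 \<and>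
        (\<exists>n::int. t + v$1 = t + w$1 + of_int n * (pi / 3))"
      by (rule same_lattice) (use vw in \<open>auto simp: V chart_def\<close>)
    then obtain n :: int where n: "v$1 - w$1 = of_int n * (pi / 3)"
      and eq: "y (t + v$1) + v$2 = y (t + w$1) + w$2" "z (t + v$1) + v$3 = z (t + w$1) + w$3"
      by auto
    have "\<bar>v$1\<bar> < pi / 6" "\<bar>w$1\<bar> < pi / 6"
      using vw by (simp_all add: V)
    then have "\<bar>v$1 - w$1\<bar> < pi / 3"
      by linarith
    then have "\<bar>of_int n :: real\<bar> * (pi / 3) < 1 * (pi / 3)"
      unfolding n by (simp add: abs_mult)
    then have "\<bar>of_int n :: real\<bar> < 1"
      using pi_gt_zero by (subst (asm) mult_less_cancel_right) auto
    then have "n = 0"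
      by linarith
    then show "v = w"
      using n eq by (simp add: vec_eq_iff forall_3)
  qed
qed

text \<open>A chart point may lie on the curve through a distant parameter \<open>s\<close>, but
  then the angles differ by whole periods, and periodicity forces both offsets to vanish.\<close>

lemma C1_submanifold_curve: "C1_submanifold 1 curve"
  unfolding C1_submanifold_def
proof (intro conjI ballI)
  show "curve \<subseteq> space_X"
    using \<Gamma>_SL2R by (auto simp: curve_def space_X_def orbit_def)
  fix x assume "x \<in> curve"
  then obtain t where t: "x = act (\<Gamma> t) Z2" "\<Gamma> t \<in> U"
    by (auto simp: curve_def)
  define V where "V = {v. \<bar>v$1\<bar> < pi / 6 \<and> chart t v \<in> U}"
  define E where "E = span {axis 1 1 :: real^3}"
  have E: "v \<in> E \<longleftrightarrow> v$2 = 0 \<and> v$3 = 0" for v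
  proof
    assume "v$2 = 0 \<and> v$3 = 0"
    then have "v = (v$1) *\<^sub>R axis 1 1"
      by (simp add: vec_eq_iff forall_3 axis_def)
    then show "v \<in> E"
      unfolding E_def span_singleton by blast
  qed (auto simp: E_def span_singleton axis_def)
  have chart0: "chart t 0 = \<Gamma> t"
    by (simp add: chart_def \<Gamma>_def)
  have "{v \<in> V. act (chart t v) Z2 \<in> curve} = V \<inter> E"
  proof (intro equalityI subsetI)
    fix v assume "v \<in> {v \<in> V. act (chart t v) Z2 \<in> curve}"
    then obtain s where v: "v \<in> V" and s: "act (chart t v) Z2 = act (\<Gamma> s) Z2" "\<Gamma> s \<in> U"
      by (auto simp: curve_def)
    have "y (t + v$1) + v$2 = y s \<and> z (t + v$1) + v$3 = z s \<and> (\<exists>n::int. t + v$1 = s + of_int n * (pi / 3))"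
      by (rule same_lattice) (use v s in \<open>auto simp: V_def chart_def \<Gamma>_def\<close>)
    then have "v$2 = 0 \<and> v$3 = 0"
      using periodic_int by auto
    then show "v \<in> V \<inter> E"
      using v E by simp
  next
    fix v assume v: "v \<in> V \<inter> E"
    then have "chart t v = \<Gamma> (t + v$1)"
      using E by (simp add: chart_def \<Gamma>_def)
    then show "v \<in> {v \<in> V. act (chart t v) Z2 \<in> curve}"
      using v by (auto simp: V_def curve_def)
  qed
  moreover have "x \<in> (\<lambda>v. act (chart t v) Z2) ` V"
    by (rule image_eqI[of _ _ 0]) (use t chart0 in \<open>auto simp: V_def\<close>)
  moreover have "subspace E" "dim E = 1"
    unfolding E_def by (simp_all add: dim_span axis_eq_0_iff)
  ultimately show "\<exists>V s E. C1_chart V s \<and> x \<in> (\<lambda>y. act (s y) Z2) ` V \<and>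
        subspace E \<and> dim E = 1 \<and> {y \<in> V. act (s y) Z2 \<in> curve} = V \<inter> E"
    using chart_C1_chart[OF V_def] by blast
qed

end

section \<open>Tangent spaces\<close>

lemma bounded_linear_matrix_mult_right: "bounded_linear (\<lambda>m :: real^2^2. m ** (g :: real^2^2))"
  unfolding linear_conv_bounded_linear[symmetric]
  by (rule linearI) (simp_all add: vec_eq_iff matrix_matrix_mult_def sum_2 algebra_simps)

lemma SL2R_mult: "g \<in> SL2R \<Longrightarrow> h \<in> SL2R \<Longrightarrow> g ** h \<in> SL2R"
  by (simp add: SL2R_def det_mul)

lemma SL2R_right_inverse:
  assumes "g \<in> SL2R"
  obtains k where "g ** k = mat 1" "k ** g = mat 1"
proof -
  have "invertible g"
    using assms by (simp add: SL2R_def invertible_det_nz)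
  then show ?thesis
    using that unfolding invertible_def by blast
qed

lemma countable_SL2Z: "countable SL2Z"
proof -
  let ?f = "\<lambda>g :: real^2^2. (g$1$1, g$1$2, g$2$1, g$2$2)"
  have "countable (\<int> :: real set)"
    unfolding Ints_def by simp
  then have "countable ((\<int> :: real set) \<times> (\<int> :: real set) \<times> (\<int> :: real set) \<times> (\<int> :: real set))"
    by (intro countable_SIGMA) auto
  moreover have "?f ` SL2Z \<subseteq> \<int> \<times> \<int> \<times> \<int> \<times> \<int>"
    by (auto simp: SL2Z_def)
  ultimately have "countable (?f ` SL2Z)"
    using countable_subset by blast
  moreover have "inj_on ?f SL2Z"
    by (auto simp: inj_on_def vec_eq_iff forall_2)
  ultimately show ?thesis
    using countable_image_inj_on by blast
qed

lemma continuous_countable_image_constant: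
  fixes f :: "real \<Rightarrow> real"
  assumes "continuous_on {a<..<b} f" "countable (f ` {a<..<b})" "s \<in> {a<..<b}" "t \<in> {a<..<b}"
  shows "f s = f t"
proof (rule ccontr)
  assume "f s \<noteq> f t"
  moreover have "connected (f ` {a<..<b})"
    by (intro connected_continuous_image assms) simp
  ultimately have "uncountable (f ` {a<..<b})"
    using connected_uncountable[of _ "f s" "f t"] assms by blast
  then show False
    using assms by blast
qed

lemma eventually_at_0_interval: "\<epsilon> > 0 \<Longrightarrow> \<forall>\<^sub>F t in at 0. t \<in> {-\<epsilon><..<\<epsilon>::real}"
  by (auto simp: eventually_at_topological intro!: exI[of _ "{-\<epsilon><..<\<epsilon>}"])

text \<open>
  Products of an entry of the first row with an entry of the second row are invariant under
  \<open>F\<close>, so along a curve in an \<open>F\<close>-orbit they take only countably many values.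
\<close>

lemma tangent_space_F_orbit:
  assumes g: "g \<in> SL2R" and v: "v \<in> tangent_space (orbit F_group (act g Z2)) (act g Z2)"
  shows "v$1$2 = 0 \<and> v$2$1 = 0"
proof -
  obtain \<gamma> \<epsilon> where \<epsilon>: "\<epsilon> > 0" and \<gamma>0: "\<gamma> 0 = mat 1" and C1: "\<gamma> C1_differentiable_on {-\<epsilon><..<\<epsilon>}"
    and orb: "\<And>t. t \<in> {-\<epsilon><..<\<epsilon>} \<Longrightarrow> \<gamma> t \<in> SL2R \<and> act (\<gamma> t) (act g Z2) \<in> orbit F_group (act g Z2)"
    and der: "(\<gamma> has_vector_derivative v) (at 0)"
    using v unfolding tangent_space_def by blast
  obtain k where k: "g ** k = mat 1" "k ** g = mat 1"
    using SL2R_right_inverse[OF g] .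
  have cont: "continuous_on {-\<epsilon><..<\<epsilon>} \<gamma>"
    using C1 by (rule C1_differentiable_imp_continuous_on)
  have prod: "\<gamma> t $ 1 $ j * \<gamma> t $ 2 $ j \<in> (\<lambda>m. (g ** m ** k) $ 1 $ j * (g ** m ** k) $ 2 $ j) ` SL2Z"
    if t: "t \<in> {-\<epsilon><..<\<epsilon>}" for t j
  proof -
    obtain f where f: "f \<in> F_group" "act (\<gamma> t) (act g Z2) = act f (act g Z2)"
      using orb[OF t] by (auto simp: orbit_def)
    obtain s where s: "f = vector [vector [exp s, 0], vector [0, exp (- s)]]"
      using f by (auto simp: F_group_def)
    have "f \<in> SL2R"
      by (simp add: s SL2R_def det_2 exp_minus)
    then have "\<exists>m\<in>SL2Z. \<gamma> t ** g = (f ** g) ** m"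
      using f(2) orb[OF t] g by (intro act_Z2_eq_iff[THEN iffD1]) (auto simp: act_mult SL2R_mult)
    then obtain m where m: "m \<in> SL2Z" "\<gamma> t ** g = (f ** g) ** m"
      by blast
    have "\<gamma> t = (\<gamma> t ** g) ** k"
      by (simp add: matrix_mul_assoc[symmetric] k)
    also have "\<dots> = f ** (g ** m ** k)"
      by (simp add: m matrix_mul_assoc)
    finally have "\<gamma> t = f ** (g ** m ** k)" .
    then have "\<gamma> t $ 1 $ j * \<gamma> t $ 2 $ j = (exp s * exp (- s)) * ((g ** m ** k) $ 1 $ j * (g ** m ** k) $ 2 $ j)"
      by (simp add: s matrix_matrix_mult_def[of "vector _"] sum_2 algebra_simps)
    then have "\<gamma> t $ 1 $ j * \<gamma> t $ 2 $ j = (g ** m ** k) $ 1 $ j * (g ** m ** k) $ 2 $ j"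
      by (simp add: exp_minus)
    then show ?thesis
      using m by blast
  qed
  have zero: "\<gamma> t $ 1 $ j * \<gamma> t $ 2 $ j = 0" if t: "t \<in> {-\<epsilon><..<\<epsilon>}" for t j
  proof -
    have "\<gamma> t $ 1 $ j * \<gamma> t $ 2 $ j = \<gamma> 0 $ 1 $ j * \<gamma> 0 $ 2 $ j"
    proof (rule continuous_countable_image_constant[where f = "\<lambda>t. \<gamma> t $ 1 $ j * \<gamma> t $ 2 $ j"])
      show "continuous_on {-\<epsilon><..<\<epsilon>} (\<lambda>t. \<gamma> t $ 1 $ j * \<gamma> t $ 2 $ j)"
        by (intro continuous_intros cont)
      show "countable ((\<lambda>t. \<gamma> t $ 1 $ j * \<gamma> t $ 2 $ j) ` {-\<epsilon><..<\<epsilon>})"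
        by (rule countable_subset[OF _ countable_image[OF countable_SL2Z]]) (use prod in blast)
    qed (use t \<epsilon> in auto)
    moreover have "(mat 1 :: real^2^2) $ 1 $ j * (mat 1 :: real^2^2) $ 2 $ j = 0"
      using exhaust_2[of j] by (auto simp: mat_def)
    ultimately show ?thesis
      by (simp add: \<gamma>0)
  qed
  have comp: "((\<lambda>t. \<gamma> t $ i $ j) has_vector_derivative v $ i $ j) (at 0)" for i j
    by (intro bounded_linear.has_vector_derivative[OF bounded_linear_vec_nth] der)
  have van: "v $ i $ j = 0" if ev: "\<forall>\<^sub>F t in at 0. \<gamma> t $ i $ j = 0" and ij: "i \<noteq> j" for i j
  proof -
    have "((\<lambda>t. \<gamma> t $ i $ j) has_vector_derivative 0) (at 0)"
      unfolding has_vector_derivative_def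
    proof (rule has_derivative_transform_eventually[where f = "\<lambda>_. 0"])
      show "\<forall>\<^sub>F t in at 0. 0 = \<gamma> t $ i $ j"
        using ev by eventually_elim simp
    qed (use ij in \<open>simp_all add: \<gamma>0 mat_def\<close>)
    then show ?thesis
      using vector_derivative_unique_at[OF comp] by blast
  qed
  have lim: "((\<lambda>t. \<gamma> t $ i $ i) \<longlongrightarrow> 1) (at 0)" for i
    using has_vector_derivative_continuous[OF comp[of i i]] by (simp add: continuous_at \<gamma>0 mat_def)
  \<comment> \<open>Near time 0 the diagonal entries stay close to 1, so in each column the
    vanishing product forces the off-diagonal entry to be 0.\<close>
  have ne: "\<forall>\<^sub>F t in at 0. \<gamma> t $ i $ i \<noteq> 0" for i
    using lim by (rule tendsto_imp_eventually_ne) simp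
  have "\<forall>\<^sub>F t in at 0. \<gamma> t $ 2 $ 1 = 0"
    using ne[of 1] eventually_at_0_interval[OF \<epsilon>] by eventually_elim (use zero[of _ 1] in auto)
  moreover have "\<forall>\<^sub>F t in at 0. \<gamma> t $ 1 $ 2 = 0"
    using ne[of 2] eventually_at_0_interval[OF \<epsilon>] by eventually_elim (use zero[of _ 2] in auto)
  ultimately show ?thesis
    using van by simp
qed

lemma diag_in_tangent_space:
  "vector [vector [1, 0], vector [0, -1]] \<in> tangent_space (orbit F_group x) x"
proof -
  define A :: "real^2^2" where "A = vector [vector [1, 0], vector [0, 0]]"
  define B :: "real^2^2" where "B = vector [vector [0, 0], vector [0, 1]]"
  define \<gamma> where "\<gamma> = (\<lambda>t. exp t *\<^sub>R A + exp (- t) *\<^sub>R B)"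
  have eq: "\<gamma> t = vector [vector [exp t, 0], vector [0, exp (- t)]]" for t
    by (simp add: \<gamma>_def A_def B_def vec_eq_iff forall_2)
  have der: "(\<gamma> has_vector_derivative exp t *\<^sub>R A - exp (- t) *\<^sub>R B) (at t)" for t
    unfolding \<gamma>_def by (auto intro!: derivative_eq_intros simp: has_real_derivative_iff_has_vector_derivative[symmetric])
  have "\<gamma> C1_differentiable_on {-1<..<1}"
    unfolding C1_differentiable_on_def
    by (intro exI[of _ "\<lambda>t. exp t *\<^sub>R A - exp (- t) *\<^sub>R B"] conjI ballI der continuous_intros)
  moreover have "\<gamma> 0 = mat 1"
    by (simp add: eq vec_eq_iff forall_2 mat_def)
  moreover have "\<gamma> t \<in> SL2R" for t
    by (simp add: eq SL2R_def det_2 exp_minus)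
  moreover have "act (\<gamma> t) x \<in> orbit F_group x" for t
    unfolding orbit_def F_group_def eq by blast
  moreover have "exp 0 *\<^sub>R A - exp (- 0) *\<^sub>R B = vector [vector [1, 0], vector [0, -1]]"
    by (simp add: A_def B_def vec_eq_iff forall_2)
  ultimately show ?thesis
    unfolding tangent_space_def using der[of 0]
    by (intro CollectI exI[of _ \<gamma>] exI[of _ 1]) auto
qed

lemma shear_in_tangent_space:
  "vector [vector [0, 1], vector [0, 0]] \<in> tangent_space (orbit H_group x) x"
proof -
  define A :: "real^2^2" where "A = vector [vector [0, 1], vector [0, 0]]"
  define \<gamma> where "\<gamma> = (\<lambda>t. mat 1 + t *\<^sub>R A)"
  have eq: "\<gamma> t = vector [vector [1, t], vector [0, 1]]" for t
    by (simp add: \<gamma>_def A_def vec_eq_iff forall_2 mat_def)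
  have der: "(\<gamma> has_vector_derivative A) (at t)" for t
    unfolding \<gamma>_def by (auto intro!: derivative_eq_intros)
  have "\<gamma> C1_differentiable_on {-1<..<1}"
    unfolding C1_differentiable_on_def
    by (intro exI[of _ "\<lambda>t. A"] conjI ballI der continuous_intros)
  moreover have "\<gamma> 0 = mat 1"
    by (simp add: \<gamma>_def)
  moreover have "\<gamma> t \<in> SL2R" for t
    by (simp add: eq SL2R_def det_2)
  moreover have "act (\<gamma> t) x \<in> orbit H_group x" for t
    unfolding orbit_def H_group_def eq by blast
  ultimately show ?thesis
    unfolding tangent_space_def A_def[symmetric] using der[of 0]
    by (intro CollectI exI[of _ \<gamma>] exI[of _ 1]) auto
qed

text \<open>The entry \<open>v$2$1\<close> vanishes on the tangent directions of \<open>F\<close>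
  and \<open>H\<close>. If no nonzero tangent vector of \<open>Z\<close> is killed by it,
  \<open>Z\<close> does not contain the direction of \<open>F\<close>, and writing the nilpotent
  direction of \<open>H\<close> as \<open>u + w\<close> forces \<open>u = 0\<close>, although
  \<open>w\<close> is diagonal.\<close>

lemma transversalI:
  assumes "Z \<subseteq> space_X" and Z: "\<And>x v. x \<in> Z \<Longrightarrow> v \<in> tangent_space Z x \<Longrightarrow> v$2$1 = 0 \<Longrightarrow> v = 0"
  shows "transversal F_group H_group Z"
  unfolding transversal_def
proof (intro ballI conjI notI)
  fix x assume x: "x \<in> Z"
  let ?D = "vector [vector [1, 0], vector [0, -1]] :: real^2^2"
  let ?E = "vector [vector [0, 1], vector [0, 0]] :: real^2^2"
  obtain g where g: "g \<in> SL2R" "x = act g Z2"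
    using x assms(1) by (auto simp: space_X_def orbit_def)
  show False if "tangent_space (orbit F_group x) x \<subseteq> tangent_space Z x"
  proof -
    have "?D = 0"
      using that diag_in_tangent_space[of x] by (intro Z[OF x]) auto
    then have "?D $ 1 $ 1 = 0"
      by (simp only: zero_index)
    then show False
      by simp
  qed
  show False if sub: "tangent_space (orbit H_group x) x
      \<subseteq> {u + w | u w. u \<in> tangent_space Z x \<and> w \<in> tangent_space (orbit F_group x) x}"
  proof -
    obtain u w where uw: "?E = u + w" "u \<in> tangent_space Z x" "w \<in> tangent_space (orbit F_group x) x"
      using subsetD[OF sub shear_in_tangent_space] by blast
    have w: "w$1$2 = 0" "w$2$1 = 0"
      using tangent_space_F_orbit[OF g(1)] uw(3) g(2) by auto
    have "?E $ 2 $ 1 = u$2$1 + w$2$1" "?E $ 1 $ 2 = u$1$2 + w$1$2"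
      unfolding uw(1) by simp_all
    moreover from this have "u = 0"
      using w uw(2) by (intro Z[OF x]) auto
    ultimately show False
      using w by simp
  qed
qed

lemma hex_form_sin_rows: "hex_form (sin_row s) (sin_row t) = 3 / 4 * cos (s - t)"
proof -
  have "a * b + (a / 2 + r / 2 * c) * (b / 2 + r / 2 * d) - (a * (b / 2 + r / 2 * d) + (a / 2 + r / 2 * c) * b) / 2
      = 3 / 4 * (a * b) + r * r / 4 * (c * d)" for a b c d r :: real
    by (simp add: field_simps)
  from this[of "sin s" "sin t" "sqrt 3" "cos s" "cos t"]
  have "hex_form (sin_row s) (sin_row t) = 3 / 4 * (sin s * sin t) + 3 / 4 * (cos s * cos t)"
    by (simp add: hex_form_def sin_row_def sin_add_pi3)
  then show ?thesis
    by (simp add: cos_diff algebra_simps)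
qed

lemma arctan_tan_cos_pos:
  assumes "cos d > 0"
  shows "\<exists>n::int. d = arctan (tan d) + 2 * pi * n"
proof -
  have "1 + (tan d)\<^sup>2 = (1 / cos d)\<^sup>2"
    using assms tan_sec[of d] by (simp add: inverse_eq_divide)
  then have s: "sqrt (1 + (tan d)\<^sup>2) = 1 / cos d"
    using assms by simp
  have "cos (arctan (tan d)) = cos d" "sin (arctan (tan d)) = sin d"
    unfolding cos_arctan sin_arctan s using assms by (simp_all add: tan_def)
  then show ?thesis
    using sin_cos_eq_iff by metis
qed

context transversal_curve
begin

lemma \<Gamma>_periodic_int: "\<Gamma> (t + 2 * pi * of_int n) = \<Gamma> t"
proof -
  have "t + 2 * pi * of_int n = t + of_int (6 * n) * (pi / 3)"
    by (simp add: field_simps)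
  then have "y (t + 2 * pi * of_int n) = y t" "z (t + 2 * pi * of_int n) = z t"
    using periodic_int by metis+
  then show ?thesis
    by (simp only: \<Gamma>_def iwasawa_periodic)
qed

lemma curve_lift:
  assumes g: "g \<in> SL2R" "g \<in> U" "act g Z2 \<in> curve"
  shows "\<exists>s. g = \<Gamma> s"
proof -
  obtain s where s: "act g Z2 = act (\<Gamma> s) Z2" "\<Gamma> s \<in> U"
    using g by (auto simp: curve_def)
  obtain m where m: "m \<in> SL2Z" "g = \<Gamma> s ** m"
    using s act_Z2_eq_iff[OF g(1) \<Gamma>_SL2R] by blast
  then have "m \<in> hex_rotations"
    using g s disc[OF \<Gamma>_SL2R] by blast
  then obtain k :: nat where k: "\<Gamma> s ** m = iwasawa (s + real k * (pi / 3)) (y s) (z s)"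
    using iwasawa_hex_rotations unfolding \<Gamma>_def by blast
  have "g = \<Gamma> (s + real k * (pi / 3))"
    using m k periodic_int[of s "int k"] by (simp add: \<Gamma>_def)
  then show ?thesis ..
qed

text \<open>Near time 0 the moving matrix is \<open>\<Gamma> (\<theta> t)\<close>, with
  \<open>\<theta>\<close> recovered differentiably from its second row. The condition on
  \<open>v\<close> says that this row moves only in its own direction, so \<open>\<theta>\<close>
  has derivative 0, and by the chain rule the velocity is 0.\<close>

lemma tangent_space_curve:
  assumes x: "x \<in> curve" and v: "v \<in> tangent_space curve x" "v$2$1 = 0"
  shows "v = 0"
proof -
  obtain t\<^sub>0 where t0: "x = act (\<Gamma> t\<^sub>0) Z2" "\<Gamma> t\<^sub>0 \<in> U"
    using x by (auto simp: curve_def)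
  obtain \<gamma> \<epsilon> where \<epsilon>: "\<epsilon> > 0" and \<gamma>0: "\<gamma> 0 = mat 1"
    and orb: "\<And>t. t \<in> {-\<epsilon><..<\<epsilon>} \<Longrightarrow> \<gamma> t \<in> SL2R \<and> act (\<gamma> t) x \<in> curve"
    and der: "(\<gamma> has_vector_derivative v) (at 0)"
    using v unfolding tangent_space_def by blast
  let ?g0 = "\<Gamma> t\<^sub>0"
  define g where "g = (\<lambda>t. \<gamma> t ** ?g0)"
  have g0: "g 0 = ?g0"
    by (simp add: g_def \<gamma>0)
  have gder: "(g has_vector_derivative v ** ?g0) (at 0)"
    unfolding g_def by (rule bounded_linear.has_vector_derivative[OF bounded_linear_matrix_mult_right der])
  have glim: "(g \<longlongrightarrow> ?g0) (at 0)"
    using has_vector_derivative_continuous[OF gder] by (simp add: continuous_at g0)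
  have evU: "\<forall>\<^sub>F t in at 0. g t \<in> U"
    using topological_tendstoD[OF glim U t0(2)] .
  have lift: "\<forall>\<^sub>F t in at 0. \<exists>s. g t = \<Gamma> s"
    using evU eventually_at_0_interval[OF \<epsilon>]
  proof eventually_elim
    case (elim t)
    then show ?case
      using orb[of t] by (intro curve_lift) (auto simp: g_def SL2R_mult \<Gamma>_SL2R t0(1) act_mult)
  qed
  define A where "A = (\<lambda>t. cross2 (g t $ 2) (?g0 $ 2))"
  define B where "B = (\<lambda>t. hex_form (g t $ 2) (?g0 $ 2))"
  \<comment> \<open>The constant turns \<open>A t / B t\<close> into the tangent of the angle
    difference: \<open>A\<close> carries the factor \<open>sqrt 3 / 2\<close> and \<open>B\<close>
    the factor \<open>3 / 4\<close>.\<close>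
  define q where "q = (\<lambda>t. sqrt 3 / 2 * (A t / B t))"
  define \<theta> where "\<theta> = (\<lambda>t. t\<^sub>0 + arctan (q t))"
  have lin: "bounded_linear (\<lambda>m :: real^2^2. cross2 (m $ 2) c)" "bounded_linear (\<lambda>m :: real^2^2. hex_form (m $ 2) c)" for c
    unfolding linear_conv_bounded_linear[symmetric]
    by (rule linearI; simp add: cross2_def hex_form_def field_simps)+
  have "(v ** ?g0) $ 2 = v$2$2 *\<^sub>R ?g0 $ 2"
    using v(2) by (intro vec2_eqI) (simp_all add: matrix_matrix_mult_def sum_2)
  then have "cross2 ((v ** ?g0) $ 2) (?g0 $ 2) = 0"
    by (simp add: cross2_scale_self)
  then have Ader: "(A has_real_derivative 0) (at 0)"
    using bounded_linear.has_vector_derivative[OF lin(1)[of "?g0 $ 2"] gder]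
    by (simp add: A_def has_real_derivative_iff_has_vector_derivative)
  have Bder: "(B has_real_derivative hex_form ((v ** ?g0) $ 2) (?g0 $ 2)) (at 0)"
    using bounded_linear.has_vector_derivative[OF lin(2)[of "?g0 $ 2"] gder]
    by (simp add: B_def has_real_derivative_iff_has_vector_derivative)
  have A0: "A 0 = 0"
    by (simp add: A_def g0 cross2_def)
  have B0: "B 0 > 0"
    unfolding B_def g0 using \<Gamma>_SL2R[of t\<^sub>0] by (intro hex_form_pos row_nonzero) (simp add: SL2R_def)
  have "(q has_real_derivative 0) (at 0)"
    unfolding q_def using A0 B0 by (auto intro!: derivative_eq_intros Ader Bder)
  then have "(\<theta> has_real_derivative 0) (at 0)"
    unfolding \<theta>_def by (auto intro!: derivative_eq_intros)
  then have \<theta>der: "(\<theta> has_vector_derivative 0) (at 0)"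
    by (simp add: has_real_derivative_iff_has_vector_derivative)
  have \<theta>0: "\<theta> 0 = t\<^sub>0"
    by (simp add: \<theta>_def q_def A0)
  have "\<Gamma> differentiable at t\<^sub>0"
  proof -
    have "(\<Gamma> has_derivative (\<lambda>h. iwasawa_deriv t\<^sub>0 (y t\<^sub>0) (z t\<^sub>0) h (y' t\<^sub>0 * h) (z' t\<^sub>0 * h))) (at t\<^sub>0)"
      unfolding \<Gamma>_def[abs_def] using y(1)[of t\<^sub>0] z(1)[of t\<^sub>0]
      by (intro has_derivative_iwasawa has_derivative_ident) (simp_all add: has_field_derivative_def)
    then show ?thesis
      unfolding differentiable_def by blast
  qed
  then have "(\<Gamma> has_vector_derivative vector_derivative \<Gamma> (at t\<^sub>0)) (at (\<theta> 0))"
    by (simp add: \<theta>0 vector_derivative_works[symmetric])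
  from vector_diff_chain_at[OF \<theta>der this]
  have "((\<lambda>t. \<Gamma> (\<theta> t)) has_vector_derivative 0) (at 0)"
    by (simp add: o_def)
  moreover have "\<forall>\<^sub>F t in at 0. \<Gamma> (\<theta> t) = g t"
  proof -
    have "(B \<longlongrightarrow> B 0) (at 0)"
      using DERIV_isCont[OF Bder] by (simp add: isCont_def)
    then have "\<forall>\<^sub>F t in at 0. B t > 0"
      using B0 by (rule order_tendstoD(1))
    then show ?thesis
      using lift
    proof eventually_elim
      case (elim t)
      then obtain s where s: "g t = \<Gamma> s" by blast
      define c where "c = (hex_scale * exp (- y s)) * (hex_scale * exp (- y t\<^sub>0))"
      have c: "c > 0"
        using hex_scale(1) by (simp add: c_def)
      have At: "A t = c * (sqrt 3 / 2 * sin (s - t\<^sub>0))"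
        unfolding A_def s by (simp add: \<Gamma>_def c_def cross2_scale_left cross2_scale_right cross2_sin_row)
      have Bt: "B t = c * (3 / 4 * cos (s - t\<^sub>0))"
        unfolding B_def s by (simp add: \<Gamma>_def c_def hex_form_simps hex_form_sin_rows)
      have cos: "cos (s - t\<^sub>0) > 0"
        using elim(1) c unfolding Bt by (simp add: zero_less_mult_iff)
      have "q t = (sqrt 3 / 2 * (sqrt 3 / 2)) / (3 / 4) * (sin (s - t\<^sub>0) / cos (s - t\<^sub>0))"
        unfolding q_def At Bt using c cos by (simp add: field_simps)
      then have "q t = tan (s - t\<^sub>0)"
        by (simp add: tan_def)
      then obtain n :: int where "s - t\<^sub>0 = arctan (q t) + 2 * pi * n"
        using arctan_tan_cos_pos[OF cos] by auto
      then have "s = \<theta> t + 2 * pi * of_int n"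
        by (simp add: \<theta>_def)
      then show ?case
        using s \<Gamma>_periodic_int by metis
    qed
  qed
  ultimately have "(g has_vector_derivative 0) (at 0)"
    unfolding has_vector_derivative_def
    by (rule has_derivative_transform_eventually) (simp_all add: \<theta>0 g0)
  then have z: "v ** ?g0 = 0"
    using vector_derivative_unique_at[OF gder] by blast
  obtain k where "?g0 ** k = mat 1"
    using SL2R_right_inverse[OF \<Gamma>_SL2R] by blast
  then have "v = (v ** ?g0) ** k"
    by (simp add: matrix_mul_assoc[symmetric])
  then show "v = 0"
    unfolding z by (simp add: matrix_matrix_mult_def vec_eq_iff)
qed

lemma transversal_curve: "transversal F_group H_group curve"
  using C1_submanifold_curve tangent_space_curve
  by (intro transversalI) (auto simp: C1_submanifold_def)

end

section \<open>Critical loci\<close>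

definition adj2 :: "real^2^2 \<Rightarrow> real^2^2" where
  "adj2 g = vector [vector [g$2$2, - g$1$2], vector [- g$2$1, g$1$1]]"

lemma adj2: "det g = 1 \<Longrightarrow> adj2 g ** g = mat 1" "det g = 1 \<Longrightarrow> g ** adj2 g = mat 1"
  by (simp_all add: adj2_def vec_eq_iff forall_2 matrix_matrix_mult_def sum_2 mat_def det_2 algebra_simps)

lemma adj2_cancel:
  assumes "det g = 1"
  shows "adj2 g ** (g ** m) = (m :: real^2^2)" "g ** (adj2 g ** m) = m"
  unfolding matrix_mul_assoc adj2[OF assms] by simp_all

lemma continuous_on_adj2_mult: "continuous_on S (\<lambda>x. adj2 (fst x) ** (snd x :: real^2^2))"
proof -
  have "adj2 g ** h = vector [(g$2$2) *\<^sub>R h$1 - (g$1$2) *\<^sub>R h$2, (g$1$1) *\<^sub>R h$2 - (g$2$1) *\<^sub>R h$1]" for g h :: "real^2^2"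
    by (simp add: adj2_def vec_eq_iff forall_2 matrix_matrix_mult_def sum_2)
  moreover have "continuous_on S (\<lambda>x :: (real^2^2) \<times> (real^2^2). vector [f x, g x] :: real^2^2)"
    if "continuous_on S f" "continuous_on S g" for f g
    using bounded_linear.continuous_on[OF bounded_linear_rows continuous_on_Pair[OF that]] by simp
  ultimately show ?thesis
    by (simp add: continuous_intros)
qed

lemma closed_subset_SL2Z:
  assumes "S \<subseteq> SL2Z"
  shows "closed S"
proof (rule discrete_imp_closed[of 1])
  show "\<forall>x\<in>S. \<forall>y\<in>S. dist y x < 1 \<longrightarrow> y = x"
  proof (intro ballI impI)
    fix x y assume xy: "x \<in> S" "y \<in> S" "dist y x < 1"
    have "y $ i $ j = x $ i $ j" for i j
    proof -
      have "\<bar>y $ i $ j - x $ i $ j\<bar> \<le> norm (y - x)"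
        using component_le_norm_cart[of "(y - x) $ i" j] Finite_Cartesian_Product.norm_nth_le[of "y - x" i] by simp
      then have "\<bar>y $ i $ j - x $ i $ j\<bar> < 1"
        using xy by (simp add: dist_norm)
      moreover have "y $ i $ j - x $ i $ j \<in> \<int>"
        using subsetD[OF assms xy(1)] subsetD[OF assms xy(2)] by (simp add: SL2Z_def)
      ultimately show ?thesis
        using Ints_nonzero_abs_less1 by fastforce
    qed
    then show "y = x"
      by (simp add: vec_eq_iff)
  qed
qed simp

lemma SL2Z_mult:
  assumes "a \<in> SL2Z" "b \<in> SL2Z"
  shows "a ** b \<in> SL2Z"
proof -
  have "(a ** b) $ i $ j \<in> \<int>" for i j
    using assms by (simp add: SL2Z_def matrix_matrix_mult_def sum_2)
  then show ?thesis
    using assms by (simp add: SL2Z_def SL2R_mult)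
qed

lemma mult_column:
  "column j (g ** m) = (m$1$j) *\<^sub>R column 1 g + (m$2$j) *\<^sub>R column 2 (g :: real^2^2)"
  by (simp add: vec_eq_iff column_def matrix_matrix_mult_def sum_2 mult.commute)

lemma funpow_hex_rotation: "((\<lambda>g. g ** hex_rotation) ^^ n) g = g ** ((\<lambda>g. g ** hex_rotation) ^^ n) (mat 1)"
  for g :: "real^2^2"
  by (induction n) (simp_all add: matrix_mul_assoc)

lemma hex_rotationsI: "m = ((\<lambda>g. g ** hex_rotation) ^^ n) (mat 1) \<Longrightarrow> m \<in> hex_rotations"
  unfolding hex_rotations_def by (auto simp: funpow_hex_rotation[symmetric])

text \<open>Among the 36 pairs of columns from \<open>H\<close>, determinant 1 leaves 12, two for
  each first column; the condition on the difference of the columns discards those whose second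
  column is two vertices further on. The remaining six are powers of the rotation.\<close>

lemma unimodular_hexagon_matrix:
  fixes m :: "real^2^2"
  assumes m: "det m = 1"
    and H: "H = {(1, 0), (-1, 0), (0, 1), (0, -1), (-1, 1), (1, -1)}"
    and c: "(m$1$1, m$2$1) \<in> H" "(m$1$2, m$2$2) \<in> H" "(m$1$2 - m$1$1, m$2$2 - m$2$1) \<in> H"
  shows "m \<in> hex_rotations"
proof -
  have d: "m$1$1 * m$2$2 - m$1$2 * m$2$1 = 1"
    using m by (simp add: det_2)
  define r where "r = (\<lambda>n. ((\<lambda>g. g ** hex_rotation) ^^ n) (mat 1 :: real^2^2))"
  have step: "r (Suc n) $ i = vector [r n $ i $ 2, r n $ i $ 2 - r n $ i $ 1]" for n i
    by (simp add: r_def row_mult_hex_rotation)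
  have r0: "r 0 $ i $ j = (if i = j then 1 else 0)" for i j
    by (simp add: r_def mat_def)
  have eqI: "m = r n" if "m$1$1 = r n $ 1 $ 1" "m$2$1 = r n $ 2 $ 1" "m$1$2 = r n $ 1 $ 2" "m$2$2 = r n $ 2 $ 2" for n
    using that by (simp add: vec_eq_iff forall_2)
  have "(m$1$1, m$2$1, m$1$2, m$2$2) \<in>
      {(1, 0, 0, 1), (0, 1, -1, 1), (-1, 1, -1, 0), (-1, 0, 0, -1), (0, -1, 1, -1), (1, -1, 1, 0)}"
  proof -
    have "(m$1$1, m$2$1, m$1$2, m$2$2) \<in>
      {(1, 0, 0, 1), (0, 1, -1, 1), (-1, 1, -1, 0), (-1, 0, 0, -1), (0, -1, 1, -1), (1, -1, 1, 0),
       (1, 0, -1, 1), (0, 1, -1, 0), (-1, 1, 0, -1), (-1, 0, 1, -1), (0, -1, 1, 0), (1, -1, 0, 1)}"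
      using c(1,2) d unfolding H by (elim insertE emptyE) simp_all
    then show ?thesis
      by (elim insertE emptyE; insert c(3)[unfolded H]; simp)
  qed
  then have "\<exists>n. m = r n"
  proof (elim insertE emptyE)
    assume "(m$1$1, m$2$1, m$1$2, m$2$2) = (1, 0, 0, 1)"
    then show ?thesis by (intro exI[of _ 0] eqI) (simp_all add: r0)
  next
    assume "(m$1$1, m$2$1, m$1$2, m$2$2) = (0, 1, -1, 1)"
    then show ?thesis by (intro exI[of _ "Suc 0"] eqI) (simp_all add: r0 step)
  next
    assume "(m$1$1, m$2$1, m$1$2, m$2$2) = (-1, 1, -1, 0)"
    then show ?thesis by (intro exI[of _ "Suc (Suc 0)"] eqI) (simp_all add: r0 step)
  next
    assume "(m$1$1, m$2$1, m$1$2, m$2$2) = (-1, 0, 0, -1)"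
    then show ?thesis by (intro exI[of _ "Suc (Suc (Suc 0))"] eqI) (simp_all add: r0 step)
  next
    assume "(m$1$1, m$2$1, m$1$2, m$2$2) = (0, -1, 1, -1)"
    then show ?thesis by (intro exI[of _ "Suc (Suc (Suc (Suc 0)))"] eqI) (simp_all add: r0 step)
  next
    assume "(m$1$1, m$2$1, m$1$2, m$2$2) = (1, -1, 1, 0)"
    then show ?thesis by (intro exI[of _ "Suc (Suc (Suc (Suc (Suc 0))))"] eqI) (simp_all add: r0 step)
  qed
  then show ?thesis
    unfolding r_def using hex_rotationsI by blast
qed

context critical_norm
begin

text \<open>The columns of the second frame and their difference are lattice vectors of norm 1, so
  their coordinates in the first frame are among the six of
  \<open>hexagon_lattice_points\<close>.\<close>

lemma hex_frames_SL2Z: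
  assumes g: "g \<in> hex_frames" and h: "g ** m \<in> hex_frames" and m: "m \<in> SL2Z"
  shows "m \<in> hex_rotations"
proof -
  have hex: "hexagon (column 1 g) (column 2 g)"
    using g by (simp add: hex_frames_def)
  let ?H = "{(1, 0), (-1, 0), (0, 1), (0, -1), (-1, 1), (1, -1)} :: (real \<times> real) set"
  have six: "(a, b) \<in> ?H" if ab: "a \<in> \<int>" "b \<in> \<int>" "N (a *\<^sub>R column 1 g + b *\<^sub>R column 2 g) = 1" for a b
  proof -
    obtain x y :: int where xy: "a = of_int x" "b = of_int y"
      using ab by (auto elim!: Ints_cases)
    have "(x, y) \<in> {(1, 0), (-1, 0), (0, 1), (0, -1), (-1, 1), (1, -1)}"
      using ab(3) unfolding xy by (rule hexagon_lattice_points[OF hex])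
    then show ?thesis
      unfolding xy by auto
  qed
  have int: "m $ i $ j \<in> \<int>" for i j
    using m by (simp add: SL2Z_def)
  have N1: "N (column 1 (g ** m)) = 1" "N (column 2 (g ** m)) = 1" "N (column 2 (g ** m) - column 1 (g ** m)) = 1"
    using h by (auto simp: hex_frames_def hexagon_def)
  show ?thesis
  proof (rule unimodular_hexagon_matrix[OF _ refl])
    show "det m = 1"
      using m by (simp add: SL2Z_def SL2R_def)
    show "(m$1$1, m$2$1) \<in> ?H"
      using N1(1) int by (intro six) (simp_all add: mult_column)
    show "(m$1$2, m$2$2) \<in> ?H"
      using N1(2) int by (intro six) (simp_all add: mult_column)
    have "column 2 (g ** m) - column 1 (g ** m) = (m$1$2 - m$1$1) *\<^sub>R column 1 g + (m$2$2 - m$2$1) *\<^sub>R column 2 g"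
      by (simp add: mult_column algebra_simps)
    then show "(m$1$2 - m$1$1, m$2$2 - m$2$1) \<in> ?H"
      using N1(3) int by (intro six) auto
  qed
qed

text \<open>The pairs \<open>(g, h)\<close> for which the quotient \<open>adj2 g ** h\<close> avoids
  the closed discrete set \<open>SL2Z - hex_rotations\<close> form an open set. It contains the
  compact square of \<open>hex_frames\<close>, hence a uniform neighbourhood of it.\<close>

lemma separated_neighbourhood:
  "\<exists>U. open U \<and> hex_frames \<subseteq> U \<and>
    (\<forall>g\<in>SL2R. \<forall>m\<in>SL2Z. g \<in> U \<longrightarrow> g ** m \<in> U \<longrightarrow> m \<in> hex_rotations)"
proof -
  define W where "W = {x. adj2 (fst x) ** snd x \<notin> SL2Z - hex_rotations}"
  have "W = (\<lambda>x. adj2 (fst x) ** snd x) -` (- (SL2Z - hex_rotations))"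
    by (auto simp: W_def)
  moreover have "closed (SL2Z - hex_rotations)"
    by (rule closed_subset_SL2Z) auto
  ultimately have W: "open W"
    using open_vimage[OF open_Compl continuous_on_adj2_mult] by (simp only:)
  have sub: "hex_frames \<times> hex_frames \<subseteq> W"
  proof
    fix x assume x: "x \<in> hex_frames \<times> hex_frames"
    let ?m = "adj2 (fst x) ** snd x"
    have "fst x ** ?m = snd x"
      using x by (auto simp: hex_frames_def adj2_cancel)
    then show "x \<in> W"
      unfolding W_def using hex_frames_SL2Z[of "fst x" ?m] x by auto
  qed
  obtain e where e: "e > 0" "(\<Union>x\<in>hex_frames \<times> hex_frames. ball x e) \<subseteq> W"
    using compact_subset_open_imp_ball_epsilon_subset[OF compact_Times[OF compact_hex_frames compact_hex_frames] W sub] .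
  define U where "U = (\<Union>x\<in>hex_frames. ball x (e / 2))"
  show ?thesis
  proof (intro exI[of _ U] conjI ballI impI)
    show "open U" "hex_frames \<subseteq> U"
      using e(1) by (auto simp: U_def)
    fix g m assume g: "g \<in> SL2R" "m \<in> SL2Z" "g \<in> U" "g ** m \<in> U"
    then obtain a b where ab: "a \<in> hex_frames" "b \<in> hex_frames" "dist a g < e / 2" "dist b (g ** m) < e / 2"
      by (auto simp: U_def)
    have "dist (a, b) (g, g ** m) \<le> dist a g + dist b (g ** m)"
      by (simp add: dist_Pair_Pair sqrt_sum_squares_le_sum)
    then have "(g, g ** m) \<in> ball (a, b) e"
      using ab by simp
    then have "(g, g ** m) \<in> W"
      using ab e(2) by blast
    then show "m \<in> hex_rotations"
      using g by (auto simp: W_def SL2R_def adj2_cancel)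
  qed
qed

text \<open>The oriented bases of the lattice form the closed set \<open>T\<close>. One minimizing
  the sum of the two norms is reduced, and \<open>reduced_basis_hexagon\<close> applies to
  it.\<close>

lemma exists_hex_frame:
  assumes g: "det g = 1"
    and adm: "\<And>x y :: int. x \<noteq> 0 \<or> y \<noteq> 0 \<Longrightarrow> N (of_int x *\<^sub>R column 1 g + of_int y *\<^sub>R column 2 g) \<ge> 1"
  shows "\<exists>m\<in>SL2Z. g ** m \<in> hex_frames"
proof -
  define T where "T = {h. adj2 g ** h \<in> SL2Z}"
  note cancel = adj2_cancel[OF g]
  define f where "f = (\<lambda>h :: real^2^2. N (column 1 h) + N (column 2 h))"
  have contf: "continuous_on UNIV f"
    unfolding f_def by (intro continuous_intros continuous_on_compose2[OF continuous]) auto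
  have "linear (\<lambda>h :: real^2^2. adj2 g ** h)"
    by (rule linearI) (simp_all add: vec_eq_iff matrix_matrix_mult_def sum_2 algebra_simps)
  then have "closed ((\<lambda>h. adj2 g ** h) -` SL2Z)"
    by (intro closed_vimage closed_subset_SL2Z linear_continuous_on) (auto simp: linear_conv_bounded_linear)
  then have closedT: "closed T"
    by (simp add: T_def vimage_def)
  have mat1: "mat 1 \<in> SL2Z"
    by (simp add: SL2Z_def SL2R_def det_I) (simp add: mat_def)
  have gT: "g \<in> T"
    using adj2[OF g] mat1 by (simp add: T_def)
  obtain C where C: "C > 0" "\<And>v. norm v \<le> C * N v"
    using norm_le by blast
  have "compact (T \<inter> {h. f h \<le> f g})"
  proof -
    have "closed {h. f h \<le> f g}"
      using contf by (intro closed_Collect_le) auto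
    moreover have "norm h \<le> 2 * (C * f g)" if "f h \<le> f g" for h
    proof -
      have "norm h \<le> 2 * (norm (column 1 h) + norm (column 2 h))"
        by (rule norm_matrix_le)
      also have "\<dots> \<le> 2 * (C * N (column 1 h) + C * N (column 2 h))"
        by (intro mult_left_mono add_mono C(2)) simp
      also have "\<dots> = 2 * (C * f h)"
        by (simp add: f_def algebra_simps)
      also have "\<dots> \<le> 2 * (C * f g)"
        using that C(1) by simp
      finally show ?thesis .
    qed
    then have "bounded {h. f h \<le> f g}"
      by (auto simp: bounded_iff)
    ultimately show ?thesis
      using closedT by (simp add: compact_eq_bounded_closed closed_Int bounded_Int)
  qed
  then obtain h where h: "h \<in> T" "f h \<le> f g" and min': "\<And>h'. h' \<in> T \<Longrightarrow> f h' \<le> f g \<Longrightarrow> f h \<le> f h'"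
    using continuous_attains_inf[of "T \<inter> {h. f h \<le> f g}" f] gT contf continuous_on_subset
    by (metis (no_types, lifting) Int_iff empty_iff mem_Collect_eq order_refl top_greatest)
  have min: "f h \<le> f h'" if "h' \<in> T" for h'
    using min'[OF that] h(2) by linarith
  have mult: "h ** m \<in> T" if "h \<in> T" "m \<in> SL2Z" for h m
    using that by (simp add: T_def matrix_mul_assoc SL2Z_mult)
  \<comment> \<open>The elementary moves: \<open>J\<close> exchanges the basis vectors up to sign,
    and \<open>S c\<close> adds \<open>c\<close> times the first to the second. Minimality against
    them yields the inequalities of a reduced basis.\<close>
  define J :: "real^2^2" where "J = vector [vector [0, -1], vector [1, 0]]"
  define S :: "real \<Rightarrow> real^2^2" where "S = (\<lambda>c. vector [vector [1, c], vector [0, 1]])"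
  have J: "J \<in> SL2Z" and S: "S 1 \<in> SL2Z" "S (-1) \<in> SL2Z"
    by (simp_all add: J_def S_def SL2Z_def SL2R_def det_2 forall_2)
  have colJ: "column 1 (h ** J) = column 2 h" "column 2 (h ** J) = - column 1 h" for h :: "real^2^2"
    by (simp_all add: mult_column J_def)
  have colS: "column 1 (h ** S c) = column 1 h" "column 2 (h ** S c) = column 2 h + c *\<^sub>R column 1 h" for h :: "real^2^2" and c
    by (simp_all add: mult_column S_def)
  have "\<exists>h\<in>T. f h \<le> f h' \<and> N (column 1 h) \<le> N (column 2 h)" if "h' = h" for h'
  proof (cases "N (column 1 h) \<le> N (column 2 h)")
    case False
    then show ?thesis
      using mult[OF h(1) J] that by (intro bexI[of _ "h ** J"]) (auto simp: f_def colJ)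
  qed (use h that in auto)
  then obtain h\<^sub>1 where h1: "h\<^sub>1 \<in> T" "f h\<^sub>1 \<le> f h" "N (column 1 h\<^sub>1) \<le> N (column 2 h\<^sub>1)"
    by blast
  let ?p = "column 1 h\<^sub>1" and ?q = "column 2 h\<^sub>1"
  define m where "m = adj2 g ** h\<^sub>1"
  have m: "m \<in> SL2Z" "h\<^sub>1 = g ** m"
    using h1(1) cancel by (auto simp: T_def m_def)
  have deth: "det h\<^sub>1 = 1"
    using m g by (simp add: det_mul SL2Z_def SL2R_def)
  have red: "N ?q \<le> N (?q + c *\<^sub>R ?p)" if "c = 1 \<or> c = -1" for c
  proof -
    have "h\<^sub>1 ** S c \<in> T"
      using that S mult[OF h1(1)] by auto
    then have "f h\<^sub>1 \<le> f (h\<^sub>1 ** S c)"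
      using min h1(2) by fastforce
    then show ?thesis
      by (simp add: f_def colS)
  qed
  have "N ?p = 1 \<and> N ?q = 1 \<and> (N (?q - ?p) = 1 \<or> N (?q + ?p) = 1)"
  proof (rule reduced_basis_hexagon)
    show "\<bar>cross2 ?p ?q\<bar> = 1"
      using deth by (simp add: det_eq_cross2)
    show "N ?q \<le> N (?q - ?p)" "N ?q \<le> N (?q + ?p)"
      using red[of 1] red[of "-1"] by simp_all
    show "N ?p \<le> N ?q"
      by (rule h1)
    fix x y :: int assume xy: "x \<noteq> 0 \<or> y \<noteq> 0"
    have int: "m $ i $ j \<in> \<int>" for i j
      using m by (simp add: SL2Z_def)
    define M where "M = (\<lambda>i j. \<lfloor>m $ i $ j\<rfloor>)"
    have M: "m $ i $ j = of_int (M i j)" for i j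
      using int[of i j] by (auto simp: M_def elim!: Ints_cases)
    have "of_int (M 1 1 * M 2 2 - M 1 2 * M 2 1) = (1 :: real)"
      using m(1) by (simp add: SL2Z_def SL2R_def det_2 M)
    then have det: "M 1 1 * M 2 2 - M 1 2 * M 2 1 = 1"
      by linarith
    have eq: "of_int x *\<^sub>R ?p + of_int y *\<^sub>R ?q = of_int (M 1 1 * x + M 1 2 * y) *\<^sub>R column 1 g + of_int (M 2 1 * x + M 2 2 * y) *\<^sub>R column 2 g"
      unfolding m(2) mult_column M by (simp add: algebra_simps)
    have "M 1 1 * x + M 1 2 * y \<noteq> 0 \<or> M 2 1 * x + M 2 2 * y \<noteq> 0"
    proof (rule ccontr)
      assume "\<not> ?thesis"
      then have z: "M 1 1 * x + M 1 2 * y = 0" "M 2 1 * x + M 2 2 * y = 0"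
        by auto
      have "x = M 2 2 * (M 1 1 * x + M 1 2 * y) - M 1 2 * (M 2 1 * x + M 2 2 * y)"
        "y = M 1 1 * (M 2 1 * x + M 2 2 * y) - M 2 1 * (M 1 1 * x + M 1 2 * y)"
        using det by algebra+
      then show False
        using xy unfolding z by simp
    qed
    then show "1 \<le> N (of_int x *\<^sub>R ?p + of_int y *\<^sub>R ?q)"
      unfolding eq by (rule adm)
  qed
  then consider "h\<^sub>1 \<in> hex_frames" | "h\<^sub>1 ** S 1 \<in> hex_frames"
  proof (elim conjE disjE)
    assume "N ?p = 1" "N ?q = 1" "N (?q - ?p) = 1"
    then show ?thesis
      using deth that(1) by (simp add: hex_frames_def hexagon_def det_eq_cross2)
  next
    \<comment> \<open>Here the third short vector is the sum, and the frame is \<open>?p\<close>,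
      \<open>?q + ?p\<close>, whose difference is \<open>?q\<close>.\<close>
    assume N1: "N ?p = 1" "N ?q = 1" "N (?q + ?p) = 1"
    have "det (h\<^sub>1 ** S 1) = 1"
      using deth S by (simp add: det_mul SL2Z_def SL2R_def)
    then have "h\<^sub>1 ** S 1 \<in> hex_frames"
      using N1 by (simp add: hex_frames_def hexagon_def det_eq_cross2 colS)
    then show ?thesis
      by (rule that(2))
  qed
  then obtain k where "k \<in> T" "k \<in> hex_frames"
    using h1(1) mult[OF h1(1) S(1)] by metis
  then show ?thesis
    using cancel by (intro bexI[of _ "adj2 g ** k"]) (auto simp: T_def)
qed

lemma hex_frame_angle:
  assumes "g \<in> hex_frames"
  shows "\<exists>t\<in>angles. frame_at t = g"
proof -
  obtain s t where "s > 0" "g$2 = s *\<^sub>R sin_row t"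
    using sin_row_polar[OF row_nonzero] assms by (auto simp: hex_frames_def)
  then have "frame_angle g t"
    using assms by (auto simp: frame_angle_def)
  then show ?thesis
    using frame_at_eq by (auto simp: angles_def)
qed

theorem hex_lattices_in_transversal_curve:
  "\<exists>Z. C1_submanifold 1 Z \<and> transversal F_group H_group Z \<and> (\<lambda>g. act g Z2) ` hex_frames \<subseteq> Z"
proof (cases "hex_frames = {}")
  case True
  then show ?thesis
    by (intro exI[of _ "{}"]) (simp add: C1_submanifold_def transversal_def)
next
  case False
  then have ne: "angles \<noteq> {}"
    using hex_frame_angle by blast
  obtain U where nb: "open U" "hex_frames \<subseteq> U"
    "\<And>g m. g \<in> SL2R \<Longrightarrow> g \<in> U \<Longrightarrow> m \<in> SL2Z \<Longrightarrow> g ** m \<in> U \<Longrightarrow> m \<in> hex_rotations"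
    using separated_neighbourhood by blast
  obtain y y' z z' where
    y: "\<forall>t. (y has_real_derivative y' t) (at t)" "continuous_on UNIV y'" "\<forall>t. y (t + pi / 3) = y t"
    and z: "\<forall>t. (z has_real_derivative z' t) (at t)" "continuous_on UNIV z'" "\<forall>t. z (t + pi / 3) = z t"
    and fr: "\<forall>t\<in>angles. frame_at t = iwasawa t (y t) (z t)"
    using coordinate_extension[OF ne] by blast
  interpret transversal_curve y y' z z' U
    by unfold_locales (use y z nb in auto)
  have "act g Z2 \<in> curve" if g: "g \<in> hex_frames" for g
  proof -
    obtain t where "t \<in> angles" "frame_at t = g"
      using hex_frame_angle[OF g] by blast
    then have "\<Gamma> t = g"
      using fr by (simp add: \<Gamma>_def)
    then show ?thesis
      using g nb(2) by (auto simp: curve_def)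
  qed
  then show ?thesis
    using C1_submanifold_curve transversal_curve by blast
qed

end

section \<open>From an arbitrary norm to critical determinant 1\<close>

lemma lattice_vector: "g *v v = (v$1) *\<^sub>R column 1 g + (v$2) *\<^sub>R column 2 (g :: real^2^2)"
  by (simp add: vec_eq_iff forall_2 matrix_vector_mult_def sum_2 column_def mult.commute)

lemma admissible_iff:
  assumes g: "det g \<noteq> 0" and \<nu>: "is_norm \<nu>" and r: "r > 0"
  shows "act g Z2 \<inter> {v. \<nu> v < r} = {0} \<longleftrightarrow>
    (\<forall>x y :: int. x \<noteq> 0 \<or> y \<noteq> 0 \<longrightarrow> \<nu> (of_int x *\<^sub>R column 1 g + of_int y *\<^sub>R column 2 g) \<ge> r)"
proof -
  interpret plane_norm \<nu>
    by unfold_locales (rule \<nu>)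
  have inZ2: "vector [of_int x, of_int y] \<in> Z2" for x y :: int
    by (simp add: Z2_def forall_2)
  have cr: "cross2 (column 1 g) (column 2 g) \<noteq> 0"
    using g by (simp add: det_eq_cross2)
  have nz: "of_int x *\<^sub>R column 1 g + of_int y *\<^sub>R column 2 g \<noteq> 0" if "x \<noteq> 0 \<or> y \<noteq> 0" for x y :: int
  proof
    assume z: "of_int x *\<^sub>R column 1 g + of_int y *\<^sub>R column 2 g = 0"
    have "cross2 (of_int x *\<^sub>R column 1 g + of_int y *\<^sub>R column 2 g) (column 2 g) = of_int x * cross2 (column 1 g) (column 2 g)"
      "cross2 (column 1 g) (of_int x *\<^sub>R column 1 g + of_int y *\<^sub>R column 2 g) = of_int y * cross2 (column 1 g) (column 2 g)"
      by (simp_all add: cross2_def algebra_simps)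
    then show False
      using cr that unfolding z by (simp add: cross2_def)
  qed
  show ?thesis
  proof (intro iffI allI impI)
    fix x y :: int
    assume eq: "act g Z2 \<inter> {v. \<nu> v < r} = {0}" and xy: "x \<noteq> 0 \<or> y \<noteq> 0"
    have "g *v vector [of_int x, of_int y] \<in> act g Z2"
      using inZ2 by (auto simp: act_def)
    then have "of_int x *\<^sub>R column 1 g + of_int y *\<^sub>R column 2 g \<in> act g Z2"
      by (simp add: lattice_vector)
    then show "r \<le> \<nu> (of_int x *\<^sub>R column 1 g + of_int y *\<^sub>R column 2 g)"
      using eq nz[OF xy] by (metis (no_types, lifting) IntI mem_Collect_eq not_le singletonD)
  next
    assume adm: "\<forall>x y :: int. x \<noteq> 0 \<or> y \<noteq> 0 \<longrightarrow> r \<le> \<nu> (of_int x *\<^sub>R column 1 g + of_int y *\<^sub>R column 2 g)"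
    show "act g Z2 \<inter> {v. \<nu> v < r} = {0}"
    proof (intro equalityI subsetI)
      fix w assume w: "w \<in> act g Z2 \<inter> {v. \<nu> v < r}"
      then obtain v where v: "v \<in> Z2" "w = g *v v"
        by (auto simp: act_def)
      then obtain x y :: int where xy: "v$1 = of_int x" "v$2 = of_int y"
        unfolding Z2_def Ints_def by blast
      have "\<nu> (of_int x *\<^sub>R column 1 g + of_int y *\<^sub>R column 2 g) < r"
        using w by (simp add: v lattice_vector xy)
      then have "x = 0 \<and> y = 0"
        using adm not_le by blast
      then show "w \<in> {0}"
        by (simp add: v lattice_vector xy)
    next
      fix w :: "real^2" assume "w \<in> {0}"
      moreover have "0 \<in> act g Z2"
        unfolding act_def by (rule image_eqI[of _ _ 0]) (auto simp: Z2_def)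
      ultimately show "w \<in> act g Z2 \<inter> {v. \<nu> v < r}"
        using r by simp
    qed
  qed
qed

lemma parallelogram_scale:
  assumes "parallelogram P" "c \<noteq> 0"
  shows "parallelogram ((\<lambda>v. c *\<^sub>R v) ` P)"
proof -
  obtain p a b where ab: "a \<noteq> b" "independent {a, b}"
    and P: "P = {p + s *\<^sub>R a + t *\<^sub>R b | s t. s \<in> {0..1} \<and> t \<in> {0..1}}"
    using assms(1) unfolding parallelogram_def by blast
  have "independent ((\<lambda>v. c *\<^sub>R v) ` {a, b})"
    using ab(2) assms(2) by (intro linear_independent_injective_image linear_scaleR) (auto simp: inj_on_def)
  moreover have "c *\<^sub>R a \<noteq> c *\<^sub>R b"
    using ab assms by simp
  moreover have "(\<lambda>v. c *\<^sub>R v) ` P = {c *\<^sub>R p + s *\<^sub>R (c *\<^sub>R a) + t *\<^sub>R (c *\<^sub>R b) | s t. s \<in> {0..1} \<and> t \<in> {0..1}}"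
  proof -
    have eq: "c *\<^sub>R p + s *\<^sub>R (c *\<^sub>R a) + t *\<^sub>R (c *\<^sub>R b) = c *\<^sub>R (p + s *\<^sub>R a + t *\<^sub>R b)" for s t
      by (simp add: algebra_simps)
    show ?thesis
      unfolding P eq by blast
  qed
  ultimately show ?thesis
    unfolding parallelogram_def by (intro exI[of _ "c *\<^sub>R p"] exI[of _ "c *\<^sub>R a"] exI[of _ "c *\<^sub>R b"]) auto
qed

text \<open>A lattice admissible for the rescaled norm becomes admissible for \<open>\<nu>\<close>
  when stretched by \<open>sqrt (critical_det \<nu>)\<close>. This multiplies the covolume by
  \<open>critical_det \<nu>\<close>, so the infimum bounds the original covolume below by 1.\<close>

lemma critical_norm_rescaled:
  assumes \<nu>: "is_norm \<nu>" and par: "\<not> parallelogram {v. \<nu> v \<le> 1}" and \<Delta>: "critical_det \<nu> > 0"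
  shows "critical_norm (\<lambda>v. sqrt (critical_det \<nu>) * \<nu> v)"
proof
  interpret plane_norm \<nu>
    by unfold_locales (rule \<nu>)
  define c where "c = sqrt (critical_det \<nu>)"
  have c: "c > 0" "c * c = critical_det \<nu>"
    using \<Delta> by (auto simp: c_def)
  show "is_norm (\<lambda>v. sqrt (critical_det \<nu>) * \<nu> v)"
    unfolding is_norm_def c_def[symmetric]
    using c(1) triangle by (auto simp: nonneg eq_0_iff scale distrib_left[symmetric])
  have "{v. \<nu> v \<le> 1} = (\<lambda>v. c *\<^sub>R v) ` {v. c * \<nu> v \<le> 1}"
  proof (intro equalityI subsetI)
    fix v assume "v \<in> {v. \<nu> v \<le> 1}"
    then show "v \<in> (\<lambda>v. c *\<^sub>R v) ` {v. c * \<nu> v \<le> 1}"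
      using c(1) by (intro image_eqI[of _ _ "(1 / c) *\<^sub>R v"]) (auto simp: scale)
  qed (use c(1) in \<open>auto simp: scale\<close>)
  then show "\<not> parallelogram {v. sqrt (critical_det \<nu>) * \<nu> v \<le> 1}"
    using par parallelogram_scale[of _ c] c(1) by (auto simp: c_def[symmetric])
  fix P Q
  assume PQ: "cross2 P Q \<noteq> 0" and adm: "\<And>x y :: int. x \<noteq> 0 \<or> y \<noteq> 0 \<Longrightarrow>
      1 \<le> sqrt (critical_det \<nu>) * \<nu> (of_int x *\<^sub>R P + of_int y *\<^sub>R Q)"
  define g where "g = frame (c *\<^sub>R P) (c *\<^sub>R Q)"
  have det: "det g = critical_det \<nu> * cross2 P Q"
    by (simp add: det_eq_cross2 g_def cross2_scale_left cross2_scale_right c(2)[symmetric])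
  have g: "det g \<noteq> 0"
    using det PQ \<Delta> by simp
  have "act g Z2 \<inter> {v. \<nu> v < 1} = {0}"
    unfolding admissible_iff[OF g \<nu> zero_less_one]
  proof (intro allI impI)
    fix x y :: int assume "x \<noteq> 0 \<or> y \<noteq> 0"
    then have "1 \<le> c * \<nu> (of_int x *\<^sub>R P + of_int y *\<^sub>R Q)"
      using adm by (simp add: c_def)
    also have "\<dots> = \<nu> (c *\<^sub>R (of_int x *\<^sub>R P + of_int y *\<^sub>R Q))"
      using c(1) by (simp add: scale)
    finally show "1 \<le> \<nu> (of_int x *\<^sub>R column 1 g + of_int y *\<^sub>R column 2 g)"
      by (simp add: g_def algebra_simps)
  qed
  then have mem: "\<bar>det g\<bar> \<in> {\<bar>det g\<bar> | g. det g \<noteq> 0 \<and> act g Z2 \<inter> {v. \<nu> v < 1} = {0}}"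
    using g by blast
  have "bdd_below {\<bar>det g\<bar> | g :: real^2^2. det g \<noteq> 0 \<and> act g Z2 \<inter> {v. \<nu> v < 1} = {0}}"
    by (rule bdd_belowI[of _ 0]) (elim CollectE exE conjE, simp)
  with mem have "critical_det \<nu> \<le> \<bar>det g\<bar>"
    unfolding critical_det_def by (rule cInf_lower)
  then show "1 \<le> \<bar>cross2 P Q\<bar>"
    using \<Delta> by (simp add: det abs_mult)
qed

theorem theorem3p11:
  fixes \<nu> :: "real^2 \<Rightarrow> real"
  assumes "is_norm \<nu>"
    and "\<not> parallelogram {v. \<nu> v \<le> 1}"
  shows "\<exists>Z. C1_submanifold 1 Z \<and> transversal F_group H_group Z \<and> critical_locus \<nu> \<subseteq> Z"
proof (cases "critical_det \<nu> > 0")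
  case False
  interpret plane_norm \<nu>
    by unfold_locales (rule assms)
  \<comment> \<open>A radius at most 0, also through \<open>1 / 0 = 0\<close>, makes the open ball
    empty; it cannot meet a lattice in \<open>{0}\<close>, so the locus is empty.\<close>
  have "1 / sqrt (critical_det \<nu>) \<le> 0"
    using False by simp
  then have "\<not> \<nu> v < 1 / sqrt (critical_det \<nu>)" for v
    using nonneg[of v] by linarith
  then have "{v. \<nu> v < 1 / sqrt (critical_det \<nu>)} = {}"
    by blast
  then have "critical_locus \<nu> = {}"
    by (auto simp: critical_locus_def)
  then show ?thesis
    by (intro exI[of _ "{}"]) (simp add: C1_submanifold_def transversal_def)
next
  case True
  define c where "c = sqrt (critical_det \<nu>)"
  have c: "c > 0"
    using True by (simp add: c_def)
  interpret critical_norm "\<lambda>v. c * \<nu> v"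
    unfolding c_def by (rule critical_norm_rescaled[OF assms True])
  have "critical_locus \<nu> \<subseteq> (\<lambda>g. act g Z2) ` hex_frames"
  proof
    fix \<Lambda> assume "\<Lambda> \<in> critical_locus \<nu>"
    then obtain g where g: "det g = 1" "\<Lambda> = act g Z2" "act g Z2 \<inter> {v. \<nu> v < 1 / c} = {0}"
      by (auto simp: critical_locus_def space_X_def orbit_def SL2R_def c_def)
    have "\<forall>x y :: int. x \<noteq> 0 \<or> y \<noteq> 0 \<longrightarrow> 1 / c \<le> \<nu> (of_int x *\<^sub>R column 1 g + of_int y *\<^sub>R column 2 g)"
      using g(3) admissible_iff[OF _ assms(1), of g "1 / c"] g(1) c by simp
    then have "\<exists>m\<in>SL2Z. g ** m \<in> hex_frames"
      using c by (intro exists_hex_frame[OF g(1)]) (simp add: pos_divide_le_eq mult.commute)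
    then obtain m where m: "m \<in> SL2Z" "g ** m \<in> hex_frames"
      by blast
    have "act (g ** m) Z2 = \<Lambda>"
      using g(2) m(1) by (simp add: act_mult SL2Z_preserves_Z2)
    then show "\<Lambda> \<in> (\<lambda>g. act g Z2) ` hex_frames"
      using m(2) by blast
  qed
  then show ?thesis
    using hex_lattices_in_transversal_curve by blast
qed

end
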